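(* Let $\omega$ be a non-quasianalytic subadditive weight function, $g\in\mathcal{S}_\omega(\mathbb R^d)\setminus\{0\}$ with $\operatorname{supp}g\subseteq[A_1,B_1]\times\cdots\times[A_d,B_d]$, $\alpha>0$ and $\{\beta_n\}_{n\in\mathbb Z^d}\subset(0,\infty)$ such that $1/\beta_n\ge\max_{1\le j\le d}(B_j-A_j)$ for all $n$, and $$\inf_{t\in\mathbb R^d}\sum_{n\in\mathbb Z^d}\beta_n^{-d}|g(t-\alpha n)|^2>0,\qquad\sup_{t\in\mathbb R^d}\sum_{n\in\mathbb Z^d}\beta_n^{-d}|g(t-\alpha n)|^2<+\infty.$$ Set $g_{m,n}(t)=e^{i\beta_n m\cdot t}g(t-\alpha n)=\Pi(\alpha n,\beta_n m)g(t)$. Then for every $u\in\mathcal{S}'_\omega(\mathbb R^d)$, $$\mathrm{WF}'_\omega(u)=\mathrm{WF}^{\{g_{m,n}\}}_\omega(u).$$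
   Context: A non-quasianalytic subadditive weight function is a continuous increasing function $\omega:[0,+\infty)\to[0,+\infty)$ such that: ($\alpha$) $\omega(t_1+t_2)\le\omega(t_1)+\omega(t_2)$ for all $t_1,t_2\ge0$; ($\beta$) $\int_1^{+\infty}\omega(t)t^{-2}\,dt<+\infty$; ($\gamma$) there exist $a\in\mathbb R$, $b>0$ with $\omega(t)\ge a+b\log(1+t)$ for all $t\ge0$; ($\delta$) $\varphi(t):=\omega(e^t)$ is convex. $\omega(\zeta):=\omega(|\zeta|)$ for vectors $\zeta$. $\mathcal{S}_\omega(\mathbb R^d)$ is the set of Schwartz functions $f$ with $\sup_x|D^\alpha f(x)|e^{\lambda\omega(x)}<\infty$ and $\sup_\xi|D^\alpha\hat f(\xi)|e^{\lambda\omega(\xi)}<\infty$ for all $\lambda>0$, $\alpha\in\mathbb N_0^d$, where $\hat f(\xi)=\int f(x)e^{-ix\cdot\xi}dx$; $\mathcal{S}'_\omega$ is its strong dual, duality conjugate-linear in the second slot. $\Pi(x,\xi)f(t)=e^{it\cdot\xi}f(t-x)$, $V_\psi u(z)=\langle u,\Pi(z)\psi\rangle$. $\mathrm{WF}'_\omega(u)$: fix $\psi\in\mathcal{S}_\omega(\mathbb R^d)\setminus\{0\}$; $z_0\in\mathbb R^{2d}\setminus\{0\}$ is not in $\mathrm{WF}'_\omega(u)$ iff there is an open conic $\Gamma\subseteq\mathbb R^{2d}\setminus\{0\}$ containing $z_0$ with $\sup_{z\in\Gamma}e^{\lambda\omega(z)}|V_\psi u(z)|<\infty$ for all $\lambda>0$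 (independent of $\psi$). $\mathrm{WF}^{\{g_{m,n}\}}_\omega(u)$: $z_0\in\mathbb R^{2d}\setminus\{0\}$ is not in it iff there is an open conic $\Gamma\subseteq\mathbb R^{2d}\setminus\{0\}$ containing $z_0$ with $\sup\{e^{\lambda\omega(\alpha n,\beta_n m)}|\langle u,g_{m,n}\rangle|: m,n\in\mathbb Z^d,\ (\alpha n,\beta_n m)\in\Gamma\}<\infty$ for all $\lambda>0$. *)

theory Defs
  imports "HOL-Analysis.Analysis"
begin

definition weight_fn :: "(real \<Rightarrow> real) \<Rightarrow> bool" where
  "weight_fn \<omega> \<longleftrightarrow>
     continuous_on {0..} \<omega> \<and> mono_on {0..} \<omega> \<and> (\<forall>t\<ge>0. 0 \<le> \<omega> t) \<and>
     (\<forall>t1\<ge>0. \<forall>t2\<ge>0. \<omega> (t1 + t2) \<le> \<omega> t1 + \<omega> t2) \<and>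
     set_integrable lborel {1..} (\<lambda>t. \<omega> t / t^2) \<and>
     (\<exists>a b. b > 0 \<and> (\<forall>t\<ge>0. a + b * ln (1 + t) \<le> \<omega> t)) \<and>
     convex_on UNIV (\<lambda>t. \<omega> (exp t))"

definition partial_deriv :: "'n::finite \<Rightarrow> (real^'n \<Rightarrow> complex) \<Rightarrow> real^'n \<Rightarrow> complex" where
  "partial_deriv j f x = vector_derivative (\<lambda>s. f (x + s *\<^sub>R axis j 1)) (at 0)"

text \<open>Iterated partial derivatives; a list of directions encodes a multi-index
  (every multi-index arises, order is irrelevant for smooth functions).\<close>
fun Dl :: "'n::finite list \<Rightarrow> (real^'n \<Rightarrow> complex) \<Rightarrow> real^'n \<Rightarrow> complex" where
  "Dl [] f = f"
| "Dl (j # js) f = partial_deriv j (Dl js f)"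

definition FT :: "(real^'n::finite \<Rightarrow> complex) \<Rightarrow> real^'n \<Rightarrow> complex" where
  "FT f \<xi> = (LINT x|lborel. f x * cis (- (x \<bullet> \<xi>)))"

definition S_omega :: "(real \<Rightarrow> real) \<Rightarrow> (real^'n::finite \<Rightarrow> complex) set" where
  "S_omega \<omega> = {f. (\<forall>ks x. Dl ks f differentiable (at x)) \<and>
     (\<forall>lam>0. \<forall>ks.
        bdd_above (range (\<lambda>x. norm (Dl ks f x) * exp (lam * \<omega> (norm x)))) \<and>
        bdd_above (range (\<lambda>\<xi>. norm (Dl ks (FT f) \<xi>) * exp (lam * \<omega> (norm \<xi>)))))}"

definition semi :: "(real \<Rightarrow> real) \<Rightarrow> real \<Rightarrow> 'n::finite list \<Rightarrow> (real^'n \<Rightarrow> complex) \<Rightarrow> real" where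
  "semi \<omega> lam ks f =
     (SUP x. norm (Dl ks f x) * exp (lam * \<omega> (norm x))) +
     (SUP \<xi>. norm (Dl ks (FT f) \<xi>) * exp (lam * \<omega> (norm \<xi>)))"

definition S_dual :: "(real \<Rightarrow> real) \<Rightarrow> ((real^'n::finite \<Rightarrow> complex) \<Rightarrow> complex) set" where
  "S_dual \<omega> = {u.
     (\<forall>f\<in>S_omega \<omega>. \<forall>g\<in>S_omega \<omega>. \<forall>c. u (\<lambda>t. c * f t + g t) = cnj c * u f + u g) \<and>
     (\<exists>C N lam. lam > 0 \<and> (\<forall>f\<in>S_omega \<omega>.
        norm (u f) \<le> C * (\<Sum>ks\<in>{ks::'n list. length ks \<le> N}. semi \<omega> lam ks f)))}"

definition tf_shift :: "real^'n::finite \<Rightarrow> real^'n \<Rightarrow> (real^'n \<Rightarrow> complex) \<Rightarrow> real^'n \<Rightarrow> complex" where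
  "tf_shift x \<xi> f t = cis (t \<bullet> \<xi>) * f (t - x)"

definition STFT :: "(real^'n::finite \<Rightarrow> complex) \<Rightarrow> ((real^'n \<Rightarrow> complex) \<Rightarrow> complex)
    \<Rightarrow> (real^'n) \<times> (real^'n) \<Rightarrow> complex" where
  "STFT \<psi> u z = u (tf_shift (fst z) (snd z) \<psi>)"

definition open_cone :: "((real^'n::finite) \<times> (real^'n)) set \<Rightarrow> bool" where
  "open_cone \<Gamma> \<longleftrightarrow> open \<Gamma> \<and> 0 \<notin> \<Gamma> \<and> (\<forall>z\<in>\<Gamma>. \<forall>s>0. s *\<^sub>R z \<in> \<Gamma>)"

definition WF_stft :: "(real \<Rightarrow> real) \<Rightarrow> (real^'n::finite \<Rightarrow> complex)
    \<Rightarrow> ((real^'n \<Rightarrow> complex) \<Rightarrow> complex) \<Rightarrow> ((real^'n) \<times> (real^'n)) set" where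
  "WF_stft \<omega> \<psi> u = {z0. z0 \<noteq> 0 \<and> \<not> (\<exists>\<Gamma>. open_cone \<Gamma> \<and> z0 \<in> \<Gamma> \<and>
      (\<forall>lam>0. bdd_above ((\<lambda>z. exp (lam * \<omega> (norm z)) * norm (STFT \<psi> u z)) ` \<Gamma>)))}"

definition ivec :: "int^'n::finite \<Rightarrow> real^'n" where
  "ivec n = (\<chi> j. real_of_int (n $ j))"

definition gabor :: "(real^'n::finite \<Rightarrow> complex) \<Rightarrow> real \<Rightarrow> (int^'n \<Rightarrow> real)
    \<Rightarrow> int^'n \<Rightarrow> int^'n \<Rightarrow> real^'n \<Rightarrow> complex" where
  "gabor g \<alpha> \<beta> m n = tf_shift (\<alpha> *\<^sub>R ivec n) (\<beta> n *\<^sub>R ivec m) g"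

definition WF_gabor :: "(real \<Rightarrow> real) \<Rightarrow> (real^'n::finite \<Rightarrow> complex) \<Rightarrow> real \<Rightarrow> (int^'n \<Rightarrow> real)
    \<Rightarrow> ((real^'n \<Rightarrow> complex) \<Rightarrow> complex) \<Rightarrow> ((real^'n) \<times> (real^'n)) set" where
  "WF_gabor \<omega> g \<alpha> \<beta> u = {z0. z0 \<noteq> 0 \<and> \<not> (\<exists>\<Gamma>. open_cone \<Gamma> \<and> z0 \<in> \<Gamma> \<and>
      (\<forall>lam>0. bdd_above
         {exp (lam * \<omega> (norm (\<alpha> *\<^sub>R ivec n, \<beta> n *\<^sub>R ivec m))) * norm (u (gabor g \<alpha> \<beta> m n)) |
            m n. (\<alpha> *\<^sub>R ivec n, \<beta> n *\<^sub>R ivec m) \<in> \<Gamma>}))}"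

end

theory Submission
  imports Defs
begin

text \<open>Both inclusions transfer decay of \<open>u\<close> tested on time-frequency shifts of one window to shifts of
  another window on a smaller cone.

  From the Gabor system to an arbitrary window \<open>f\<close>: since \<open>g\<close> has compact support, every shift of \<open>f\<close> is
  a series in the \<open>g\<^sub>m\<^sub>n\<close>. Indeed \<open>G(t) = \<Sum>\<^sub>n \<bar>g(t - \<alpha>n)\<bar>\<^sup>2\<close> is \<open>\<alpha>\<close>-periodic and bounded below, so with
  \<open>\<gamma> = g* / G\<close> one has \<open>\<Sum>\<^sub>n \<gamma>(t - \<alpha>n) g(t - \<alpha>n) = 1\<close>, and each \<open>f \<gamma>(\<cdot> - \<alpha>n)\<close> is expanded into a Fourier
  series of period \<open>2\<pi> / \<beta>\<^sub>n\<close>. The coefficients decay like \<open>exp(-\<lambda>\<omega>)\<close> of the distance between the two shifts;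
  the point is that \<open>1 / G\<close> stays in the class, which follows from a Neumann series and \<open>\<omega>(t) = o(t)\<close>.
  Applying \<open>u\<close> termwise, the terms with \<open>g\<^sub>m\<^sub>n\<close> in the cone decay by hypothesis, the others by distance.

  Conversely, multiplying \<open>\<psi>\<close> by a translate \<open>h\<close> of \<open>g\<close> gives a compactly supported window, whose shifts are limits
  of superpositions of modulations of shifts of \<open>\<psi>\<close> (expand periodizations of \<open>h\<close> with period tending
  to infinity); the first part, applied to the window \<open>h \<psi>\<close> and a fine lattice, then reaches \<open>g\<close>.\<close>

text \<open>The steps \<open>\<beta> n\<close> depend on \<open>n\<close>, so the points
  \<open>(\<alpha> n, \<beta> n m)\<close> need not form a lattice; each translate of
  \<open>g\<close> is treated on its own by a Fourier series whose period 2 pi / \<beta> n exceeds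
  the sides of the support box. The hypotheses bound sums weighted by powers of \<beta> n, which
  need not be periodic. They serve to enclose all \<beta> n between two positive constants: the
  upper bound on the sum keeps \<beta> n away from 0, a support of positive width keeps it bounded.
  The unweighted sum G then inherits the lower bound, and G is periodic. Decay is always required
  for every exponent, so each step may pay a fixed number of exponents for separating cones,
  absorbing the growth of \<open>u\<close> and summing over lattices. Since \<open>u\<close> is a
  functional, it is only ever applied to series that converge in all seminorms; where an integral
  superposition would be natural, lattice sums of mesh k with bounds uniform in k replace it. In the
  converse, the product window need not satisfy a lower bound for the given \<open>\<alpha>\<close>,
  hence the fresh lattice.\<close>

locale weight =
  fixes \<omega> :: "real \<Rightarrow> real"
  assumes weight: "weight_fn \<omega>"
begin

section \<open>Weight functions: subadditivity, growth and sublinearity\<close>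

abbreviation decay :: "real \<Rightarrow> 'a::real_normed_vector \<Rightarrow> real" where
  "decay lam x \<equiv> exp (- (lam * \<omega> (norm x)))"

lemma weight_nonneg: "0 \<le> t \<Longrightarrow> 0 \<le> \<omega> t"
  using weight by (auto simp: weight_fn_def)

lemma weight_norm_nonneg [simp]: "0 \<le> \<omega> (norm x)"
  by (simp add: weight_nonneg)

lemma weight_mono: "0 \<le> s \<Longrightarrow> s \<le> t \<Longrightarrow> \<omega> s \<le> \<omega> t"
  using weight by (auto simp: weight_fn_def mono_on_def)

lemma weight_subadd: "0 \<le> s \<Longrightarrow> 0 \<le> t \<Longrightarrow> \<omega> (s + t) \<le> \<omega> s + \<omega> t"
  using weight by (auto simp: weight_fn_def)

lemma weight_norm_add: "\<omega> (norm (x + y)) \<le> \<omega> (norm x) + \<omega> (norm y)"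
  by (rule order_trans[OF weight_mono weight_subadd]) (auto intro: norm_triangle_ineq)

lemma weight_norm_diff: "\<omega> (norm x) \<le> \<omega> (norm (x - y)) + \<omega> (norm y)"
  using weight_norm_add[of "x - y" y] by simp

lemma weight_norm_diff': "\<omega> (norm x) \<le> \<omega> (norm (y - x)) + \<omega> (norm y)"
  using weight_norm_diff[of x y] by (simp add: norm_minus_commute)

lemma weight_norm_Pair: "\<omega> (norm (x, y)) \<le> \<omega> (norm x) + \<omega> (norm y)"
  by (rule order_trans[OF weight_mono weight_subadd]) (auto intro: norm_Pair_le)

text \<open>Stated for \<open>Suc N\<close> because at factor 0 it would read
  \<open>\<omega> 0 \<le> 0\<close>, which a weight need not satisfy.\<close>

lemma weight_multiple: "0 \<le> t \<Longrightarrow> \<omega> (real (Suc N) * t) \<le> real (Suc N) * \<omega> t"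
proof (induction N)
  case (Suc N)
  have "\<omega> (real (Suc (Suc N)) * t) = \<omega> (real (Suc N) * t + t)"
    by (simp add: algebra_simps)
  also have "\<dots> \<le> \<omega> (real (Suc N) * t) + \<omega> t"
    using Suc.prems by (intro weight_subadd) auto
  also have "\<dots> \<le> real (Suc N) * \<omega> t + \<omega> t"
    using Suc by simp
  finally show ?case by (simp add: algebra_simps)
qed simp

text \<open>Exponentiating the logarithmic minorant of the weight turns powers into exponentials.
  Every later estimate absorbs polynomial factors this way and gains the decay needed to sum over
  lattices.\<close>

lemma power_le_exp_weight: "\<exists>lam C. lam > 0 \<and> C > 0 \<and> (\<forall>t\<ge>0. (1 + t) ^ N \<le> C * exp (lam * \<omega> t))"
proof -
  obtain a b where b: "b > 0" and ab: "\<And>t. t \<ge> 0 \<Longrightarrow> a + b * ln (1 + t) \<le> \<omega> t"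
    using weight by (auto simp: weight_fn_def)
  \<comment> \<open>The summand 1 in the exponent keeps it positive when
    \<open>N = 0\<close>.\<close>
  have "(1 + t) ^ N \<le> exp (- N * a / b) * exp ((N / b + 1) * \<omega> t)" if t: "t \<ge> 0" for t
  proof -
    have "ln (1 + t) \<le> (\<omega> t - a) / b"
      using ab[OF t] b by (simp add: field_simps)
    then have "N * ln (1 + t) \<le> N * ((\<omega> t - a) / b)"
      by (intro mult_left_mono) auto
    also have "\<dots> \<le> - N * a / b + (N / b + 1) * \<omega> t"
      using weight_nonneg[OF t] b by (simp add: field_simps)
    finally have "exp (N * ln (1 + t)) \<le> exp (- N * a / b + (N / b + 1) * \<omega> t)"
      by simp
    moreover have "exp (N * ln (1 + t)) = (1 + t) ^ N"
      using t by (simp add: exp_of_nat_mult)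
    ultimately show ?thesis
      by (simp only: exp_add)
  qed
  moreover have "N / b + 1 > 0" using b by (simp add: add_nonneg_pos)
  ultimately show ?thesis using exp_gt_zero by blast
qed

lemma exp_weight_le_inverse_power:
  "\<exists>lam C. lam > 0 \<and> C > 0 \<and> (\<forall>t\<ge>0. exp (- (lam * \<omega> t)) \<le> C / (1 + t) ^ N)"
proof -
  obtain lam C where *: "lam > 0" "C > 0" "\<forall>t\<ge>0. (1 + t) ^ N \<le> C * exp (lam * \<omega> t)"
    using power_le_exp_weight by blast
  show ?thesis
    using * by (intro exI[of _ lam] exI[of _ C]) (auto simp: exp_minus field_simps)
qed

text \<open>Nonquasianalyticity enters here. By monotonicity \<omega>(s)/s, which is the integral of
  \<omega>(s)/t^2 over t \<ge> s, is at most the integral of \<omega>(t)/t^2 over t \<ge> s, a tail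
  of a convergent integral. The integral of 1/t^2 is first taken over \<open>{s..s+r}\<close>, and
  then \<open>r\<close> tends to infinity.\<close>

lemma weight_sublinear: assumes "\<epsilon> > 0" shows "\<exists>T. \<forall>t\<ge>T. \<omega> t \<le> \<epsilon> * t"
proof -
  define f where "f = (\<lambda>t. indicator {1..} t *\<^sub>R (\<omega> t / t^2))"
  have f: "integrable lborel f"
    using weight by (simp add: weight_fn_def set_integrable_def f_def)
  have "((\<lambda>k. LINT t:{real k..}|lborel. f t) \<longlongrightarrow> (LINT t:(\<Inter>k. {real k..})|lborel. f t)) sequentially"
    by (intro set_integral_cont_down)
      (auto simp: antimono_def set_integrable_def
        intro!: integrable_mult_indicator[of _ lborel f, unfolded real_scaleR_def] f)
  moreover have "(\<Inter>k. {real k..}) = {}"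
  proof -
    have "\<exists>k. \<not> real k \<le> x" for x
      using reals_Archimedean2[of x] by (auto simp: not_le)
    then show ?thesis by blast
  qed
  ultimately have "(\<lambda>k. LINT t:{real k..}|lborel. f t) \<longlonglongrightarrow> 0"
    by (simp add: set_lebesgue_integral_def)
  from LIMSEQ_D[OF this assms] obtain k0
    where k0: "\<And>k. k \<ge> k0 \<Longrightarrow> norm ((LINT t:{real k..}|lborel. f t) - 0) < \<epsilon>"
    by blast
  define k where "k = max k0 1"
  have k: "norm (LINT t:{real k..}|lborel. f t) < \<epsilon>" "k \<ge> 1"
    using k0[of k] by (auto simp: k_def)
  show ?thesis
  proof (intro exI[of _ "real k"] allI impI)
    fix s assume s: "real k \<le> s"
    with k have s1: "s \<ge> 1" by simp
    have fnn: "f t \<ge> 0" for t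
      using weight_nonneg by (auto simp: f_def indicator_def)
    have *: "\<omega> s * (indicator {s..s+r} t / t^2) \<le> indicator {real k..} t * f t" for r t
      using s s1 k(2) weight_mono[of s t] weight_nonneg[of t]
      by (auto simp: indicator_def f_def divide_right_mono)
    have fin: "\<omega> s * (1 / s - 1 / (s + r)) \<le> (LINT t:{real k..}|lborel. f t)" if r: "r > 0" for r
    proof -
      have hi: "has_bochner_integral lborel (\<lambda>t. indicator {s..s+r} t *\<^sub>R (1 / t^2)) (- 1 / (s + r) - - 1 / s)"
        by (rule has_bochner_integral_FTC_Icc)
          (use s1 r in \<open>auto intro!: derivative_eq_intros continuous_intros
             simp: has_real_derivative_iff_has_vector_derivative[symmetric] power2_eq_square\<close>)
      have "(LINT t|lborel. \<omega> s * (indicator {s..s+r} t *\<^sub>R (1 / t^2))) \<le> (LINT t:{real k..}|lborel. f t)"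
        unfolding set_lebesgue_integral_def
      proof (rule integral_mono)
        show "integrable lborel (\<lambda>t. \<omega> s * (indicator {s..s+r} t *\<^sub>R (1 / t^2)))"
          using hi by (intro integrable_mult_right) (simp add: has_bochner_integral_iff)
        show "integrable lborel (\<lambda>t. indicator {real k..} t *\<^sub>R f t)"
          by (intro integrable_mult_indicator f) auto
      qed (use * in simp)
      moreover have "(LINT t|lborel. \<omega> s * (indicator {s..s+r} t *\<^sub>R (1 / t^2)))
          = \<omega> s * (LINT t|lborel. indicator {s..s+r} t *\<^sub>R (1 / t^2))"
        by (rule integral_mult_right_zero)
      ultimately show ?thesis
        using hi by (simp add: has_bochner_integral_iff)
    qed
    have "(LINT t:{real k..}|lborel. f t) \<le> \<epsilon>" using k by simp
    then have b: "\<omega> s * (1 / s - 1 / (s + r)) \<le> \<epsilon>" if "r > 0" for r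
      using fin[OF that] by simp
    have "((\<lambda>r. \<omega> s * (1 / s - 1 / (s + r))) \<longlongrightarrow> \<omega> s * (1 / s - 0)) at_top"
      by (intro tendsto_mult tendsto_diff tendsto_const tendsto_divide_0[OF tendsto_const]
            filterlim_at_top_imp_at_infinity filterlim_tendsto_add_at_top[OF tendsto_const] filterlim_ident)
    then have "\<omega> s * (1 / s - 0) \<le> \<epsilon>"
      by (rule tendsto_upperbound[OF _ eventually_mono[OF eventually_gt_at_top[of 0] b]]) auto
    then show "\<omega> s \<le> \<epsilon> * s"
      using s1 by (simp add: field_simps)
  qed
qed

end

section \<open>Sums over the integer lattice\<close>

lemma ivec_nth [simp]: "ivec m $ j = real_of_int (m $ j)"
  by (simp add: ivec_def)

lemma ivec_add: "ivec (m + n) = ivec m + ivec n" by (simp add: vec_eq_iff)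
lemma ivec_diff: "ivec (m - n) = ivec m - ivec n" by (simp add: vec_eq_iff)
lemma ivec_minus: "ivec (- m) = - ivec m" by (simp add: vec_eq_iff)
lemma ivec_0 [simp]: "ivec 0 = 0" by (simp add: vec_eq_iff)

text \<open>Cubes exhaust the lattice, and sums of products over them factor coordinatewise.\<close>

definition lbox :: "nat \<Rightarrow> (int^'n::finite) set" where
  "lbox R = {m. \<forall>j. \<bar>m $ j\<bar> \<le> int R}"

lemma sum_vec_prod:
  fixes f :: "'n::finite \<Rightarrow> int \<Rightarrow> 'a::comm_semiring_1"
  assumes "\<And>j. finite (S j)"
  shows "(\<Sum>m\<in>{m::int^'n. \<forall>j. m $ j \<in> S j}. \<Prod>j\<in>UNIV. f j (m $ j)) = (\<Prod>j\<in>UNIV. \<Sum>k\<in>S j. f j k)"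
proof -
  have "(\<Prod>j\<in>UNIV. \<Sum>k\<in>S j. f j k) = (\<Sum>g\<in>PiE UNIV S. \<Prod>j\<in>UNIV. f j (g j))"
    using assms by (intro prod_sum_PiE) auto
  also have "\<dots> = (\<Sum>m\<in>{m::int^'n. \<forall>j. m $ j \<in> S j}. \<Prod>j\<in>UNIV. f j (m $ j))"
    by (rule sum.reindex_bij_witness[of _ vec_nth vec_lambda]) (auto simp: PiE_iff)
  finally show ?thesis by simp
qed

lemma finite_vec_box:
  assumes "\<And>j. finite (S j)"
  shows "finite {m::int^'n::finite. \<forall>j. m $ j \<in> S j}"
proof -
  have "finite (vec_lambda ` PiE UNIV S :: (int^'n) set)"
    using assms by (intro finite_imageI finite_PiE) auto
  then show ?thesis
    by (rule finite_subset[rotated]) (force intro: image_eqI[of _ vec_lambda "vec_nth _"] simp: PiE_iff)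
qed

lemma card_vec_box:
  assumes "\<And>j. finite (S j)"
  shows "card {m::int^'n::finite. \<forall>j. m $ j \<in> S j} = (\<Prod>j\<in>UNIV. card (S j))"
  using sum_vec_prod[OF assms, of "\<lambda>_ _. 1::nat"] by simp

lemma lbox_alt: "lbox R = {m::int^'n::finite. \<forall>j. m $ j \<in> {- int R..int R}}"
  by (auto simp: lbox_def abs_le_iff) (metis minus_le_iff)+

lemma finite_lbox [simp]: "finite (lbox R :: (int^'n::finite) set)"
  unfolding lbox_alt by (rule finite_vec_box) simp

lemma card_lbox: "card (lbox R :: (int^'n::finite) set) = (2 * R + 1) ^ CARD('n)"
  unfolding lbox_alt by (subst card_vec_box) (auto simp: nat_add_distrib nat_mult_distrib)

lemma finite_subset_lbox: "finite F \<Longrightarrow> \<exists>R. F \<subseteq> (lbox R :: (int^'n::finite) set)"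
proof (induction F rule: finite_induct)
  case (insert m F)
  then obtain R where R: "F \<subseteq> lbox R" by auto
  define R' where "R' = R + (\<Sum>j\<in>UNIV. nat \<bar>m $ j\<bar>)"
  have "nat \<bar>m $ j\<bar> \<le> (\<Sum>j\<in>UNIV. nat \<bar>m $ j\<bar>)" for j
    by (rule member_le_sum) auto
  then have *: "\<bar>m $ j\<bar> \<le> int R'" for j
    by (metis R'_def nat_le_iff trans_le_add2)
  have "lbox R \<subseteq> (lbox R' :: (int^'n) set)"
  proof
    fix x :: "int^'n" assume "x \<in> lbox R"
    then have "\<bar>x $ j\<bar> \<le> int R" for j by (simp add: lbox_def)
    then show "x \<in> lbox R'" by (simp add: lbox_def R'_def add_increasing2)
  qed
  moreover have "m \<in> lbox R'" using * by (simp add: lbox_def)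
  ultimately have "insert m F \<subseteq> lbox R'" using R by blast
  then show ?case by blast
qed auto

text \<open>A Riemann sum of mesh \<open>k\<close> for the integral of 1/(1+|x|)^2. Each half
  telescopes to at most 1 and the term at 0 adds \<open>k \<le> 1\<close>. The bound must not depend
  on \<open>k\<close>, because meshes tending to 0 occur later.\<close>

lemma sum_int_kernel_le:
  fixes k :: real assumes "0 < k" "k \<le> 1"
  shows "(\<Sum>m\<in>{- int R..int R}. k / (1 + k * \<bar>real_of_int m\<bar>)\<^sup>2) \<le> 3"
proof -
  let ?f = "\<lambda>m::int. k / (1 + k * \<bar>real_of_int m\<bar>)\<^sup>2"
  have pos: "(\<Sum>m\<in>{1..int R}. ?f m) \<le> 1 - 1 / (1 + k * real R)"
  proof (induction R)
    case (Suc R)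
    have *: "{1..int (Suc R)} = insert (int (Suc R)) {1..int R}" by auto
    let ?x = "1 + k * real R"
    have x: "?x > 0" using assms by (simp add: add_pos_nonneg)
    have "k / (?x + k)\<^sup>2 \<le> k / (?x * (?x + k))"
      using x assms by (intro divide_left_mono) (auto simp: power2_eq_square)
    also have "\<dots> = 1 / ?x - 1 / (?x + k)"
      using x assms by (simp add: divide_simps)
    finally have "k / (1 + k * real (Suc R))\<^sup>2 \<le> 1 / ?x - 1 / (1 + k * real (Suc R))"
      by (simp add: algebra_simps)
    then show ?case
      using Suc unfolding * by simp
  qed simp
  then have pos: "(\<Sum>m\<in>{1..int R}. ?f m) \<le> 1"
    using assms by (smt (verit) divide_nonneg_nonneg mult_nonneg_nonneg of_nat_0_le_iff)
  have neg: "(\<Sum>m\<in>{- int R..-1}. ?f m) = (\<Sum>m\<in>{1..int R}. ?f m)"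
    by (rule sum.reindex_bij_witness[of _ uminus uminus]) auto
  have "{- int R..int R} = {- int R..-1} \<union> ({0} \<union> {1..int R})" by auto
  then have "(\<Sum>m\<in>{- int R..int R}. ?f m) = (\<Sum>m\<in>{- int R..-1}. ?f m) + (?f 0 + (\<Sum>m\<in>{1..int R}. ?f m))"
    by (simp add: sum.union_disjoint)
  then show ?thesis using pos neg assms by simp
qed

text \<open>Every coordinate is at most the norm, so the radial kernel lies below a product kernel,
  whose sums and integrals factor. This dictates the exponent 2d used throughout.\<close>

lemma kernel_le_prod:
  fixes x :: "real^'n::finite"
  shows "1 / (1 + norm x) ^ (2 * CARD('n)) \<le> (\<Prod>j\<in>UNIV. 1 / (1 + \<bar>x $ j\<bar>)\<^sup>2)"
proof -
  have "(\<Prod>j\<in>(UNIV::'n set). 1 / (1 + norm x)\<^sup>2) \<le> (\<Prod>j\<in>UNIV. 1 / (1 + \<bar>x $ j\<bar>)\<^sup>2)"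
    by (intro prod_mono conjI divide_left_mono power_mono add_left_mono component_le_norm_cart
          mult_pos_pos zero_less_power) (auto simp: add_pos_nonneg)
  then show ?thesis by (simp add: power_mult power_one_over)
qed

text \<open>The factor \<open>k ^ CARD('n)\<close> is the volume of a cell, so this is again a
  Riemann sum; its uniformity in the mesh is what allows periods to tend to infinity.\<close>

lemma lattice_sum_le:
  fixes F :: "(int^'n::finite) set"
  assumes k: "0 < k" "k \<le> 1" and F: "finite F"
  shows "(\<Sum>m\<in>F. k ^ CARD('n) / (1 + norm (k *\<^sub>R ivec m)) ^ (2 * CARD('n))) \<le> 3 ^ CARD('n)"
proof -
  obtain R where R: "F \<subseteq> lbox R" using finite_subset_lbox[OF F] by blast
  have "(\<Sum>m\<in>F. k ^ CARD('n) / (1 + norm (k *\<^sub>R ivec m)) ^ (2 * CARD('n)))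
      \<le> (\<Sum>m\<in>(lbox R :: (int^'n) set). k ^ CARD('n) / (1 + norm (k *\<^sub>R ivec m)) ^ (2 * CARD('n)))"
    using k R by (intro sum_mono2) (auto intro!: divide_nonneg_nonneg)
  also have "\<dots> \<le> (\<Sum>m\<in>(lbox R :: (int^'n) set). \<Prod>j\<in>(UNIV::'n set). k / (1 + k * \<bar>real_of_int (m $ j)\<bar>)\<^sup>2)"
  proof (rule sum_mono)
    fix m :: "int^'n"
    have "k ^ CARD('n) * (1 / (1 + norm (k *\<^sub>R ivec m)) ^ (2 * CARD('n)))
        \<le> k ^ CARD('n) * (\<Prod>j\<in>UNIV. 1 / (1 + \<bar>(k *\<^sub>R ivec m) $ j\<bar>)\<^sup>2)"
      using k by (intro mult_left_mono kernel_le_prod) auto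
    also have "\<dots> = (\<Prod>j\<in>(UNIV::'n set). k * (1 / (1 + \<bar>(k *\<^sub>R ivec m) $ j\<bar>)\<^sup>2))"
      by (subst prod.distrib) simp
    finally show "k ^ CARD('n) / (1 + norm (k *\<^sub>R ivec m)) ^ (2 * CARD('n))
       \<le> (\<Prod>j\<in>(UNIV::'n set). k / (1 + k * \<bar>real_of_int (m $ j)\<bar>)\<^sup>2)"
      using k by (simp add: abs_mult)
  qed
  also have "\<dots> = (\<Prod>j\<in>(UNIV::'n set). \<Sum>m\<in>{- int R..int R}. k / (1 + k * \<bar>real_of_int m\<bar>)\<^sup>2)"
    unfolding lbox_alt by (subst sum_vec_prod) auto
  also have "\<dots> \<le> (\<Prod>j\<in>(UNIV::'n set). 3)"
    using k by (intro prod_mono conjI sum_int_kernel_le sum_nonneg) auto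
  finally show ?thesis by simp
qed

lemma norm_ivec_ge_1: "l \<noteq> 0 \<Longrightarrow> 1 \<le> norm (ivec l)"
proof -
  assume l: "l \<noteq> 0"
  obtain j where "l $ j \<noteq> 0" using l by (auto simp: vec_eq_iff)
  then have "1 \<le> \<bar>ivec l $ j\<bar>" by simp
  then show ?thesis using component_le_norm_cart[of "ivec l" j] by linarith
qed

lemma lattice_sum_enum_le:
  fixes e :: "nat \<Rightarrow> int^'n::finite"
  assumes "0 < k" "k \<le> 1" "bij e"
  shows "(\<Sum>i<n. k ^ CARD('n) / (1 + norm (k *\<^sub>R ivec (e i))) ^ (2 * CARD('n))) \<le> 3 ^ CARD('n)"
proof -
  have "(\<Sum>i<n. k ^ CARD('n) / (1 + norm (k *\<^sub>R ivec (e i))) ^ (2 * CARD('n)))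
      = (\<Sum>m\<in>e ` {..<n}. k ^ CARD('n) / (1 + norm (k *\<^sub>R ivec m)) ^ (2 * CARD('n)))"
    using assms(3) by (subst sum.reindex) (auto intro: inj_on_subset[OF bij_is_inj])
  also have "\<dots> \<le> 3 ^ CARD('n)" using assms by (intro lattice_sum_le) auto
  finally show ?thesis .
qed

lemma lattice_summable:
  assumes k: "0 < k"
  shows "(\<lambda>m::int^'n::finite. 1 / (1 + norm (k *\<^sub>R ivec m)) ^ (2 * CARD('n))) summable_on UNIV"
proof (rule nonneg_bdd_above_summable_on)
  \<comment> \<open>The uniform bound covers meshes at most 1; enlarging the mesh beyond that only
    decreases the terms.\<close>
  let ?k = "min k 1"
  have k': "0 < ?k" "?k \<le> 1" using k by auto
  show "bdd_above (sum (\<lambda>m::int^'n. 1 / (1 + norm (k *\<^sub>R ivec m)) ^ (2 * CARD('n))) ` {F. F \<subseteq> UNIV \<and> finite F})"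
  proof (rule bdd_aboveI2)
    fix F :: "(int^'n) set" assume "F \<in> {F. F \<subseteq> UNIV \<and> finite F}"
    then have F: "finite F" by simp
    have "(\<Sum>m\<in>F. 1 / (1 + norm (k *\<^sub>R ivec m)) ^ (2 * CARD('n)))
       \<le> (\<Sum>m\<in>F. (?k ^ CARD('n) / (1 + norm (?k *\<^sub>R ivec m)) ^ (2 * CARD('n))) / ?k ^ CARD('n))"
    proof (rule sum_mono)
      fix m :: "int^'n"
      have "norm (?k *\<^sub>R ivec m) \<le> norm (k *\<^sub>R ivec m)"
        using k by (auto intro!: mult_right_mono)
      then have "1 / (1 + norm (k *\<^sub>R ivec m)) ^ (2 * CARD('n)) \<le> 1 / (1 + norm (?k *\<^sub>R ivec m)) ^ (2 * CARD('n))"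
        by (intro divide_left_mono power_mono mult_pos_pos zero_less_power) (auto simp: add_pos_nonneg)
      then show "1 / (1 + norm (k *\<^sub>R ivec m)) ^ (2 * CARD('n))
          \<le> (?k ^ CARD('n) / (1 + norm (?k *\<^sub>R ivec m)) ^ (2 * CARD('n))) / ?k ^ CARD('n)"
        using k' by simp
    qed
    also have "\<dots> = (\<Sum>m\<in>F. ?k ^ CARD('n) / (1 + norm (?k *\<^sub>R ivec m)) ^ (2 * CARD('n))) / ?k ^ CARD('n)"
      by (simp only: sum_divide_distrib)
    also have "\<dots> \<le> 3 ^ CARD('n) / ?k ^ CARD('n)"
      using k' by (intro divide_right_mono lattice_sum_le F) auto
    finally show "(\<Sum>m\<in>F. 1 / (1 + norm (k *\<^sub>R ivec m)) ^ (2 * CARD('n))) \<le> 3 ^ CARD('n) / ?k ^ CARD('n)" .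
  qed
qed auto

lemma infinite_int_vec: "infinite (UNIV :: (int^'n::finite) set)"
proof
  assume "finite (UNIV :: (int^'n) set)"
  then obtain R where "UNIV \<subseteq> (lbox R :: (int^'n) set)" using finite_subset_lbox by blast
  then have "(\<chi> j. int (Suc R)) \<in> (lbox R :: (int^'n) set)" by blast
  then show False by (simp add: lbox_def)
qed

lemma countable_int_vec: "countable (UNIV :: (int^'n::finite) set)"
proof -
  have "countable (\<Union>R. lbox R :: (int^'n) set)"
    by (rule countable_UN[OF _ countable_finite]) auto
  moreover have "(\<Union>R. lbox R :: (int^'n) set) = UNIV"
  proof -
    have "\<exists>R. m \<in> lbox R" for m :: "int^'n"
      using finite_subset_lbox[of "{m}"] by auto
    then show ?thesis by blast
  qed
  ultimately show ?thesis by simp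
qed

lemma int_vec_enum: "\<exists>e. bij (e :: nat \<Rightarrow> int^'n::finite)"
  using bij_betw_from_nat_into[OF countable_int_vec infinite_int_vec] by blast

lemma int_vec_pair_enum: "\<exists>e. bij (e :: nat \<Rightarrow> (int^'n::finite) \<times> (int^'n))"
proof -
  have "countable (UNIV :: ((int^'n) \<times> (int^'n)) set)"
    using countable_SIGMA[OF countable_int_vec, of "\<lambda>_. UNIV"] countable_int_vec by (simp add: UNIV_Times_UNIV)
  moreover have "infinite (UNIV :: ((int^'n) \<times> (int^'n)) set)"
    using infinite_int_vec by (simp add: finite_prod)
  ultimately show ?thesis using bij_betw_from_nat_into by blast
qed

text \<open>Unconditional sums over the lattice are turned into series over \<open>nat\<close>, to
  which termwise integration, differentiation and application of \<open>u\<close> apply.\<close>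

lemma has_sum_enum:
  fixes f :: "'i \<Rightarrow> 'a::{topological_comm_monoid_add, t2_space}"
  assumes "bij (e :: nat \<Rightarrow> 'i)" "(f has_sum S) UNIV"
  shows "(\<lambda>i. f (e i)) sums S"
  using assms by (intro has_sum_imp_sums) (simp add: has_sum_reindex_bij_betw)

lemma summable_on_enum:
  fixes f :: "'i \<Rightarrow> 'a::{topological_comm_monoid_add, t2_space}"
  assumes "bij (e :: nat \<Rightarrow> 'i)" "f summable_on UNIV"
  shows "summable (\<lambda>i. f (e i))"
  using has_sum_enum[OF assms(1) has_sum_infsum[OF assms(2)]] by (rule sums_summable)

section \<open>Integrals over boxes\<close>

text \<open>Lebesgue measure on \<open>real^'n\<close> is the image of a product measure indexed by
  \<open>Basis\<close>, and \<open>axis\<close> identifies \<open>Basis\<close> with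
  \<open>'n\<close>; this is Fubini for tensor products.\<close>

lemma
  fixes f :: "'n::finite \<Rightarrow> real \<Rightarrow> 'a::{real_normed_field,banach,second_countable_topology}"
  assumes f: "\<And>j. integrable lborel (f j)"
  shows integrable_prod_vec: "integrable lborel (\<lambda>x::real^'n. \<Prod>j\<in>UNIV. f j (x $ j))"
    and integral_prod_vec: "(LINT x|lborel. (\<Prod>j\<in>UNIV. f j ((x::real^'n) $ j))) = (\<Prod>j\<in>UNIV. (LINT t|lborel. f j t))"
proof -
  interpret product_sigma_finite "\<lambda>_::real^'n. lborel :: real measure" ..
  let ?T = "\<lambda>g. \<Sum>b\<in>Basis. g b *\<^sub>R b :: real^'n"
  let ?F = "\<lambda>b::real^'n. f (axis_index b)"
  have meas [measurable]: "\<And>j. f j \<in> borel_measurable borel"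
    using f borel_measurable_integrable by fastforce
  have [measurable]: "(\<lambda>x::real^'n. x $ j) \<in> borel_measurable borel" for j
    by (intro borel_measurable_continuous_onI continuous_intros)
  have prodm [measurable]: "(\<lambda>x::real^'n. \<Prod>j\<in>UNIV. f j (x $ j)) \<in> borel_measurable borel"
    by measurable
  have T [measurable]: "?T \<in> measurable (PiM Basis (\<lambda>_. lborel)) borel"
    by measurable
  have Basis: "Basis = range (\<lambda>j::'n. axis j (1::real))"
    by (auto simp: Basis_vec_def)
  have inj: "inj (\<lambda>j::'n. axis j (1::real))"
    by (auto simp: inj_def axis_eq_axis)
  have nth: "?T g $ j = g (axis j 1)" for g j
    by (simp add: cart_eq_inner_axis inner_sum_left_Basis)
  have eq: "(\<lambda>g. \<Prod>j\<in>UNIV. f j (?T g $ j)) = (\<lambda>g. \<Prod>b\<in>Basis. ?F b (g b))"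
    unfolding nth unfolding Basis
    by (subst prod.reindex[OF inj]) (simp add: o_def)
  have "integrable (PiM Basis (\<lambda>_. lborel)) (\<lambda>g. \<Prod>b\<in>Basis. ?F b (g b))"
    using product_integrable_prod[of Basis ?F] f by auto
  then show "integrable lborel (\<lambda>x::real^'n. \<Prod>j\<in>UNIV. f j (x $ j))"
    by (subst lborel_eq, subst integrable_distr_eq[OF T prodm], subst eq)
  have "(LINT x|lborel. (\<Prod>j\<in>UNIV. f j ((x::real^'n) $ j))) = (LINT g|PiM Basis (\<lambda>_. lborel). (\<Prod>b\<in>Basis. ?F b (g b)))"
    by (subst lborel_eq, subst integral_distr[OF T prodm], subst eq) simp
  also have "\<dots> = (\<Prod>b\<in>Basis. (LINT t|lborel. ?F b t))"
    using product_integral_prod[of Basis ?F] f by auto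
  also have "\<dots> = (\<Prod>j\<in>UNIV. (LINT t|lborel. f j t))"
    unfolding Basis by (subst prod.reindex[OF inj]) (simp add: o_def)
  finally show "(LINT x|lborel. (\<Prod>j\<in>UNIV. f j ((x::real^'n) $ j))) = (\<Prod>j\<in>UNIV. (LINT t|lborel. f j t))" .
qed

lemma integrable_inverse_square: "integrable lborel (\<lambda>t::real. 1 / (1 + \<bar>t\<bar>)\<^sup>2)"
proof -
  have pos: "set_integrable lborel {0..} (\<lambda>t::real. 1 / (1 + t)\<^sup>2)"
  proof -
    have "(\<integral>\<^sup>+x. ennreal (1 / (1 + x)\<^sup>2) * indicator {0..} x \<partial>lborel) = 0 - - 1 / (1 + 0::real)"
    proof (rule nn_integral_FTC_atLeast)
      show "((\<lambda>t::real. - 1 / (1 + t)) \<longlongrightarrow> 0) at_top"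
        by (intro tendsto_divide_0[OF tendsto_const] filterlim_at_top_imp_at_infinity
              filterlim_tendsto_add_at_top[OF tendsto_const] filterlim_ident)
    qed (auto intro!: derivative_eq_intros simp: power2_eq_square)
    moreover have "(\<lambda>x. ennreal (1 / (1 + x)\<^sup>2) * indicator {0..} x)
        = (\<lambda>x. ennreal (indicator {0..} x * (1 / (1 + x)\<^sup>2)))"
      by (auto simp: indicator_def)
    ultimately show ?thesis
      unfolding set_integrable_def real_scaleR_def
      by (intro integrableI_nn_integral_finite) auto
  qed
  have pos': "integrable lborel (\<lambda>t::real. indicator {0..} t * (1 / (1 + \<bar>t\<bar>)\<^sup>2))"
  proof -
    have "(\<lambda>t::real. indicator {0..} t * (1 / (1 + \<bar>t\<bar>)\<^sup>2)) = (\<lambda>t. indicator {0..} t *\<^sub>R (1 / (1 + t)\<^sup>2))"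
      by (auto simp: indicator_def fun_eq_iff)
    then show ?thesis using pos by (simp add: set_integrable_def)
  qed
  have neg: "integrable lborel (\<lambda>t::real. indicator {0..} (- t) * (1 / (1 + \<bar>t\<bar>)\<^sup>2))"
    using lborel_integrable_real_affine[OF pos', of "-1" 0] by simp
  show ?thesis
    by (rule Bochner_Integration.integrable_bound[OF Bochner_Integration.integrable_add[OF pos' neg]])
      (auto simp: indicator_def)
qed

lemma integrable_kernel:
  "integrable lborel (\<lambda>x::real^'n::finite. 1 / (1 + norm x) ^ (2 * CARD('n)))"
proof (rule Bochner_Integration.integrable_bound)
  show "integrable lborel (\<lambda>x::real^'n. \<Prod>j\<in>UNIV. 1 / (1 + \<bar>x $ j\<bar>)\<^sup>2)"
    by (rule integrable_prod_vec) (rule integrable_inverse_square)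
  have "continuous_on UNIV (\<lambda>x::real^'n. 1 / (1 + norm x) ^ (2 * CARD('n)))"
    by (intro continuous_intros) (auto simp: add_nonneg_eq_0_iff)
  then show "(\<lambda>x::real^'n. 1 / (1 + norm x) ^ (2 * CARD('n))) \<in> borel_measurable lborel"
    by (simp add: borel_measurable_continuous_onI)
  show "AE x in lborel. norm (1 / (1 + norm (x::real^'n)) ^ (2 * CARD('n))) \<le> norm (\<Prod>j\<in>(UNIV::'n set). 1 / (1 + \<bar>x $ j\<bar>)\<^sup>2)"
  proof (rule AE_I2)
    fix x :: "real^'n"
    show "norm (1 / (1 + norm x) ^ (2 * CARD('n))) \<le> norm (\<Prod>j\<in>(UNIV::'n set). 1 / (1 + \<bar>x $ j\<bar>)\<^sup>2)"
      using kernel_le_prod[of x] by (simp add: abs_prod)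
  qed
qed

lemma cis_sum: "finite A \<Longrightarrow> cis (sum f A) = (\<Prod>a\<in>A. cis (f a))"
  by (induction A rule: finite_induct) (auto simp: cis_mult[symmetric])

lemma cis_2pi_int: "cis (2 * pi * real_of_int n) = 1"
  by (rule cis_multiple_2pi) simp

text \<open>Half-open, so that the translates by \<open>L *\<^sub>R ivec l\<close> tile the space
  without overlap.\<close>

definition cube :: "real \<Rightarrow> (real^'n::finite) set" where
  "cube L = {t. \<forall>j. - L / 2 \<le> t $ j \<and> t $ j < L / 2}"

lemma indicator_cube:
  "(indicator (cube L) (t::real^'n::finite) :: 'a::{comm_semiring_1}) = (\<Prod>j\<in>UNIV. indicator {-L/2..<L/2} (t $ j))"
proof (cases "t \<in> cube L")
  case False
  then obtain j where "indicator {-L/2..<L/2} (t $ j) = (0::'a)" by (auto simp: cube_def indicator_def)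
  then have "(\<Prod>j\<in>UNIV. indicator {-L/2..<L/2} (t $ j)) = (0::'a)" by (rule prod_zero[OF finite bexI]) auto
  with False show ?thesis by simp
qed (auto simp: cube_def indicator_def)

lemma cube_sets [measurable]: "cube L \<in> sets (borel :: (real^'n::finite) measure)"
proof -
  have [measurable]: "(\<lambda>x::real^'n. x $ j) \<in> borel_measurable borel" for j
    by (intro borel_measurable_continuous_onI continuous_intros)
  have "{t \<in> space borel. \<forall>j. - L / 2 \<le> t $ j \<and> t $ j < L / 2} \<in> sets (borel :: (real^'n) measure)"
    by measurable
  then show ?thesis by (simp add: cube_def)
qed

lemma integrable_cube:
  fixes f :: "real^'n::finite \<Rightarrow> 'a::{banach,second_countable_topology}"
  assumes "continuous_on UNIV f"
  shows "integrable lborel (\<lambda>t. indicator (cube L) t *\<^sub>R f t)"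
proof -
  let ?C = "cbox (\<chi> j. - L / 2) (\<chi> j. L / 2) :: (real^'n) set"
  have "set_integrable lborel ?C f"
    unfolding set_integrable_def by (rule borel_integrable_compact) (auto intro: continuous_on_subset[OF assms])
  then have "set_integrable lborel (cube L) f"
    by (rule set_integrable_subset) (auto simp: cube_def mem_box_cart less_imp_le)
  then show ?thesis by (simp add: set_integrable_def)
qed

lemma has_vector_derivative_cis_affine:
  "((\<lambda>t. cis (a + c * t)) has_vector_derivative (\<i> * of_real c * cis (a + c * t))) (at t within S)"
proof -
  have "((\<lambda>z. exp (\<i> * (of_real a + of_real c * z))) has_field_derivative
      exp (\<i> * (of_real a + of_real c * of_real t)) * (\<i> * of_real c)) (at (of_real t))"
    by (auto intro!: derivative_eq_intros)
  from has_vector_derivative_real_field[OF this] show ?thesis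
    by (simp add: cis_conv_exp mult_ac)
qed

lemma integral_cis_interval:
  assumes "k > 0" and L: "L = 2 * pi / k"
  shows "(LINT t|lborel. indicator {-L/2..<L/2} t *\<^sub>R cis (k * real_of_int p * t)) = (if p = 0 then of_real L else 0)"
    and "integrable lborel (\<lambda>t. indicator {-L/2..<L/2} t *\<^sub>R cis (k * real_of_int p * t))"
proof -
  have L0: "L > 0" using assms by simp
  \<comment> \<open>The endpoint is a null set; on the closed interval the fundamental theorem
    applies. For \<open>p \<noteq> 0\<close> the primitive takes equal values at the two ends, which
    differ by full turns.\<close>
  have eq: "AE t in lborel. indicator {-L/2..<L/2} t *\<^sub>R cis (k * real_of_int p * t)
      = indicator {-L/2..L/2} t *\<^sub>R cis (k * real_of_int p * t)"
    using AE_lborel_singleton[of "L/2"] by eventually_elim (auto simp: indicator_def)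
  have hb: "has_bochner_integral lborel (\<lambda>t. indicator {-L/2..L/2} t *\<^sub>R cis (k * real_of_int p * t))
     (if p = 0 then of_real L else 0)"
  proof (cases "p = 0")
    case True
    have "has_bochner_integral lborel (\<lambda>t. indicator {-L/2..L/2} t *\<^sub>R (1::complex)) (of_real (L/2) - of_real (-L/2))"
      using L0 by (intro has_bochner_integral_FTC_Icc) (auto intro!: derivative_eq_intros continuous_intros simp: has_vector_derivative_def scaleR_conv_of_real)
    moreover have "complex_of_real (L/2) - of_real (-L/2) = of_real L"
      by (simp flip: of_real_diff)
    ultimately show ?thesis using True by simp
  next
    case False
    let ?c = "k * real_of_int p"
    have c: "?c \<noteq> 0" using False assms by simp
    have "has_bochner_integral lborel (\<lambda>t. indicator {-L/2..L/2} t *\<^sub>R cis (?c * t))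
        (cis (?c * (L/2)) / (\<i> * of_real ?c) - cis (?c * (-L/2)) / (\<i> * of_real ?c))"
    proof (rule has_bochner_integral_FTC_Icc)
      show "((\<lambda>t. cis (?c * t) / (\<i> * of_real ?c)) has_vector_derivative cis (?c * x)) (at x within {-L/2..L/2})" for x
        using has_vector_derivative_mult_left[OF has_vector_derivative_cis_affine[of 0 ?c x "{-L/2..L/2}"],
            of "1 / (\<i> * of_real ?c)"] c by (simp add: field_simps)
      show "continuous_on {-L/2..L/2} (\<lambda>t. cis (?c * t))"
        unfolding cis_conv_exp by (intro continuous_intros)
    qed (use L0 in auto)
    moreover have "cis (?c * (L/2)) = cis (?c * (-L/2))"
    proof -
      have "?c * (L/2) = ?c * (-L/2) + 2 * pi * real_of_int p"
        using assms by (simp add: field_simps)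
      then show ?thesis by (simp only: cis_mult[symmetric] cis_2pi_int mult_1_right)
    qed
    ultimately show ?thesis using False by simp
  qed
  then have i: "integrable lborel (\<lambda>t. indicator {-L/2..L/2} t *\<^sub>R cis (k * real_of_int p * t))"
    by (simp add: has_bochner_integral_iff)
  have cism: "(\<lambda>t. cis (k * real_of_int p * t)) \<in> borel_measurable borel"
    unfolding cis_conv_exp by (intro borel_measurable_continuous_onI continuous_intros)
  then have m: "(\<lambda>t. indicator {-L/2..<L/2} t *\<^sub>R cis (k * real_of_int p * t)) \<in> borel_measurable lborel"
    by measurable
  show "integrable lborel (\<lambda>t. indicator {-L/2..<L/2} t *\<^sub>R cis (k * real_of_int p * t))"
    using integrable_cong_AE[OF m borel_measurable_integrable[OF i] eq] i by simp
  show "(LINT t|lborel. indicator {-L/2..<L/2} t *\<^sub>R cis (k * real_of_int p * t)) = (if p = 0 then of_real L else 0)"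
    using integral_cong_AE[OF m borel_measurable_integrable[OF i] eq] hb by (simp add: has_bochner_integral_iff)
qed

lemma integral_cis_cube:
  assumes "k > 0" and L: "L = 2 * pi / k"
  shows "(LINT t|lborel. indicator (cube L) t *\<^sub>R cis (k * (ivec p \<bullet> t)))
     = (if p = (0::int^'n::finite) then of_real L ^ CARD('n) else 0)"
proof -
  let ?f = "\<lambda>j x. indicator {-L/2..<L/2} x *\<^sub>R cis (k * real_of_int (p $ j) * x)"
  have "indicator (cube L) t *\<^sub>R cis (k * (ivec p \<bullet> t)) = (\<Prod>j\<in>UNIV. ?f j (t $ j))" for t
  proof -
    have "cis (k * (ivec p \<bullet> t)) = cis (\<Sum>j\<in>UNIV. k * real_of_int (p $ j) * t $ j)"
      by (simp add: inner_vec_def sum_distrib_left mult.assoc)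
    also have "\<dots> = (\<Prod>j\<in>UNIV. cis (k * real_of_int (p $ j) * t $ j))"
      by (simp add: cis_sum)
    finally show ?thesis
      by (simp add: scaleR_conv_of_real prod.distrib indicator_cube)
  qed
  then have "(LINT t|lborel. indicator (cube L) t *\<^sub>R cis (k * (ivec p \<bullet> t))) = (\<Prod>j\<in>UNIV. (LINT x|lborel. ?f j x))"
    using integral_prod_vec[of ?f] integral_cis_interval(2)[OF assms] by simp
  also have "\<dots> = (\<Prod>j\<in>UNIV. if p $ j = 0 then of_real L else 0)"
    by (simp only: integral_cis_interval(1)[OF assms])
  also have "\<dots> = (if p = 0 then of_real L ^ CARD('n) else 0)"
    by (auto simp: vec_eq_iff)
  finally show ?thesis .
qed

section \<open>The Fourier transform\<close>

lemma continuous_on_cis_real [continuous_intros]: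
  "continuous_on S f \<Longrightarrow> continuous_on S (\<lambda>x. cis (f x))"
  unfolding cis_conv_exp by (intro continuous_intros)

lemma borel_measurable_cis [measurable (raw)]:
  "f \<in> borel_measurable M \<Longrightarrow> (\<lambda>x. cis (f x)) \<in> borel_measurable M"
  by (rule borel_measurable_continuous_on[of cis]) (auto intro: continuous_on_cis_real continuous_on_id)

lemma integral_shift:
  fixes f :: "'a::euclidean_space \<Rightarrow> 'b::{banach,second_countable_topology}"
  assumes [measurable]: "f \<in> borel_measurable borel"
  shows "(LINT x|lborel. f (x + c)) = (LINT x|lborel. f x)"
proof -
  have "(LINT x|lborel. f x) = (LINT x|distr lborel borel ((+) c). f x)"
    by (simp only: lborel_distr_plus)
  also have "\<dots> = (LINT x|lborel. f (c + x))"
    by (rule integral_distr) auto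
  finally show ?thesis by (simp add: add.commute)
qed

lemma integrable_shift:
  fixes f :: "'a::euclidean_space \<Rightarrow> 'b::{banach,second_countable_topology}"
  assumes f: "integrable lborel f"
  shows "integrable lborel (\<lambda>x. f (x + c))"
proof -
  have [measurable]: "f \<in> borel_measurable borel" using borel_measurable_integrable[OF f] by simp
  have "integrable (distr lborel borel ((+) c)) f" using f by (simp only: lborel_distr_plus)
  then have "integrable lborel (\<lambda>x. f (c + x))" by (subst (asm) integrable_distr_eq) auto
  then show ?thesis by (simp add: add.commute)
qed

lemma integrable_mult_cis:
  fixes f :: "'a::euclidean_space \<Rightarrow> complex"
  assumes f: "integrable lborel f" and [measurable]: "h \<in> borel_measurable borel"
  shows "integrable lborel (\<lambda>x. f x * cis (h x))"
proof (rule Bochner_Integration.integrable_bound[OF f])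
  have [measurable]: "f \<in> borel_measurable borel" using borel_measurable_integrable[OF f] by simp
  show "(\<lambda>x. f x * cis (h x)) \<in> borel_measurable lborel" by measurable
qed (simp add: norm_mult)

lemma norm_FT_le: "cmod (FT f \<xi>) \<le> (LINT x|lborel. cmod (f x))"
  unfolding FT_def by (rule order_trans[OF integral_norm_bound]) (simp add: norm_mult)

lemma FT_tf_shift:
  assumes [measurable]: "f \<in> borel_measurable borel"
  shows "FT (tf_shift x \<xi> f) \<eta> = cis (- (x \<bullet> (\<eta> - \<xi>))) * FT f (\<eta> - \<xi>)"
proof -
  have "FT (tf_shift x \<xi> f) \<eta> = (LINT t|lborel. cis (t \<bullet> \<xi>) * f (t - x) * cis (- (t \<bullet> \<eta>)))"
    by (simp add: FT_def tf_shift_def)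
  also have "\<dots> = (LINT t|lborel. cis ((t + x) \<bullet> \<xi>) * f ((t + x) - x) * cis (- ((t + x) \<bullet> \<eta>)))"
    by (subst integral_shift[of _ x, symmetric]) auto
  also have "\<dots> = (LINT t|lborel. cis (- (x \<bullet> (\<eta> - \<xi>))) * (f t * cis (- (t \<bullet> (\<eta> - \<xi>)))))"
  proof (rule Bochner_Integration.integral_cong[OF refl])
    fix t
    have "cis ((t + x) \<bullet> \<xi>) * cis (- ((t + x) \<bullet> \<eta>)) = cis (- (x \<bullet> (\<eta> - \<xi>))) * cis (- (t \<bullet> (\<eta> - \<xi>)))"
      by (simp add: cis_mult inner_add_left inner_diff_right algebra_simps)
    then show "cis ((t + x) \<bullet> \<xi>) * f ((t + x) - x) * cis (- ((t + x) \<bullet> \<eta>)) = cis (- (x \<bullet> (\<eta> - \<xi>))) * (f t * cis (- (t \<bullet> (\<eta> - \<xi>))))"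
      by (simp add: mult_ac)
  qed
  finally show ?thesis by (simp add: FT_def)
qed

lemma FT_cnj: "FT (\<lambda>t. cnj (f t)) \<xi> = cnj (FT f (- \<xi>))"
proof -
  have "FT (\<lambda>t. cnj (f t)) \<xi> = (LINT t|lborel. cnj (f t * cis (- (t \<bullet> - \<xi>))))"
    by (simp add: FT_def cis_cnj)
  also have "\<dots> = cnj (FT f (- \<xi>))"
    unfolding FT_def by (rule Bochner_Integration.integral_cnj)
  finally show ?thesis .
qed

lemma FT_cmult: "FT (\<lambda>t. c * f t) \<xi> = c * FT f \<xi>"
  by (simp add: FT_def mult.assoc)

lemma FT_sums:
  assumes f: "\<And>i. integrable lborel (f i)" and sm: "\<And>t. (\<lambda>i. f i t) sums F t"
    and abs: "\<And>t. summable (\<lambda>i. cmod (f i t))" and s: "summable (\<lambda>i. LINT t|lborel. cmod (f i t))"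
  shows "(\<lambda>i. FT (f i) \<xi>) sums FT F \<xi>"
proof -
  have "(\<lambda>i. LINT t|lborel. f i t * cis (- (t \<bullet> \<xi>))) sums (LINT t|lborel. (\<Sum>i. f i t * cis (- (t \<bullet> \<xi>))))"
    by (rule sums_integral) (use assms in \<open>auto simp: norm_mult intro!: integrable_mult_cis\<close>)
  also have "(\<lambda>t. \<Sum>i. f i t * cis (- (t \<bullet> \<xi>))) = (\<lambda>t. F t * cis (- (t \<bullet> \<xi>)))"
    using sums_mult2[OF sm, of _ "cis _"] by (auto simp: sums_iff)
  finally show ?thesis by (simp add: FT_def)
qed

lemma continuous_on_series:
  fixes f :: "nat \<Rightarrow> 'a::topological_space \<Rightarrow> 'b::banach"
  assumes c: "\<And>i. continuous_on UNIV (f i)" and b: "\<And>i t. norm (f i t) \<le> M i" and M: "summable M"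
    and sm: "\<And>t. (\<lambda>i. f i t) sums F t"
  shows "continuous_on UNIV F"
proof -
  have "uniform_limit UNIV (\<lambda>n x. \<Sum>i<n. f i x) (\<lambda>x. suminf (\<lambda>i. f i x)) sequentially"
    by (rule Weierstrass_m_test[OF b M])
  then have "continuous_on UNIV (\<lambda>x. suminf (\<lambda>i. f i x))"
    by (rule uniform_limit_theorem[rotated]) (auto intro!: continuous_on_sum c always_eventually)
  then show ?thesis
    by (rule continuous_on_eq) (use sm in \<open>auto simp: sums_iff\<close>)
qed

section \<open>Poisson summation\<close>

text \<open>A vector of norm at least \<open>CARD('n) * d\<close> has a coordinate of modulus at
  least \<open>d\<close>, and cosine decreases on [0, pi]. Thus the sum of 1 - cos is a Korovkin
  test function: bounded below away from the origin.\<close>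

lemma vec_near_or_cos_large:
  fixes t :: "real^'n::finite"
  assumes k: "k > 0" and t: "t \<in> cube (2 * pi / k)" and d: "0 < d" "d \<le> pi / k"
    and n: "norm t \<ge> real CARD('n) * d"
  shows "1 - cos (k * d) \<le> (\<Sum>j\<in>UNIV. 1 - cos (k * t $ j))"
proof -
  obtain j where j: "\<bar>t $ j\<bar> \<ge> d"
  proof (rule ccontr)
    assume "\<not> thesis"
    then have lt: "\<And>j. \<bar>t $ j\<bar> < d" using that by (meson not_le)
    have "norm t \<le> (\<Sum>j\<in>UNIV. \<bar>t $ j\<bar>)" by (rule norm_le_l1_cart)
    also have "\<dots> < (\<Sum>j\<in>(UNIV::'n set). d)" by (rule sum_strict_mono) (use lt in auto)
    finally show False using n by simp
  qed
  have "\<bar>t $ j\<bar> \<le> pi / k"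
    using t by (auto simp: cube_def abs_le_iff dest!: spec[of _ j])
  then have "k * \<bar>t $ j\<bar> \<le> pi" using k by (simp add: field_simps)
  then have "cos (k * \<bar>t $ j\<bar>) \<le> cos (k * d)"
    using j k d by (intro cos_monotone_0_pi_le) auto
  then have "1 - cos (k * d) \<le> 1 - cos (k * t $ j)"
    using k by (cases "t $ j \<ge> 0") (auto simp: abs_if)
  also have "\<dots> \<le> (\<Sum>j\<in>UNIV. 1 - cos (k * t $ j))"
    by (rule member_le_sum) auto
  finally show ?thesis .
qed

text \<open>The Fejer kernel is the squared modulus of the exponential sum over \<open>{0..<N}\<^sup>d\<close>. As in
  Korovkin's theorem, only its integrals against \<open>1\<close> and \<open>cos\<close> matter.\<close>

lemma zero_of_fourier_coefficients_zero:
  fixes D :: "real^'n::finite \<Rightarrow> complex"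
  assumes k: "k > 0" and L: "L = 2 * pi / k"
    and cont: "continuous_on UNIV D" and bdd: "\<And>t. cmod (D t) \<le> M"
    and zero: "\<And>p. (LINT t|lborel. indicator (cube L) t *\<^sub>R (D t * cis (k * (ivec p \<bullet> t)))) = 0"
  shows "D 0 = 0"
proof -
  have L0: "L > 0" using k L by simp
  define I where "I F = (LINT t|lborel. indicator (cube L) t *\<^sub>R F t)" for F :: "real^'n \<Rightarrow> complex"
  define E where "E m t = cis (k * (ivec m \<bullet> t))" for m :: "int^'n" and t
  define V where "V = complex_of_real L ^ CARD('n)"
  have Ec: "continuous_on UNIV (E m)" for m
    unfolding E_def by (intro continuous_intros)
  have E0: "E 0 t = 1" for t by (simp add: E_def)
  have Em: "E m t * cnj (E m' t) = E (m - m') t" for m m' t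
    by (simp add: E_def cis_cnj cis_mult ivec_diff inner_diff_left algebra_simps)
  have Ea: "E m t * E m' t = E (m + m') t" for m m' t
    by (simp add: E_def cis_mult ivec_add inner_add_left algebra_simps)
  have IE: "I (E m) = (if m = 0 then V else 0)" for m
    using integral_cis_cube[OF k L, of m] by (simp add: I_def E_def V_def)
  \<comment> \<open>Weighting with the Fejer kernel \<open>K\<close>, which is nonnegative:
    \<open>D * K\<close> integrates to 0 because all coefficients of \<open>D\<close> vanish, so
    \<open>D 0\<close> times the mass of \<open>K\<close> is an average of \<open>D 0 - D t\<close>.
    The mean of each 1 - cos relative to that mass is 1/N.\<close>
  have main: "cmod (D 0) \<le> e + C * CARD('n) / real N"
    if N: "N > 0" and C: "\<And>t. t \<in> cube L \<Longrightarrow> cmod (D 0 - D t) \<le> e + C * (\<Sum>j\<in>UNIV. 1 - cos (k * t $ j))" for e C N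
  proof -
    define B where "B = {m::int^'n. \<forall>j. m $ j \<in> {0..<int N}}"
    have fB: "finite B" unfolding B_def by (rule finite_vec_box) simp
    have cB: "card B = N ^ CARD('n)" unfolding B_def by (subst card_vec_box) auto
    define S where "S t = (\<Sum>m\<in>B. E m t)" for t
    define K where "K t = S t * cnj (S t)" for t
    have Kr: "K t = of_real ((cmod (S t))\<^sup>2)" for t
      unfolding K_def by (simp only: complex_norm_square)
    have Kc: "continuous_on UNIV K"
      unfolding K_def S_def by (intro continuous_intros Ec)
    have Ksum: "K t = (\<Sum>m\<in>B. \<Sum>m'\<in>B. E (m - m') t)" for t
      by (simp add: K_def S_def sum_product Em)
    have IFK: "I (\<lambda>t. F t * K t) = (\<Sum>m\<in>B. \<Sum>m'\<in>B. I (\<lambda>t. F t * E (m - m') t))"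
      if F: "continuous_on UNIV F" for F
    proof -
      have "I (\<lambda>t. F t * K t) = (LINT t|lborel. (\<Sum>m\<in>B. \<Sum>m'\<in>B. indicator (cube L) t *\<^sub>R (F t * E (m - m') t)))"
        by (simp add: I_def Ksum sum_distrib_left scaleR_sum_right)
      also have "\<dots> = (\<Sum>m\<in>B. \<Sum>m'\<in>B. I (\<lambda>t. F t * E (m - m') t))"
        unfolding I_def
        by (subst Bochner_Integration.integral_sum | intro Bochner_Integration.integrable_sum
             integrable_cube continuous_intros F Ec sum.cong refl)+
      finally show ?thesis .
    qed
    have I1: "I K = V * of_nat (N ^ CARD('n))"
    proof -
      have "I K = (\<Sum>m\<in>B. \<Sum>m'\<in>B. I (E (m - m')))"
        using IFK[of "\<lambda>_. 1"] by simp
      also have "\<dots> = (\<Sum>m\<in>B. \<Sum>m'\<in>B. if m = m' then V else 0)"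
        by (simp add: IE)
      finally show ?thesis using fB by (simp add: cB)
    qed
    have ID: "I (\<lambda>t. D t * K t) = 0"
      by (simp add: IFK[OF cont]) (simp add: I_def E_def zero)
    \<comment> \<open>Pairs in \<open>B\<close> that differ by the unit vector in direction
      \<open>j\<close>: the last layer has no partner, so one factor \<open>N\<close> of the count
      becomes \<open>N - 1\<close>. This missing layer yields the relative mean 1/N of 1 -
      cos.\<close>
    have Ij: "I (\<lambda>t. E (axis j 1) t * K t) = V * of_nat ((N - 1) * N ^ (CARD('n) - 1))" for j
    proof -
      let ?e = "axis j 1 :: int^'n"
      have "I (\<lambda>t. E ?e t * K t) = (\<Sum>m\<in>B. \<Sum>m'\<in>B. I (E (?e + (m - m'))))"
        by (simp add: IFK[OF Ec] Ea)
      also have "\<dots> = (\<Sum>m\<in>B. \<Sum>m'\<in>B. if m' = m + ?e then V else 0)"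
        by (intro sum.cong refl) (auto simp: IE algebra_simps eq_iff_diff_eq_0[symmetric])
      also have "\<dots> = (\<Sum>m\<in>B. if m + ?e \<in> B then V else 0)"
        using fB by simp
      also have "\<dots> = V * of_nat (card {m\<in>B. m + ?e \<in> B})"
        using fB by (simp add: sum.If_cases Int_def)
      also have "{m\<in>B. m + ?e \<in> B} = {m. \<forall>i. m $ i \<in> (if i = j then {0..<int N - 1} else {0..<int N})}"
      proof (rule set_eqI)
        fix m :: "int^'n"
        have nth: "(m + ?e) $ i = m $ i + (if i = j then 1 else 0)" for i
          by (simp add: axis_def)
        have "m \<in> {m\<in>B. m + ?e \<in> B} \<longleftrightarrow> (\<forall>i. m $ i \<in> {0..<int N} \<and> (m + ?e) $ i \<in> {0..<int N})"
          unfolding B_def by blast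
        also have "\<dots> \<longleftrightarrow> (\<forall>i. m $ i \<in> (if i = j then {0..<int N - 1} else {0..<int N}))"
          unfolding nth by (intro all_cong1) auto
        finally show "m \<in> {m\<in>B. m + ?e \<in> B} \<longleftrightarrow> m \<in> {m. \<forall>i. m $ i \<in> (if i = j then {0..<int N - 1} else {0..<int N})}"
          by simp
      qed
      also have "card \<dots> = (N - 1) * N ^ (CARD('n) - 1)"
        by (subst card_vec_box)
          (use N in \<open>auto simp: if_distrib[of card] prod.If_cases Compl_eq_Diff_UNIV card_Diff_singleton nat_diff_distrib\<close>)
      finally show ?thesis .
    qed
    have Ejc: "Re (E (axis j 1) t) = cos (k * t $ j)" for j t
    proof -
      have "ivec (axis j 1) = (axis j 1 :: real^'n)"
        by (simp add: vec_eq_iff axis_def)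
      then show ?thesis by (simp add: E_def inner_axis')
    qed
    have "V * of_nat (N ^ CARD('n)) * D 0 = I (\<lambda>t. D 0 * K t) - I (\<lambda>t. D t * K t)"
    proof -
      have "I (\<lambda>t. D 0 * K t) = (LINT t|lborel. D 0 * (indicator (cube L) t *\<^sub>R K t))"
        by (simp add: I_def)
      also have "\<dots> = D 0 * I K"
        unfolding I_def by (rule integral_mult_right_zero)
      finally show ?thesis using I1 ID by simp
    qed
    also have "\<dots> = (LINT t|lborel. indicator (cube L) t *\<^sub>R (D 0 * K t) - indicator (cube L) t *\<^sub>R (D t * K t))"
      unfolding I_def by (intro Bochner_Integration.integral_diff[symmetric] integrable_cube continuous_intros Kc cont)
    also have "cmod \<dots> \<le> (LINT t|lborel. indicator (cube L) t *\<^sub>R ((e + C * (\<Sum>j\<in>UNIV. 1 - cos (k * t $ j))) * Re (K t)))"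
    proof (rule order_trans[OF integral_norm_bound integral_mono])
      show "integrable lborel (\<lambda>t. norm (indicator (cube L) t *\<^sub>R (D 0 * K t) - indicator (cube L) t *\<^sub>R (D t * K t)))"
        by (intro integrable_norm Bochner_Integration.integrable_diff integrable_cube continuous_intros Kc cont)
      show "integrable lborel (\<lambda>t. indicator (cube L) t *\<^sub>R ((e + C * (\<Sum>j\<in>UNIV. 1 - cos (k * t $ j))) * Re (K t)))"
        by (intro integrable_cube continuous_intros Kc)
      show "norm (indicator (cube L) t *\<^sub>R (D 0 * K t) - indicator (cube L) t *\<^sub>R (D t * K t))
          \<le> indicator (cube L) t *\<^sub>R ((e + C * (\<Sum>j\<in>UNIV. 1 - cos (k * t $ j))) * Re (K t))" for t
      proof (cases "t \<in> cube L")
        case True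
        have "cmod (D 0 * K t - D t * K t) = cmod (D 0 - D t) * Re (K t)"
          unfolding left_diff_distrib[symmetric] norm_mult by (simp add: Kr norm_power)
        also have "\<dots> \<le> (e + C * (\<Sum>j\<in>UNIV. 1 - cos (k * t $ j))) * Re (K t)"
          using C[OF True] by (intro mult_right_mono) (auto simp: Kr)
        finally show ?thesis using True by simp
      qed simp
    qed
    also have "\<dots> = Re (I (\<lambda>t. (of_real e + of_real C * (\<Sum>j\<in>UNIV. 1 - E (axis j 1) t)) * K t))"
    proof -
      have "indicator (cube L) t *\<^sub>R ((e + C * (\<Sum>j\<in>UNIV. 1 - cos (k * t $ j))) * Re (K t))
        = Re (indicator (cube L) t *\<^sub>R ((of_real e + of_real C * (\<Sum>j\<in>UNIV. 1 - E (axis j 1) t)) * K t))" for t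
        by (simp add: Kr Ejc Re_sum)
      then show ?thesis
        unfolding I_def
        by (simp only:) (intro integral_Re integrable_cube continuous_intros Ec Kc)
    qed
    also have "I (\<lambda>t. (of_real e + of_real C * (\<Sum>j\<in>UNIV. 1 - E (axis j 1) t)) * K t)
       = of_real e * I K + of_real C * (\<Sum>j\<in>(UNIV::'n set). I K - I (\<lambda>t. E (axis j 1) t * K t))"
    proof -
      have "indicator (cube L) t *\<^sub>R ((of_real e + of_real C * (\<Sum>j\<in>UNIV. 1 - E (axis j 1) t)) * K t)
       = of_real e * (indicator (cube L) t *\<^sub>R K t) + of_real C * (\<Sum>j\<in>(UNIV::'n set). indicator (cube L) t *\<^sub>R K t - indicator (cube L) t *\<^sub>R (E (axis j 1) t * K t))" for t
        by (simp add: algebra_simps sum_subtractf sum_distrib_left sum_distrib_right scaleR_sum_right)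
      moreover have "integrable lborel (\<lambda>t. indicator (cube L) t *\<^sub>R K t)"
        "\<And>j. integrable lborel (\<lambda>t. indicator (cube L) t *\<^sub>R (E (axis j 1) t * K t))"
        by (intro integrable_cube continuous_intros Ec Kc)+
      moreover have "(LINT t|lborel. a * f t + b * (\<Sum>j\<in>UNIV. f t - g j t))
          = a * (LINT t|lborel. f t) + b * (\<Sum>j\<in>(UNIV::'n set). (LINT t|lborel. f t) - (LINT t|lborel. g j t))"
        if "integrable lborel f" "\<And>j. integrable lborel (g j)" for a b f and g :: "'n \<Rightarrow> real^'n \<Rightarrow> complex"
        using that by simp
      ultimately show ?thesis
        unfolding I_def by (simp only:)
    qed
    also have "\<dots> = V * (of_real e * of_nat (N ^ CARD('n)) + of_real C * of_nat (CARD('n)) * of_nat (N ^ (CARD('n) - 1)))"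
    proof -
      have "real N ^ CARD('n) = real N * real N ^ (CARD('n) - 1)"
        by (metis zero_less_card_finite power_eq_if less_numeral_extra(3))
      then have "complex_of_nat (N ^ CARD('n)) - of_nat ((N - 1) * N ^ (CARD('n) - 1)) = of_nat (N ^ (CARD('n) - 1))"
        using N by (simp add: of_nat_diff left_diff_distrib) (metis of_real_of_nat_eq of_real_mult of_real_power)
      then have "I K - I (\<lambda>t. E (axis j 1) t * K t) = V * of_nat (N ^ (CARD('n) - 1))" for j
        unfolding I1 Ij right_diff_distrib[symmetric] by (simp only:)
      then have "of_real e * I K + of_real C * (\<Sum>j\<in>(UNIV::'n set). I K - I (\<lambda>t. E (axis j 1) t * K t))
         = of_real e * (V * of_nat (N ^ CARD('n))) + of_real C * (\<Sum>j\<in>(UNIV::'n set). V * of_nat (N ^ (CARD('n) - 1)))"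
        unfolding I1[symmetric] by (simp only:)
      then show ?thesis by (simp add: distrib_left mult_ac)
    qed
    finally have "cmod (V * of_nat (N ^ CARD('n)) * D 0) \<le> Re (V * (of_real e * of_nat (N ^ CARD('n)) + of_real C * of_nat (CARD('n)) * of_nat (N ^ (CARD('n) - 1))))" .
    also have "V * (of_real e * of_nat (N ^ CARD('n)) + of_real C * of_nat (CARD('n)) * of_nat (N ^ (CARD('n) - 1)))
       = of_real (L ^ CARD('n) * (e * N ^ CARD('n) + C * CARD('n) * N ^ (CARD('n) - 1)))"
      by (simp add: V_def)
    finally have "L ^ CARD('n) * real N ^ CARD('n) * cmod (D 0) \<le> L ^ CARD('n) * (e * N ^ CARD('n) + C * CARD('n) * N ^ (CARD('n) - 1))"
      using L0 by (simp add: V_def norm_mult norm_power)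
    then have "real N ^ CARD('n) * cmod (D 0) \<le> e * N ^ CARD('n) + C * CARD('n) * N ^ (CARD('n) - 1)"
      using L0 by (simp add: mult.assoc)
    moreover have "real N ^ CARD('n) = real N * real N ^ (CARD('n) - 1)"
      by (metis zero_less_card_finite power_eq_if less_numeral_extra(3))
    ultimately have "real N ^ (CARD('n) - 1) * (real N * cmod (D 0)) \<le> real N ^ (CARD('n) - 1) * (real N * e + C * CARD('n))"
      by (simp add: algebra_simps)
    then have "real N * cmod (D 0) \<le> real N * e + C * CARD('n)"
      using N by simp
    then show ?thesis using N by (simp add: field_simps)
  qed
  have "cmod (D 0) \<le> 0"
  proof (rule field_le_epsilon)
    fix e :: real assume e: "e > 0"
    have "isCont D 0" using cont by (simp add: continuous_on_eq_continuous_at)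
    then obtain \<delta> where \<delta>: "\<delta> > 0" "\<And>t. norm t < \<delta> \<Longrightarrow> cmod (D t - D 0) < e"
      using e by (auto simp: continuous_at_eps_delta dist_norm)
    \<comment> \<open>Chosen so that \<open>norm t \<ge> \<delta>\<close> forces a coordinate of
      size at least \<open>d\<close>, while \<open>k * d\<close> stays in the interval where cosine
      is monotone.\<close>
    define d where "d = min (\<delta> / (2 * CARD('n))) (pi / k)"
    have d: "0 < d" "d \<le> pi / k" "CARD('n) * d < \<delta>"
    proof -
      show "0 < d" "d \<le> pi / k" using \<delta> k by (auto simp: d_def)
      have "CARD('n) * d \<le> CARD('n) * (\<delta> / (2 * CARD('n)))"
        by (intro mult_left_mono) (auto simp: d_def)
      also have "\<dots> < \<delta>" using \<delta> by simp
      finally show "CARD('n) * d < \<delta>" .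
    qed
    define c where "c = 1 - cos (k * d)"
    have c: "c > 0"
      using cos_monotone_0_pi[of 0 "k * d"] d k by (simp add: c_def field_simps)
    have M: "M \<ge> 0" using bdd[of 0] by (meson norm_ge_zero order_trans)
    \<comment> \<open>Away from the origin the test function is at least \<open>c\<close>, so
      \<open>C * c = 2 * M\<close> covers the trivial bound for \<open>D 0 - D t\<close>.\<close>
    define C where "C = 2 * M / c"
    have C: "cmod (D 0 - D t) \<le> e + C * (\<Sum>j\<in>UNIV. 1 - cos (k * t $ j))" if t: "t \<in> cube L" for t
    proof (cases "norm t < \<delta>")
      case True
      have "0 \<le> C * (\<Sum>j\<in>(UNIV::'n set). 1 - cos (k * t $ j))"
        using M c by (intro mult_nonneg_nonneg sum_nonneg) (auto simp: C_def)
      then show ?thesis using \<delta>(2)[OF True] by (simp add: norm_minus_commute)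
    next
      case False
      then have "c \<le> (\<Sum>j\<in>UNIV. 1 - cos (k * t $ j))"
        unfolding c_def using t d by (intro vec_near_or_cos_large[OF k]) (auto simp: L)
      then have "C * c \<le> C * (\<Sum>j\<in>UNIV. 1 - cos (k * t $ j))"
        using M c by (intro mult_left_mono) (auto simp: C_def)
      moreover have "C * c = 2 * M" using c by (simp add: C_def)
      moreover have "cmod (D 0 - D t) \<le> M + M"
        using norm_triangle_ineq4[of "D 0" "D t"] bdd[of 0] bdd[of t] by linarith
      ultimately show ?thesis using e by linarith
    qed
    have "cmod (D 0) \<le> e + C * CARD('n) / real (Suc N)" for N
      using main[OF _ C, of "Suc N"] by simp
    moreover have "(\<lambda>N. e + C * CARD('n) / real (Suc N)) \<longlonglongrightarrow> e + 0"
      by (intro tendsto_intros tendsto_divide_0[OF tendsto_const] filterlim_at_top_imp_at_infinity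
        filterlim_compose[OF filterlim_real_sequentially filterlim_Suc])
    ultimately have "cmod (D 0) \<le> e + 0"
      by (intro tendsto_lowerbound[of _ _ sequentially]) auto
    then show "cmod (D 0) \<le> 0 + e" by simp
  qed
  then show ?thesis by simp
qed


lemma cube_tiling:
  assumes "L > 0"
  shows "\<exists>l0. \<forall>l. t - L *\<^sub>R ivec l \<in> cube L \<longleftrightarrow> l = (l0::int^'n::finite)"
proof (intro exI[of _ "\<chi> j. \<lfloor>t $ j / L + 1 / 2\<rfloor>"] allI)
  fix l :: "int^'n"
  have "- L / 2 \<le> t $ j - L * real_of_int (l $ j) \<and> t $ j - L * real_of_int (l $ j) < L / 2
      \<longleftrightarrow> \<lfloor>t $ j / L + 1 / 2\<rfloor> = l $ j" for j
    using assms by (auto simp: floor_eq_iff field_simps)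
  then show "t - L *\<^sub>R ivec l \<in> cube L \<longleftrightarrow> l = (\<chi> j. \<lfloor>t $ j / L + 1 / 2\<rfloor>)"
    by (auto simp: cube_def vec_eq_iff)
qed

lemma zero_in_cube: "L > 0 \<Longrightarrow> 0 \<in> cube L"
  by (simp add: cube_def)

text \<open>One box serves all \<open>t\<close> in the period cube, so on that cube a periodization
  is one fixed finite sum and inherits continuity.\<close>

lemma compact_support_translates:
  fixes h :: "real^'n::finite \<Rightarrow> 'a::zero"
  assumes L: "L > 0" and supp: "\<And>t. r < norm t \<Longrightarrow> h t = 0"
  shows "\<exists>R. \<forall>t\<in>cube L. \<forall>l. h (s + t + L *\<^sub>R ivec l) \<noteq> 0 \<longrightarrow> l \<in> lbox R"
proof -
  obtain R :: nat where R: "(r + norm s) / L + 1 / 2 \<le> real R" using real_arch_simple by blast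
  have "l \<in> lbox R" if t: "t \<in> cube L" and h: "h (s + t + L *\<^sub>R ivec l) \<noteq> 0" for t l
  proof -
    have "\<bar>l $ j\<bar> \<le> int R" for j
    proof -
      have "norm (s + t + L *\<^sub>R ivec l) \<le> r" using supp h by (meson not_le)
      then have "\<bar>(s + t + L *\<^sub>R ivec l) $ j\<bar> \<le> r"
        using component_le_norm_cart order_trans by blast
      moreover have "\<bar>t $ j\<bar> \<le> L / 2"
        using t by (auto simp: cube_def abs_le_iff dest!: spec[of _ j])
      moreover have "\<bar>s $ j\<bar> \<le> norm s" by (rule component_le_norm_cart)
      ultimately have "\<bar>L * real_of_int (l $ j)\<bar> \<le> r + norm s + L / 2"
        by simp
      moreover have "L * ((r + norm s) / L + 1 / 2) = r + norm s + L / 2"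
        using L by (simp add: field_simps)
      ultimately have "L * \<bar>real_of_int (l $ j)\<bar> \<le> L * ((r + norm s) / L + 1 / 2)"
        using L by (simp add: abs_mult)
      then have "\<bar>real_of_int (l $ j)\<bar> \<le> real R"
        using L R by simp
      then show ?thesis by linarith
    qed
    then show ?thesis by (simp add: lbox_def)
  qed
  then show ?thesis by blast
qed

lemma integrable_compact_support:
  fixes h :: "real^'n::finite \<Rightarrow> complex"
  assumes "continuous_on UNIV h" and supp: "\<And>t. r < norm t \<Longrightarrow> h t = 0"
  shows "integrable lborel h"
proof -
  have "integrable lborel (\<lambda>x. indicator (cball 0 r) x *\<^sub>R h x)"
    by (rule borel_integrable_compact) (use assms in \<open>auto intro: continuous_on_subset\<close>)
  also have "(\<lambda>x. indicator (cball 0 r) x *\<^sub>R h x) = h"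
    using supp by (auto simp: indicator_def fun_eq_iff not_le)
  finally show ?thesis .
qed

lemma bounded_compact_support:
  fixes h :: "real^'n::finite \<Rightarrow> complex"
  assumes "continuous_on UNIV h" and supp: "\<And>t. r < norm t \<Longrightarrow> h t = 0"
  shows "\<exists>M\<ge>0. \<forall>t. cmod (h t) \<le> M"
proof -
  have "compact (h ` cball 0 r)"
    by (rule compact_continuous_image) (use assms in \<open>auto intro: continuous_on_subset\<close>)
  then obtain M where M: "\<forall>x\<in>h ` cball 0 r. cmod x \<le> M"
    using compact_imp_bounded bounded_iff by blast
  have "cmod (h t) \<le> max M 0" for t
    using M supp[of t] by (cases "norm t \<le> r") (auto simp: not_le le_max_iff_disj)
  then show ?thesis by (intro exI[of _ "max M 0"]) auto
qed

text \<open>With the point \<open>s\<close> moved to the origin, the finite sum \<open>H\<close> and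
  the series \<open>S\<close> are continuous and bounded, and after normalization have equal Fourier
  coefficients, so they agree at 0 by the uniqueness lemma. Summability of the coefficients replaces
  smoothness of \<open>h\<close>.\<close>

lemma poisson_summation:
  fixes h :: "real^'n::finite \<Rightarrow> complex"
  assumes k: "k > 0" and L: "L = 2 * pi / k" and cont: "continuous_on UNIV h"
    and supp: "\<And>t. r < norm t \<Longrightarrow> h t = 0"
    and sm: "(\<lambda>m. cmod (FT h (k *\<^sub>R ivec m))) summable_on UNIV"
  shows "finite {l. h (s + L *\<^sub>R ivec l) \<noteq> 0}"
    and "((\<lambda>m. FT h (k *\<^sub>R ivec m) * cis (k * (ivec m \<bullet> s))) has_sum
      of_real (L ^ CARD('n)) * (\<Sum>\<^sub>\<infinity>l. h (s + L *\<^sub>R ivec l))) UNIV"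
proof -
  have L0: "L > 0" using k L by simp
  obtain R where R: "\<And>t l. t \<in> cube L \<Longrightarrow> h (s + t + L *\<^sub>R ivec l) \<noteq> 0 \<Longrightarrow> l \<in> lbox R"
    using compact_support_translates[of L r h s, OF L0 supp] by blast
  have R0: "h (s + L *\<^sub>R ivec l) \<noteq> 0 \<Longrightarrow> l \<in> lbox R" for l
    using R[OF zero_in_cube[OF L0]] by simp
  then show fin: "finite {l. h (s + L *\<^sub>R ivec l) \<noteq> 0}"
    by (intro finite_subset[OF _ finite_lbox[of R]]) auto
  have hi: "integrable lborel h" by (rule integrable_compact_support[OF cont supp])
  have hm [measurable]: "h \<in> borel_measurable borel" using borel_measurable_integrable[OF hi] by simp
  obtain M where M: "\<And>t. cmod (h t) \<le> M" using bounded_compact_support[OF cont supp] by blast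
  define E where "E m t = cis (k * (ivec m \<bullet> t))" for m :: "int^'n" and t
  have Ec: "continuous_on UNIV (E m)" for m
    unfolding E_def by (intro continuous_intros)
  define a where "a m = FT h (k *\<^sub>R ivec m) * E m s" for m
  have asm: "(\<lambda>m. cmod (a m)) summable_on UNIV"
    using sm by (simp add: a_def E_def norm_mult)
  obtain e :: "nat \<Rightarrow> int^'n" where e: "bij e" using int_vec_enum by blast
  have asm': "summable (\<lambda>i. cmod (a (e i)))" by (rule summable_on_enum[OF e asm])
  define S where "S t = (\<Sum>i. a (e i) * E (e i) t)" for t
  have S: "(\<lambda>i. a (e i) * E (e i) t) sums S t" for t
    unfolding S_def by (rule summable_sums, rule summable_norm_cancel) (use asm' in \<open>simp add: norm_mult E_def\<close>)
  have Sc: "continuous_on UNIV S"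
  proof (rule continuous_on_series[OF _ _ asm' S])
    show "continuous_on UNIV (\<lambda>t. a (e i) * E (e i) t)" for i by (intro continuous_intros Ec)
    show "cmod (a (e i) * E (e i) t) \<le> cmod (a (e i))" for i t by (simp add: norm_mult E_def)
  qed
  have Sb: "cmod (S t) \<le> (\<Sum>i. cmod (a (e i)))" for t
  proof -
    have "cmod (S t) \<le> (\<Sum>i. cmod (a (e i) * E (e i) t))"
      unfolding S_def using asm' by (intro summable_norm) (simp add: norm_mult E_def)
    then show ?thesis by (simp add: norm_mult E_def)
  qed
  \<comment> \<open>This equals the periodization around \<open>s\<close> only for \<open>t\<close>
    in the cube, but the coefficient integrals see nothing else.\<close>
  define H where "H t = (\<Sum>l\<in>lbox R. h (s + t + L *\<^sub>R ivec l))" for t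
  have hcont: "continuous_on UNIV (\<lambda>t. h (f t))" if "continuous_on UNIV f" for f :: "real^'n \<Rightarrow> real^'n"
    using continuous_on_compose2[OF cont that] by simp
  have Hc: "continuous_on UNIV H"
    unfolding H_def by (intro continuous_intros hcont)
  have Hb: "cmod (H t) \<le> real (card (lbox R :: (int^'n) set)) * M" for t
    unfolding H_def by (rule sum_norm_bound) (rule M)
  define D where "D t = of_real (L ^ CARD('n)) * H t - S t" for t
  have "D 0 = 0"
  proof (rule zero_of_fourier_coefficients_zero[OF k L])
    show "continuous_on UNIV D"
      unfolding D_def by (intro continuous_intros Hc Sc)
    show "cmod (D t) \<le> L ^ CARD('n) * (real (card (lbox R :: (int^'n) set)) * M) + (\<Sum>i. cmod (a (e i)))" for t
    proof -
      have "cmod (D t) \<le> cmod (of_real (L ^ CARD('n)) * H t) + cmod (S t)"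
        unfolding D_def by (rule norm_triangle_ineq4)
      also have "cmod (of_real (L ^ CARD('n)) * H t) = L ^ CARD('n) * cmod (H t)"
        using L0 by (simp add: norm_mult norm_power)
      finally have "cmod (D t) \<le> L ^ CARD('n) * cmod (H t) + cmod (S t)" .
      moreover have "L ^ CARD('n) * cmod (H t) \<le> L ^ CARD('n) * (real (card (lbox R :: (int^'n) set)) * M)"
        using L0 by (intro mult_left_mono Hb) simp
      ultimately show ?thesis using Sb[of t] by linarith
    qed
    fix p :: "int^'n"
    have per: "E p (t + L *\<^sub>R ivec l) = E p t" for t l
    proof -
      have "k * (ivec p \<bullet> (t + L *\<^sub>R ivec l)) = k * (ivec p \<bullet> t) + 2 * pi * (ivec p \<bullet> ivec l)"
        using k by (simp add: L inner_add_right algebra_simps)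
      also have "(ivec p \<bullet> ivec l) = real_of_int (\<Sum>j\<in>UNIV. p $ j * l $ j)"
        by (simp add: inner_vec_def)
      finally show ?thesis by (simp only: E_def cis_mult[symmetric] cis_2pi_int mult_1_right)
    qed
    \<comment> \<open>Unfolding: the character is \<open>L\<close>-periodic and the translated cubes
      tile the space, so the integrals of the translates join to one integral over the whole space.
      The index is \<open>- p\<close> because the character enters without conjugation.\<close>
    have IH: "(LINT t|lborel. indicator (cube L) t *\<^sub>R (H t * E p t)) = a (- p)"
    proof -
      let ?f = "\<lambda>t. h (s + t) * E p t"
      have Ebm [measurable]: "E p \<in> borel_measurable borel"
        by (intro borel_measurable_continuous_onI Ec)
      have fi: "integrable lborel ?f"
        unfolding E_def using integrable_shift[OF hi, of s]
        by (intro integrable_mult_cis) (auto simp: add.commute)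
      have fci: "integrable lborel (\<lambda>t. indicator (cube L) (t - L *\<^sub>R ivec l) *\<^sub>R ?f t)" for l :: "int^'n"
        by (rule Bochner_Integration.integrable_bound[OF fi]) (auto simp: indicator_def norm_mult)
      have "(LINT t|lborel. indicator (cube L) t *\<^sub>R (H t * E p t))
          = (LINT t|lborel. (\<Sum>l\<in>lbox R. indicator (cube L) (t + L *\<^sub>R ivec l - L *\<^sub>R ivec l) *\<^sub>R ?f (t + L *\<^sub>R ivec l)))"
        by (simp add: H_def sum_distrib_right scaleR_sum_right per add.assoc)
      also have "\<dots> = (\<Sum>l\<in>lbox R. (LINT t|lborel. indicator (cube L) (t + L *\<^sub>R ivec l - L *\<^sub>R ivec l) *\<^sub>R ?f (t + L *\<^sub>R ivec l)))"
        by (rule Bochner_Integration.integral_sum) (rule integrable_shift[OF fci])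
      also have "\<dots> = (\<Sum>l\<in>lbox R. (LINT t|lborel. indicator (cube L) (t - L *\<^sub>R ivec l) *\<^sub>R ?f t))"
        by (intro sum.cong refl integral_shift) measurable
      also have "\<dots> = (LINT t|lborel. (\<Sum>l\<in>lbox R. indicator (cube L) (t - L *\<^sub>R ivec l) *\<^sub>R ?f t))"
        by (rule Bochner_Integration.integral_sum[symmetric]) (rule fci)
      also have "\<dots> = (LINT t|lborel. ?f t)"
      proof (rule Bochner_Integration.integral_cong[OF refl])
        fix t
        show "(\<Sum>l\<in>lbox R. indicator (cube L) (t - L *\<^sub>R ivec l) *\<^sub>R ?f t) = ?f t"
        proof (cases "h (s + t) = 0")
          case False
          obtain l0 where l0: "\<And>l::int^'n. t - L *\<^sub>R ivec l \<in> cube L \<longleftrightarrow> l = l0"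
            using cube_tiling[OF L0] by blast
          then have "l0 \<in> lbox R"
            using R[of "t - L *\<^sub>R ivec l0" l0] False by (simp add: algebra_simps)
          moreover have "indicator (cube L) (t - L *\<^sub>R ivec l) *\<^sub>R ?f t = (if l = l0 then ?f t else 0)" for l
            using l0 by (auto simp: indicator_def)
          ultimately show ?thesis by simp
        qed simp
      qed
      also have "\<dots> = (LINT t|lborel. h (s + (t + (- s))) * E p (t + (- s)))"
        by (rule integral_shift[symmetric]) measurable
      also have "\<dots> = (LINT t|lborel. E (- p) s * (h t * cis (- (t \<bullet> (k *\<^sub>R ivec (- p))))))"
        by (intro Bochner_Integration.integral_cong refl)
          (simp add: E_def cis_mult ivec_minus inner_diff_right inner_commute algebra_simps)
      also have "\<dots> = a (- p)"
        by (simp add: a_def FT_def)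
      finally show ?thesis .
    qed
    \<comment> \<open>Termwise integration; by orthogonality only the index with
      \<open>e i = - p\<close> survives.\<close>
    have IS: "(LINT t|lborel. indicator (cube L) t *\<^sub>R (S t * E p t)) = of_real (L ^ CARD('n)) * a (- p)"
    proof -
      let ?g = "\<lambda>i t. indicator (cube L) t *\<^sub>R (a (e i) * E (e i) t * E p t)"
      have gi: "integrable lborel (?g i)" for i
        by (intro integrable_cube continuous_intros Ec)
      have c1: "integrable lborel (\<lambda>t::real^'n. indicator (cube L) t *\<^sub>R (1::real))"
        by (intro integrable_cube continuous_intros)
      have gn: "norm (?g i t) = cmod (a (e i)) * (indicator (cube L) t *\<^sub>R (1::real))" for i t
        by (simp add: norm_mult E_def)
      have "(\<lambda>i. LINT t|lborel. ?g i t) sums (LINT t|lborel. (\<Sum>i. ?g i t))"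
        by (rule sums_integral) (use gi asm' in \<open>auto simp only: gn integral_mult_right_zero intro!: summable_mult2 c1\<close>)
      moreover have "(\<Sum>i. ?g i t) = indicator (cube L) t *\<^sub>R (S t * E p t)" for t
        using sums_scaleR_right[OF sums_mult2[OF S[of t], of "E p t"], of "indicator (cube L) t"]
        by (simp add: sums_iff)
      moreover have "(LINT t|lborel. ?g i t) = (if e i = - p then of_real (L ^ CARD('n)) * a (- p) else 0)" for i
      proof -
        have "?g i t = a (e i) * (indicator (cube L) t *\<^sub>R cis (k * (ivec (e i + p) \<bullet> t)))" for t
          by (simp add: E_def cis_mult ivec_add inner_add_left algebra_simps)
        then have "(LINT t|lborel. ?g i t) = a (e i) * (LINT t|lborel. indicator (cube L) t *\<^sub>R cis (k * (ivec (e i + p) \<bullet> t)))"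
          by (simp only: integral_mult_right_zero)
        also have "\<dots> = (if e i = - p then of_real (L ^ CARD('n)) * a (- p) else 0)"
          unfolding integral_cis_cube[OF k L] by (auto simp: add_eq_0_iff2 mult.commute)
        finally show ?thesis .
      qed
      ultimately have "(\<lambda>i. if e i = - p then of_real (L ^ CARD('n)) * a (- p) else 0) sums (LINT t|lborel. indicator (cube L) t *\<^sub>R (S t * E p t))"
        by simp
      moreover obtain i0 where "\<And>i. e i = - p \<longleftrightarrow> i = i0"
        using e by (metis bij_pointE)
      ultimately have "(\<lambda>i. if i = i0 then of_real (L ^ CARD('n)) * a (- p) else 0) sums (LINT t|lborel. indicator (cube L) t *\<^sub>R (S t * E p t))"
        by simp
      then show ?thesis
        using sums_unique2[OF _ sums_single[of i0 "\<lambda>_. of_real (L ^ CARD('n)) * a (- p)"]] by simp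
    qed
    have "indicator (cube L) t *\<^sub>R (D t * cis (k * (ivec p \<bullet> t)))
       = of_real (L ^ CARD('n)) * (indicator (cube L) t *\<^sub>R (H t * E p t)) - indicator (cube L) t *\<^sub>R (S t * E p t)" for t
      by (simp add: D_def E_def algebra_simps scaleR_diff_right)
    moreover have "integrable lborel (\<lambda>t. indicator (cube L) t *\<^sub>R (H t * E p t))"
      "integrable lborel (\<lambda>t. indicator (cube L) t *\<^sub>R (S t * E p t))"
      by (intro integrable_cube continuous_intros Hc Sc Ec)+
    moreover have "(LINT t|lborel. c * f t - g t) = c * (LINT t|lborel. f t) - (LINT t|lborel. g t)"
      if "integrable lborel f" "integrable lborel g" for c and f g :: "real^'n \<Rightarrow> complex"
      using that by simp
    ultimately show "(LINT t|lborel. indicator (cube L) t *\<^sub>R (D t * cis (k * (ivec p \<bullet> t)))) = 0"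
      using IH IS by (simp only: diff_self)
  qed
  then have S0: "S 0 = of_real (L ^ CARD('n)) * H 0" by (simp add: D_def)
  have H0: "H 0 = (\<Sum>\<^sub>\<infinity>l. h (s + L *\<^sub>R ivec l))"
  proof -
    have "(\<Sum>\<^sub>\<infinity>l. h (s + L *\<^sub>R ivec l)) = (\<Sum>\<^sub>\<infinity>l\<in>lbox R. h (s + L *\<^sub>R ivec l))"
      by (rule infsum_cong_neutral) (use R0 in auto)
    then show ?thesis by (simp add: H_def)
  qed
  have "(a has_sum infsum a UNIV) UNIV"
    using abs_summable_summable[OF asm] by (rule has_sum_infsum)
  moreover from has_sum_enum[OF e this] have "infsum a UNIV = S 0"
    using S[of 0] sums_unique2 by (fastforce simp: E_def)
  ultimately show "((\<lambda>m. FT h (k *\<^sub>R ivec m) * cis (k * (ivec m \<bullet> s))) has_sum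
      of_real (L ^ CARD('n)) * (\<Sum>\<^sub>\<infinity>l. h (s + L *\<^sub>R ivec l))) UNIV"
    using S0 H0 by (simp add: a_def[abs_def] E_def)
qed

section \<open>Fourier transforms of products\<close>

context weight
begin

lemma kernel_weight:
  "\<exists>mu K. mu > 0 \<and> K > 0 \<and> (\<forall>x::real^'n::finite. decay mu x \<le> K / (1 + norm x) ^ (2 * CARD('n)))"
  using exp_weight_le_inverse_power[of "2 * CARD('n)"] by (metis norm_ge_zero)

text \<open>Poisson summation with normalized, enumerated coefficients. The coefficient norms form a
  Riemann sum, whence their sum is bounded independently of \<open>k \<le> 1\<close>: the factor 3
  is the bound per coordinate and \<open>2 * pi\<close> the normalization.\<close>

lemma periodization:
  fixes h :: "real^'n::finite \<Rightarrow> complex"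
  assumes K: "\<And>x::real^'n. decay mu x \<le> K / (1 + norm x) ^ (2 * CARD('n))"
    and cont: "continuous_on UNIV h" and supp: "\<And>t. r < norm t \<Longrightarrow> h t = 0"
    and FTh: "\<And>\<xi>. cmod (FT h \<xi>) \<le> C * decay mu \<xi>"
    and k: "0 < k" and e: "bij (e :: nat \<Rightarrow> int^'n)"
  defines "c \<equiv> \<lambda>i. of_real ((k / (2 * pi)) ^ CARD('n)) * FT h (k *\<^sub>R ivec (e i))"
  shows "finite {l. h (t + (2 * pi / k) *\<^sub>R ivec l) \<noteq> 0}"
    and "(\<lambda>i. c i * cis (k * (ivec (e i) \<bullet> t))) sums (\<Sum>\<^sub>\<infinity>l. h (t + (2 * pi / k) *\<^sub>R ivec l))"
    and "summable (\<lambda>i. cmod (c i))"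
    and "k \<le> 1 \<Longrightarrow> (\<Sum>i. cmod (c i)) \<le> K * (3 / (2 * pi)) ^ CARD('n) * C"
proof -
  let ?d = "CARD('n)"
  define L where "L = 2 * pi / k"
  have L0: "L > 0" using k by (simp add: L_def)
  have C0: "C \<ge> 0" using order_trans[OF norm_ge_zero FTh[of 0]] by (simp add: zero_le_mult_iff)
  have bd: "cmod (FT h (k *\<^sub>R ivec m)) \<le> C * K * (1 / (1 + norm (k *\<^sub>R ivec m)) ^ (2 * ?d))" for m :: "int^'n"
  proof -
    have "cmod (FT h (k *\<^sub>R ivec m)) \<le> C * decay mu (k *\<^sub>R ivec m)" by (rule FTh)
    also have "\<dots> \<le> C * (K / (1 + norm (k *\<^sub>R ivec m)) ^ (2 * ?d))"
      by (intro mult_left_mono K C0)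
    finally show ?thesis by simp
  qed
  have sm: "(\<lambda>m::int^'n. cmod (FT h (k *\<^sub>R ivec m))) summable_on UNIV"
    using bd by (intro summable_on_comparison_test[OF summable_on_cmult_right[OF lattice_summable[OF k]]]) auto
  note po = poisson_summation[OF k L_def cont supp sm, where s = t]
  show "finite {l. h (t + (2 * pi / k) *\<^sub>R ivec l) \<noteq> 0}"
    using po(1) by (simp add: L_def)
  have "(\<lambda>i. FT h (k *\<^sub>R ivec (e i)) * cis (k * (ivec (e i) \<bullet> t))) sums (of_real (L ^ ?d) * (\<Sum>\<^sub>\<infinity>l. h (t + L *\<^sub>R ivec l)))"
    using has_sum_enum[OF e po(2)] .
  then have "(\<lambda>i. of_real ((k / (2 * pi)) ^ ?d) * (FT h (k *\<^sub>R ivec (e i)) * cis (k * (ivec (e i) \<bullet> t))))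
      sums (of_real ((k / (2 * pi)) ^ ?d) * (of_real (L ^ ?d) * (\<Sum>\<^sub>\<infinity>l. h (t + L *\<^sub>R ivec l))))"
    by (rule sums_mult)
  moreover have "complex_of_real ((k / (2 * pi)) ^ ?d) * of_real (L ^ ?d) = 1"
    unfolding of_real_mult[symmetric] power_mult_distrib[symmetric] using k by (simp add: L_def)
  ultimately show "(\<lambda>i. c i * cis (k * (ivec (e i) \<bullet> t))) sums (\<Sum>\<^sub>\<infinity>l. h (t + (2 * pi / k) *\<^sub>R ivec l))"
    by (simp only: c_def mult.assoc[symmetric] mult_1_left L_def)
  have cn: "cmod (c i) = (k / (2 * pi)) ^ ?d * cmod (FT h (k *\<^sub>R ivec (e i)))" for i
    using k by (simp add: c_def norm_mult norm_power norm_divide)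
  show smc: "summable (\<lambda>i. cmod (c i))"
    unfolding cn by (rule summable_mult[OF summable_on_enum[OF e sm]])
  assume k1: "k \<le> 1"
  have "(\<Sum>i<n. cmod (c i)) \<le> K * (3 / (2 * pi)) ^ ?d * C" for n
  proof -
    have "(\<Sum>i<n. cmod (c i)) \<le> (\<Sum>i<n. (k / (2 * pi)) ^ ?d * (C * K * (1 / (1 + norm (k *\<^sub>R ivec (e i))) ^ (2 * ?d))))"
      unfolding cn using k by (intro sum_mono mult_left_mono bd) auto
    also have "\<dots> = (C * K / (2 * pi) ^ ?d) * (\<Sum>i<n. k ^ ?d / (1 + norm (k *\<^sub>R ivec (e i))) ^ (2 * ?d))"
      by (simp add: sum_distrib_left power_divide mult_ac)
    also have "\<dots> \<le> (C * K / (2 * pi) ^ ?d) * 3 ^ ?d"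
    proof (intro mult_left_mono lattice_sum_enum_le k k1 e)
      have "0 \<le> K" using K[of 0] exp_gt_zero[of "- (mu * \<omega> 0)"] by (simp del: exp_gt_zero)
      then show "0 \<le> C * K / (2 * pi) ^ ?d" using C0 by simp
    qed
    finally show ?thesis by (simp add: power_divide mult_ac)
  qed
  then show "(\<Sum>i. cmod (c i)) \<le> K * (3 / (2 * pi)) ^ ?d * C"
    using smc by (intro suminf_le_const)
qed

text \<open>Once the period exceeds \<open>r + norm t\<close>, only the translate with
  \<open>l = 0\<close> meets the support. At each point the periodizations are therefore eventually
  equal to \<open>h\<close>.\<close>

lemma infsum_translates_eq:
  fixes h :: "real^'n::finite \<Rightarrow> complex"
  assumes supp: "\<And>t. r < norm t \<Longrightarrow> h t = 0" and L: "L > r + norm t" "L > 0"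
  shows "(\<Sum>\<^sub>\<infinity>l. h (t + L *\<^sub>R ivec l)) = h t"
proof -
  have "h (t + L *\<^sub>R ivec l) = 0" if l: "l \<noteq> 0" for l :: "int^'n"
  proof (rule supp)
    have "1 \<le> norm (ivec l)" by (rule norm_ivec_ge_1[OF l])
    then have "L * 1 \<le> L * norm (ivec l)" using L by (intro mult_left_mono) auto
    then have "L \<le> norm (L *\<^sub>R ivec l)" using L by simp
    moreover have "norm (L *\<^sub>R ivec l) \<le> norm (t + L *\<^sub>R ivec l) + norm t"
      using norm_triangle_ineq4[of "t + L *\<^sub>R ivec l" t] by simp
    ultimately show "r < norm (t + L *\<^sub>R ivec l)" using L by linarith
  qed
  then have "(\<Sum>\<^sub>\<infinity>l. h (t + L *\<^sub>R ivec l)) = (\<Sum>\<^sub>\<infinity>l\<in>{0}. h (t + L *\<^sub>R ivec l))"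
    by (intro infsum_cong_neutral) auto
  then show ?thesis by simp
qed

lemma FT_modulate:
  assumes "f \<in> borel_measurable borel"
  shows "FT (\<lambda>t. cis (\<mu> \<bullet> t) * f t) \<xi> = FT f (\<xi> - \<mu>)"
  using FT_tf_shift[OF assms, of 0 \<mu> \<xi>] by (simp add: tf_shift_def[abs_def] inner_commute)

text \<open>Multiplying by an absolutely convergent trigonometric series becomes a discrete
  convolution on the transform side.\<close>

lemma FT_trig_series:
  assumes \<phi>: "integrable lborel \<phi>" and c: "summable (\<lambda>i. cmod (c i))"
    and F: "\<And>t. (\<lambda>i. c i * cis (\<mu> i \<bullet> t)) sums F t"
  shows "(\<lambda>i. c i * FT \<phi> (\<xi> - \<mu> i)) sums FT (\<lambda>t. F t * \<phi> t) \<xi>"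
proof -
  have [measurable]: "\<phi> \<in> borel_measurable borel" using borel_measurable_integrable[OF \<phi>] by simp
  have n: "cmod (c i * (cis (\<mu> i \<bullet> t) * \<phi> t)) = cmod (c i) * cmod (\<phi> t)" for i t
    by (simp add: norm_mult)
  have "(\<lambda>i. FT (\<lambda>t. c i * (cis (\<mu> i \<bullet> t) * \<phi> t)) \<xi>) sums FT (\<lambda>t. F t * \<phi> t) \<xi>"
  proof (rule FT_sums)
    show "integrable lborel (\<lambda>t. c i * (cis (\<mu> i \<bullet> t) * \<phi> t))" for i
      using integrable_mult_cis[OF \<phi>, of "\<lambda>t. \<mu> i \<bullet> t"] by (intro integrable_mult_right) (simp add: mult.commute)
    show "(\<lambda>i. c i * (cis (\<mu> i \<bullet> t) * \<phi> t)) sums (F t * \<phi> t)" for t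
      using sums_mult2[OF F[of t], of "\<phi> t"] by (simp add: mult.assoc)
    show "summable (\<lambda>i. cmod (c i * (cis (\<mu> i \<bullet> t) * \<phi> t)))" for t
      unfolding n by (rule summable_mult2[OF c])
    show "summable (\<lambda>i. LINT t|lborel. cmod (c i * (cis (\<mu> i \<bullet> t) * \<phi> t)))"
      unfolding n integral_mult_right_zero by (rule summable_mult2[OF c])
  qed
  then show ?thesis by (simp add: FT_cmult FT_modulate)
qed

lemma exp_weight_shift:
  assumes "lam \<ge> 0"
  shows "decay lam (\<xi> - \<mu>) \<le> exp (lam * \<omega> (norm \<mu>)) * decay lam \<xi>"
proof -
  have "lam * \<omega> (norm \<xi>) \<le> lam * (\<omega> (norm (\<xi> - \<mu>)) + \<omega> (norm \<mu>))"
    by (rule mult_left_mono[OF weight_norm_diff assms])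
  then show ?thesis by (simp add: exp_add[symmetric] algebra_simps)
qed

text \<open>The part \<open>lam\<close> of the decay in \<open>\<eta>\<close> pays for moving the
  weight from \<open>\<xi> - \<eta>\<close> to \<open>\<xi>\<close>; the part \<open>mu\<close> is
  left for summing over \<open>\<eta>\<close>.\<close>

lemma exp_weight_convolve:
  assumes "lam \<ge> 0"
  shows "decay (lam + mu) \<eta> * decay lam (\<xi> - \<eta>) \<le> decay mu \<eta> * decay lam \<xi>"
proof -
  have "lam * \<omega> (norm \<xi>) \<le> lam * (\<omega> (norm (\<xi> - \<eta>)) + \<omega> (norm \<eta>))"
    by (rule mult_left_mono[OF weight_norm_diff assms])
  then show ?thesis by (simp add: exp_add[symmetric] algebra_simps)
qed

text \<open>Replacing \<open>h\<close> by its periodization turns the convolution of the two transforms into a lattice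
  sum; the period then tends to infinity.\<close>

lemma FT_product:
  "\<exists>mu K. mu > 0 \<and> K > 0 \<and> (\<forall>lam\<ge>0. \<forall>C1 C2 r. \<forall>h \<Psi> :: real^'n::finite \<Rightarrow> complex.
     continuous_on UNIV h \<longrightarrow> (\<forall>t. r < norm t \<longrightarrow> h t = 0) \<longrightarrow>
     (\<forall>\<xi>. cmod (FT h \<xi>) \<le> C1 * decay (lam + mu) \<xi>) \<longrightarrow>
     integrable lborel \<Psi> \<longrightarrow> (\<forall>\<xi>. cmod (FT \<Psi> \<xi>) \<le> C2 * decay lam \<xi>) \<longrightarrow>
     (\<forall>\<xi>. cmod (FT (\<lambda>t. h t * \<Psi> t) \<xi>) \<le> K * C1 * C2 * decay lam \<xi>))"
proof -
  obtain mu K where mu: "mu > 0" and K0: "K > 0"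
    and K: "\<And>x::real^'n. decay mu x \<le> K / (1 + norm x) ^ (2 * CARD('n))"
    using kernel_weight by blast
  let ?K = "K * (3 / (2 * pi)) ^ CARD('n)"
  have main: "cmod (FT (\<lambda>t. h t * \<Psi> t) \<xi>) \<le> ?K * C1 * C2 * decay lam \<xi>"
    if lam: "lam \<ge> 0" and hc: "continuous_on UNIV h" and supp: "\<And>t. r < norm t \<Longrightarrow> h t = 0"
      and FTh: "\<And>\<xi>. cmod (FT h \<xi>) \<le> C1 * decay (lam + mu) \<xi>"
      and \<Psi>: "integrable lborel \<Psi>" and FT\<Psi>: "\<And>\<xi>. cmod (FT \<Psi> \<xi>) \<le> C2 * decay lam \<xi>"
    for lam C1 C2 r \<xi> and h \<Psi> :: "real^'n \<Rightarrow> complex"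
  proof -
    have [measurable]: "\<Psi> \<in> borel_measurable borel" using borel_measurable_integrable[OF \<Psi>] by simp
    have C1: "C1 \<ge> 0" using order_trans[OF norm_ge_zero FTh[of 0]] by (simp add: zero_le_mult_iff)
    have C2: "C2 \<ge> 0" using order_trans[OF norm_ge_zero FT\<Psi>[of 0]] by (simp add: zero_le_mult_iff)
    obtain e :: "nat \<Rightarrow> int^'n" where e: "bij e" using int_vec_enum by blast
    have FTh': "cmod (FT h \<eta>) \<le> C1 * decay mu \<eta>" for \<eta>
    proof -
      have "decay (lam + mu) \<eta> \<le> decay mu \<eta>"
        using lam by (simp add: mult_right_mono)
      then show ?thesis using mult_left_mono[OF _ C1] FTh order_trans by blast
    qed
    \<comment> \<open>Meshes tending to 0, that is, periods tending to infinity; all are at most 1,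
      as the uniform Riemann sum bound demands.\<close>
    define k where "k N = 1 / real (Suc N)" for N
    have k: "0 < k N" "k N \<le> 1" for N by (auto simp: k_def)
    define P where "P N t = (\<Sum>\<^sub>\<infinity>l. h (t + (2 * pi / k N) *\<^sub>R ivec l))" for N t
    define c where "c N i = of_real ((k N / (2 * pi)) ^ CARD('n)) * FT h (k N *\<^sub>R ivec (e i))" for N i
    have Ps: "(\<lambda>i. c N i * cis ((k N *\<^sub>R ivec (e i)) \<bullet> t)) sums P N t" for N t
      using periodization(2)[OF K hc supp FTh' k(1)[of N] e, where t = t] by (simp add: P_def c_def)
    have csm: "summable (\<lambda>i. cmod (c N i))" for N
      unfolding c_def by (rule periodization(3)[OF K hc supp FTh' k(1) e])
    \<comment> \<open>Independent of \<open>N\<close>, hence the source of the dominating function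
      when \<open>P N\<close> is replaced by its limit \<open>h\<close> under the integral.\<close>
    have Pb: "cmod (P N t) \<le> ?K * C1" for N t
    proof -
      have "cmod (P N t) \<le> (\<Sum>i. cmod (c N i * cis ((k N *\<^sub>R ivec (e i)) \<bullet> t)))"
        unfolding sums_unique[OF Ps] by (rule summable_norm) (use csm in \<open>simp add: norm_mult\<close>)
      also have "\<dots> \<le> ?K * C1" using periodization(4)[OF K hc supp FTh' k(1)[of N] e k(2)]
        by (simp add: norm_mult c_def)
      finally show ?thesis .
    qed
    have Pm [measurable]: "P N \<in> borel_measurable borel" for N
    proof (rule borel_measurable_continuous_onI, rule continuous_on_series[OF _ _ csm[of N] Ps])
      show "continuous_on UNIV (\<lambda>t. c N i * cis ((k N *\<^sub>R ivec (e i)) \<bullet> t))" for i by (intro continuous_intros)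
    qed (simp add: norm_mult)
    have lim: "(\<lambda>N. P N t) \<longlonglongrightarrow> h t" for t
    proof (rule tendsto_eventually)
      have "filterlim (\<lambda>N. 2 * pi / k N) at_top sequentially"
        unfolding k_def
        by (simp, intro filterlim_tendsto_pos_mult_at_top[OF tendsto_const])
          (auto intro!: filterlim_tendsto_add_at_top[OF tendsto_const] filterlim_real_sequentially)
      then have "eventually (\<lambda>N. 2 * pi / k N > r + norm t) sequentially"
        by (simp add: filterlim_at_top_dense)
      then show "eventually (\<lambda>N. P N t = h t) sequentially"
        by eventually_elim (use k in \<open>auto simp: P_def intro!: infsum_translates_eq supp\<close>)
    qed
    have bound: "cmod (FT (\<lambda>t. P N t * \<Psi> t) \<xi>) \<le> ?K * C1 * C2 * decay lam \<xi>" for N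
    proof -
      let ?x = "\<lambda>i. k N *\<^sub>R ivec (e i)"
      let ?a = "(k N / (2 * pi)) ^ CARD('n)"
      have s: "(\<lambda>i. c N i * FT \<Psi> (\<xi> - ?x i)) sums FT (\<lambda>t. P N t * \<Psi> t) \<xi>"
        by (rule FT_trig_series[OF \<Psi> csm Ps])
      have t: "cmod (c N i * FT \<Psi> (\<xi> - ?x i)) \<le> ?a * C1 * C2 * decay lam \<xi> * decay mu (?x i)" for i
      proof -
        have "cmod (c N i * FT \<Psi> (\<xi> - ?x i)) \<le> ?a * (C1 * decay (lam + mu) (?x i)) * (C2 * decay lam (\<xi> - ?x i))"
        proof -
          have "cmod (c N i) \<le> ?a * (C1 * decay (lam + mu) (?x i))"
            unfolding c_def norm_mult using k(1)[of N] FTh[of "?x i"] by (simp add: norm_power norm_divide mult_left_mono)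
          then show ?thesis unfolding norm_mult
            using C1 k(1)[of N] by (intro mult_mono FT\<Psi>) auto
        qed
        also have "\<dots> = ?a * C1 * C2 * (decay (lam + mu) (?x i) * decay lam (\<xi> - ?x i))"
          by (simp add: mult_ac)
        also have "\<dots> \<le> ?a * C1 * C2 * (decay mu (?x i) * decay lam \<xi>)"
          using C1 C2 k(1)[of N] by (intro mult_left_mono exp_weight_convolve lam) auto
        finally show ?thesis by (simp add: mult_ac)
      qed
      have part: "cmod (\<Sum>i<n. c N i * FT \<Psi> (\<xi> - ?x i)) \<le> ?K * C1 * C2 * decay lam \<xi>" for n
      proof -
        have "cmod (\<Sum>i<n. c N i * FT \<Psi> (\<xi> - ?x i)) \<le> (\<Sum>i<n. ?a * C1 * C2 * decay lam \<xi> * decay mu (?x i))"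
          by (rule order_trans[OF norm_sum sum_mono[OF t]])
        also have "\<dots> \<le> (\<Sum>i<n. ?a * C1 * C2 * decay lam \<xi> * (K / (1 + norm (?x i)) ^ (2 * CARD('n))))"
          using C1 C2 k(1)[of N] by (intro sum_mono mult_left_mono K) auto
        also have "\<dots> = (K * C1 * C2 * decay lam \<xi> / (2 * pi) ^ CARD('n)) * (\<Sum>i<n. k N ^ CARD('n) / (1 + norm (?x i)) ^ (2 * CARD('n)))"
          by (simp add: sum_distrib_left power_divide mult_ac)
        also have "\<dots> \<le> (K * C1 * C2 * decay lam \<xi> / (2 * pi) ^ CARD('n)) * 3 ^ CARD('n)"
          using K0 C1 C2 by (intro mult_left_mono lattice_sum_enum_le k e) auto
        finally show ?thesis by (simp add: power_divide mult_ac)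
      qed
      have "(\<lambda>n. \<Sum>i<n. c N i * FT \<Psi> (\<xi> - ?x i)) \<longlonglongrightarrow> FT (\<lambda>t. P N t * \<Psi> t) \<xi>"
        using s by (simp add: sums_def)
      from tendsto_norm[OF this] show ?thesis
        by (rule LIMSEQ_le_const2) (use part in blast)
    qed
    have "(\<lambda>N. FT (\<lambda>t. P N t * \<Psi> t) \<xi>) \<longlonglongrightarrow> FT (\<lambda>t. h t * \<Psi> t) \<xi>"
      unfolding FT_def
    proof (rule integral_dominated_convergence)
      have [measurable]: "h \<in> borel_measurable borel" by (rule borel_measurable_continuous_onI[OF hc])
      show "(\<lambda>x. h x * \<Psi> x * cis (- (x \<bullet> \<xi>))) \<in> borel_measurable lborel" by measurable
      show "(\<lambda>x. P N x * \<Psi> x * cis (- (x \<bullet> \<xi>))) \<in> borel_measurable lborel" for N by measurable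
      show "integrable lborel (\<lambda>x. (?K * C1) * cmod (\<Psi> x))"
        by (intro integrable_mult_right integrable_norm \<Psi>)
      show "AE x in lborel. (\<lambda>N. P N x * \<Psi> x * cis (- (x \<bullet> \<xi>))) \<longlonglongrightarrow> h x * \<Psi> x * cis (- (x \<bullet> \<xi>))"
        by (intro AE_I2 tendsto_mult lim tendsto_const)
      show "AE x in lborel. norm (P N x * \<Psi> x * cis (- (x \<bullet> \<xi>))) \<le> (?K * C1) * cmod (\<Psi> x)" for N
        unfolding norm_mult norm_cis mult_1_right by (intro AE_I2 mult_right_mono Pb) auto
    qed
    from tendsto_norm[OF this] show ?thesis
      by (rule LIMSEQ_le_const2) (use bound in blast)
  qed
  show ?thesis
  proof (rule exI[of _ mu], rule exI[of _ ?K], intro conjI allI impI mu)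
    show "?K > 0" using K0 by simp
  qed (rule main; blast)
qed

end

section \<open>Inverses of periodic functions\<close>

text \<open>The degree is measured coordinatewise by \<open>R\<close>, so degrees add under
  multiplication and a power has degree \<open>j * R\<close>.\<close>

definition trig_poly :: "real \<Rightarrow> nat \<Rightarrow> (real^'n::finite \<Rightarrow> complex) \<Rightarrow> bool" where
  "trig_poly k R P \<longleftrightarrow> (\<exists>a. \<forall>t. P t = (\<Sum>m\<in>lbox R. a m * cis (k * (ivec m \<bullet> t))))"

text \<open>Frequencies may repeat; grouping equal ones gives the coefficients. For products this
  hides the convolution of the two coefficient families.\<close>

lemma trig_poly_finite_sum:
  fixes \<mu> :: "'i \<Rightarrow> int^'n::finite"
  assumes "finite I" "\<mu> ` I \<subseteq> lbox R"
  shows "trig_poly k R (\<lambda>t. \<Sum>i\<in>I. c i * cis (k * (ivec (\<mu> i) \<bullet> t)))"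
  unfolding trig_poly_def
proof (intro exI[of _ "\<lambda>m. \<Sum>i\<in>{i\<in>I. \<mu> i = m}. c i"] allI)
  fix t
  have "(\<Sum>i\<in>I. c i * cis (k * (ivec (\<mu> i) \<bullet> t)))
     = (\<Sum>m\<in>lbox R. \<Sum>i\<in>{i\<in>I. \<mu> i = m}. c i * cis (k * (ivec (\<mu> i) \<bullet> t)))"
    by (rule sum.group[symmetric]) (use assms in auto)
  then show "(\<Sum>i\<in>I. c i * cis (k * (ivec (\<mu> i) \<bullet> t))) = (\<Sum>m\<in>lbox R. (\<Sum>i\<in>{i\<in>I. \<mu> i = m}. c i) * cis (k * (ivec m \<bullet> t)))"
    by (simp add: sum_distrib_right)
qed

lemma zero_in_lbox: "0 \<in> lbox R"
  by (simp add: lbox_def)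

lemma trig_poly_const: "trig_poly k R (\<lambda>_. c)"
  using trig_poly_finite_sum[of "{()}" "\<lambda>_. 0" R k "\<lambda>_. c"] by (simp add: zero_in_lbox)

lemma trig_poly_diff:
  assumes "trig_poly k R P" "trig_poly k R Q"
  shows "trig_poly k R (\<lambda>t. P t - Q t)"
proof -
  obtain a b where "\<And>t. P t = (\<Sum>m\<in>lbox R. a m * cis (k * (ivec m \<bullet> t)))"
    "\<And>t. Q t = (\<Sum>m\<in>lbox R. b m * cis (k * (ivec m \<bullet> t)))"
    using assms by (auto simp: trig_poly_def)
  then show ?thesis
    unfolding trig_poly_def by (intro exI[of _ "\<lambda>m. a m - b m"]) (simp add: sum_subtractf left_diff_distrib)
qed

lemma lbox_add: "m \<in> lbox R \<Longrightarrow> m' \<in> lbox R' \<Longrightarrow> m + m' \<in> lbox (R + R')"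
proof -
  assume "m \<in> lbox R" "m' \<in> lbox R'"
  then have "\<bar>m $ j\<bar> \<le> int R" "\<bar>m' $ j\<bar> \<le> int R'" for j by (auto simp: lbox_def)
  then have "\<bar>m $ j + m' $ j\<bar> \<le> int R + int R'" for j
    by (meson abs_triangle_ineq add_mono order_trans)
  then show ?thesis by (simp add: lbox_def)
qed

lemma trig_poly_mult:
  fixes P Q :: "real^'n::finite \<Rightarrow> complex"
  assumes "trig_poly k R P" "trig_poly k R' Q"
  shows "trig_poly k (R + R') (\<lambda>t. P t * Q t)"
proof -
  obtain a b where P: "\<And>t. P t = (\<Sum>m\<in>lbox R. a m * cis (k * (ivec m \<bullet> t)))"
    and Q: "\<And>t. Q t = (\<Sum>m\<in>lbox R'. b m * cis (k * (ivec m \<bullet> t)))"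
    using assms by (auto simp: trig_poly_def)
  have "(\<lambda>t. P t * Q t) = (\<lambda>t. \<Sum>i\<in>lbox R \<times> lbox R'. (a (fst i) * b (snd i)) * cis (k * (ivec (fst i + snd i) \<bullet> t)))"
    by (auto simp: P Q sum_product sum.cartesian_product ivec_add inner_add_left distrib_left cis_mult[symmetric]
        intro!: sum.cong)
  moreover have "trig_poly k (R + R') (\<lambda>t. \<Sum>i\<in>lbox R \<times> lbox R'. (a (fst i) * b (snd i)) * cis (k * (ivec (fst i + snd i) \<bullet> t)))"
    by (rule trig_poly_finite_sum) (auto intro: lbox_add)
  ultimately show ?thesis by simp
qed

lemma trig_poly_power:
  assumes "trig_poly k R P" shows "trig_poly k (j * R) (\<lambda>t. P t ^ j)"
proof (induction j)
  case (Suc j)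
  show ?case using trig_poly_mult[OF assms Suc] by simp
qed (simp add: trig_poly_const)

text \<open>By orthogonality a coefficient is the mean of \<open>P\<close> against a character over
  one period. Hence powers can be controlled by the supremum of \<open>P\<close>, which may be far
  smaller than its sum of coefficient norms.\<close>

lemma trig_poly_coeff_bound:
  fixes P :: "real^'n::finite \<Rightarrow> complex"
  assumes k: "k > 0" and P: "\<And>t. P t = (\<Sum>m\<in>lbox R. a m * cis (k * (ivec m \<bullet> t)))"
    and B: "\<And>t. cmod (P t) \<le> B" and n: "n \<in> lbox R"
  shows "cmod (a n) \<le> B"
proof -
  define L where "L = 2 * pi / k"
  have L: "L > 0" using k by (simp add: L_def)
  let ?E = "\<lambda>m t. cis (k * (ivec m \<bullet> t))"
  let ?f = "\<lambda>t. indicator (cube L) t *\<^sub>R (P t * ?E (- n) t)"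
  have "?f t = (\<Sum>m\<in>lbox R. a m * (indicator (cube L) t *\<^sub>R ?E (m - n) t))" for t
    by (simp add: P sum_distrib_right scaleR_sum_right ivec_diff ivec_minus inner_diff_left right_diff_distrib
        cis_mult mult.assoc)
  moreover have "integrable lborel (\<lambda>t. indicator (cube L) t *\<^sub>R ?E (m - n) t)" for m
    by (intro integrable_cube continuous_intros)
  moreover have "(LINT t|lborel. (\<Sum>m\<in>lbox R. a m * f m t)) = (\<Sum>m\<in>lbox R. a m * (LINT t|lborel. f m t))"
    if "\<And>m. integrable lborel (f m)" for f :: "int^'n \<Rightarrow> real^'n \<Rightarrow> complex"
    using that by (subst Bochner_Integration.integral_sum) auto
  ultimately have "(LINT t|lborel. ?f t) = (\<Sum>m\<in>lbox R. a m * (LINT t|lborel. indicator (cube L) t *\<^sub>R ?E (m - n) t))"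
    by (simp only:)
  also have "\<dots> = (\<Sum>m\<in>lbox R. if m = n then a n * of_real L ^ CARD('n) else 0)"
    by (intro sum.cong refl) (simp add: integral_cis_cube[OF k L_def])
  also have "\<dots> = a n * of_real L ^ CARD('n)"
    using n by simp
  finally have eq: "(LINT t|lborel. ?f t) = a n * of_real L ^ CARD('n)" .
  have Pc: "continuous_on UNIV P"
    unfolding P by (intro continuous_intros)
  have "cmod (LINT t|lborel. ?f t) \<le> (LINT t|lborel. indicator (cube L) (t::real^'n) *\<^sub>R B)"
  proof (rule order_trans[OF integral_norm_bound integral_mono])
    show "integrable lborel (\<lambda>t. cmod (?f t))"
      by (intro integrable_norm integrable_cube continuous_intros Pc)
    show "integrable lborel (\<lambda>t::real^'n. indicator (cube L) t *\<^sub>R B)"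
      by (intro integrable_cube continuous_intros)
    show "cmod (?f t) \<le> indicator (cube L) t *\<^sub>R B" for t
      using B by (auto simp: indicator_def norm_mult)
  qed
  \<comment> \<open>The volume of the cube is read off from \<open>integral_cis_cube\<close> at
    frequency 0.\<close>
  also have "\<dots> = L ^ CARD('n) * B"
  proof -
    have "(LINT t|lborel. of_real (indicator (cube L) (t::real^'n))) = complex_of_real L ^ CARD('n)"
      using integral_cis_cube[OF k L_def, of "0::int^'n"] by (simp add: scaleR_conv_of_real)
    then have "complex_of_real (LINT t|lborel. indicator (cube L) (t::real^'n)) = of_real (L ^ CARD('n))"
      by (subst integral_of_real[symmetric])
        (auto simp: integrable_cube[where f = "\<lambda>_. 1::real", simplified])
    then have "(LINT t|lborel. indicator (cube L) (t::real^'n)) = L ^ CARD('n)"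
      by (simp only: of_real_eq_iff)
    then show ?thesis by simp
  qed
  finally show ?thesis using L unfolding eq by (simp add: norm_mult norm_power mult.commute)
qed

section \<open>Multipliers for weighted decay of the Fourier transform\<close>

context weight
begin

text \<open>A stand-in for membership in a weighted Wiener algebra: \<open>M\<close> bounds
  multiplication by \<open>F\<close> as an operator on integrable functions whose transform is
  controlled by \<open>decay lam\<close>. Such bounds are submultiplicative and pass to series, and
  no Fourier coefficients of \<open>F\<close> are involved, which suits
  \<open>1 / G\<close>.\<close>

definition FT_multiplier :: "real \<Rightarrow> real \<Rightarrow> (real^'n::finite \<Rightarrow> complex) \<Rightarrow> bool" where
  "FT_multiplier lam M F \<longleftrightarrow> F \<in> borel_measurable borel \<and> (\<exists>B. \<forall>t. cmod (F t) \<le> B) \<and> 0 \<le> M \<and>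
     (\<forall>\<phi> C. integrable lborel \<phi> \<longrightarrow> (\<forall>\<xi>. cmod (FT \<phi> \<xi>) \<le> C * decay lam \<xi>) \<longrightarrow>
       (\<forall>\<xi>. cmod (FT (\<lambda>t. F t * \<phi> t) \<xi>) \<le> M * C * decay lam \<xi>))"

lemma integrable_mult_bounded:
  fixes F \<phi> :: "real^'n::finite \<Rightarrow> complex"
  assumes [measurable]: "F \<in> borel_measurable borel" and B: "\<And>t. cmod (F t) \<le> B" and \<phi>: "integrable lborel \<phi>"
  shows "integrable lborel (\<lambda>t. F t * \<phi> t)"
proof (rule Bochner_Integration.integrable_bound)
  have [measurable]: "\<phi> \<in> borel_measurable borel" using borel_measurable_integrable[OF \<phi>] by simp
  show "integrable lborel (\<lambda>t. B * cmod (\<phi> t))" by (intro integrable_mult_right integrable_norm \<phi>)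
  show "(\<lambda>t. F t * \<phi> t) \<in> borel_measurable lborel" by measurable
  have "cmod (F t * \<phi> t) \<le> norm (B * cmod (\<phi> t))" for t
    using mult_right_mono[OF B[of t], of "cmod (\<phi> t)"] by (simp add: norm_mult abs_le_iff)
  then show "AE t in lborel. norm (F t * \<phi> t) \<le> norm (B * cmod (\<phi> t))" by simp
qed

lemma FT_multiplierD:
  assumes "FT_multiplier lam M F"
  shows "F \<in> borel_measurable borel" "\<exists>B. \<forall>t. cmod (F t) \<le> B" "0 \<le> M"
    "integrable lborel \<phi> \<Longrightarrow> (\<And>\<xi>. cmod (FT \<phi> \<xi>) \<le> C * decay lam \<xi>) \<Longrightarrow>
      cmod (FT (\<lambda>t. F t * \<phi> t) \<xi>) \<le> M * C * decay lam \<xi>"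
    "integrable lborel \<phi> \<Longrightarrow> integrable lborel (\<lambda>t. F t * \<phi> t)"
proof -
  show m: "F \<in> borel_measurable borel" and B: "\<exists>B. \<forall>t. cmod (F t) \<le> B" and "0 \<le> M"
    using assms unfolding FT_multiplier_def by blast+
  show "cmod (FT (\<lambda>t. F t * \<phi> t) \<xi>) \<le> M * C * decay lam \<xi>"
    if "integrable lborel \<phi>" "\<And>\<xi>. cmod (FT \<phi> \<xi>) \<le> C * decay lam \<xi>"
    using assms that unfolding FT_multiplier_def by blast
  show "integrable lborel (\<lambda>t. F t * \<phi> t)" if "integrable lborel \<phi>"
    using B integrable_mult_bounded[OF m _ that] by blast
qed

lemma FT_multiplier_mono:
  fixes F :: "real^'n::finite \<Rightarrow> complex"
  assumes F: "FT_multiplier lam M F" and M: "M \<le> M'"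
  shows "FT_multiplier lam M' F"
  unfolding FT_multiplier_def
proof (intro conjI allI impI)
  show "F \<in> borel_measurable borel" "\<exists>B. \<forall>t. cmod (F t) \<le> B" "0 \<le> M'"
    using FT_multiplierD(1-3)[OF F] M by auto
  fix \<phi> :: "real^'n \<Rightarrow> complex" and C and \<xi> :: "real^'n" assume \<phi>: "integrable lborel \<phi>" and C: "\<forall>\<xi>. cmod (FT \<phi> \<xi>) \<le> C * decay lam \<xi>"
  have "C \<ge> 0" using order_trans[OF norm_ge_zero C[rule_format, of 0]] by (simp add: zero_le_mult_iff)
  then have "M * C * decay lam \<xi> \<le> M' * C * decay lam \<xi>"
    using M by (intro mult_right_mono) auto
  then show "cmod (FT (\<lambda>t. F t * \<phi> t) \<xi>) \<le> M' * C * decay lam \<xi>"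
    using FT_multiplierD(4)[OF F \<phi>, where C = C and \<xi> = \<xi>] C by force
qed

lemma FT_multiplier_mult:
  fixes F G :: "real^'n::finite \<Rightarrow> complex"
  assumes F: "FT_multiplier lam M F" and G: "FT_multiplier lam N G"
  shows "FT_multiplier lam (M * N) (\<lambda>t. F t * G t)"
  unfolding FT_multiplier_def
proof (intro conjI allI impI)
  note [measurable] = FT_multiplierD(1)[OF F] FT_multiplierD(1)[OF G]
  show "(\<lambda>t. F t * G t) \<in> borel_measurable borel" by measurable
  obtain B1 B2 where B: "\<And>t. cmod (F t) \<le> B1" "\<And>t. cmod (G t) \<le> B2"
    using FT_multiplierD(2)[OF F] FT_multiplierD(2)[OF G] by blast
  have "cmod (F t * G t) \<le> B1 * B2" for t
    unfolding norm_mult using B norm_ge_zero[THEN order_trans[OF _ B(1)]] by (intro mult_mono) auto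
  then show "\<exists>B. \<forall>t. cmod (F t * G t) \<le> B" by blast
  show "0 \<le> M * N" using FT_multiplierD(3)[OF F] FT_multiplierD(3)[OF G] by simp
  fix \<phi> :: "real^'n \<Rightarrow> complex" and C and \<xi> :: "real^'n" assume \<phi>: "integrable lborel \<phi>" and C: "\<forall>\<xi>. cmod (FT \<phi> \<xi>) \<le> C * decay lam \<xi>"
  have "cmod (FT (\<lambda>t. F t * (G t * \<phi> t)) \<xi>) \<le> M * (N * C) * decay lam \<xi>"
    by (rule FT_multiplierD(4)[OF F FT_multiplierD(5)[OF G \<phi>] FT_multiplierD(4)[OF G \<phi> C[rule_format]]])
  then show "cmod (FT (\<lambda>t. F t * G t * \<phi> t) \<xi>) \<le> M * N * C * decay lam \<xi>"
    by (simp add: mult.assoc)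
qed

text \<open>Two majorants with different tasks: \<open>b\<close> bounds the functions pointwise and
  justifies exchanging sum and integral, \<open>M\<close> adds up to the operator bound of the
  limit.\<close>

lemma FT_multiplier_sums:
  fixes F :: "nat \<Rightarrow> real^'n::finite \<Rightarrow> complex"
  assumes F: "\<And>i. FT_multiplier lam (M i) (F i)" and M: "summable M"
    and b: "\<And>i t. cmod (F i t) \<le> b i" and bs: "summable b" and G: "\<And>t. (\<lambda>i. F i t) sums G t"
  shows "FT_multiplier lam (suminf M) G"
  unfolding FT_multiplier_def
proof (intro conjI allI impI)
  note [measurable] = FT_multiplierD(1)[OF F]
  have "G = (\<lambda>t. \<Sum>i. F i t)" using G by (auto simp: sums_iff)
  then show Gm: "G \<in> borel_measurable borel" by simp
  have sb: "summable (\<lambda>i. cmod (F i t))" for t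
    by (rule summable_comparison_test'[OF bs, of 0]) (simp add: b)
  have "cmod (G t) \<le> suminf b" for t
  proof -
    have "cmod (G t) \<le> (\<Sum>i. cmod (F i t))"
      using summable_norm[OF sb[of t]] G[of t] by (simp add: sums_iff)
    also have "\<dots> \<le> suminf b" by (rule suminf_le[OF b sb bs])
    finally show ?thesis .
  qed
  then show "\<exists>B. \<forall>t. cmod (G t) \<le> B" by blast
  show "0 \<le> suminf M" by (rule suminf_nonneg[OF M FT_multiplierD(3)[OF F]])
  fix \<phi> :: "real^'n \<Rightarrow> complex" and C and \<xi> :: "real^'n" assume \<phi>: "integrable lborel \<phi>" and C: "\<forall>\<xi>. cmod (FT \<phi> \<xi>) \<le> C * decay lam \<xi>"
  have bd: "cmod (FT (\<lambda>t. F i t * \<phi> t) \<xi>) \<le> M i * (C * decay lam \<xi>)" for i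
    using FT_multiplierD(4)[OF F \<phi>, where C = C and \<xi> = \<xi>] C by (simp add: mult.assoc)
  have "(\<lambda>i. FT (\<lambda>t. F i t * \<phi> t) \<xi>) sums FT (\<lambda>t. G t * \<phi> t) \<xi>"
  proof (rule FT_sums)
    show "integrable lborel (\<lambda>t. F i t * \<phi> t)" for i by (rule FT_multiplierD(5)[OF F \<phi>])
    show "(\<lambda>i. F i t * \<phi> t) sums (G t * \<phi> t)" for t by (rule sums_mult2[OF G])
    show "summable (\<lambda>i. cmod (F i t * \<phi> t))" for t
      unfolding norm_mult by (rule summable_mult2[OF sb])
    show "summable (\<lambda>i. LINT t|lborel. cmod (F i t * \<phi> t))"
    proof (rule summable_comparison_test'[of "\<lambda>i. b i * (LINT t|lborel. cmod (\<phi> t))" 0])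
      show "summable (\<lambda>i. b i * (LINT t|lborel. cmod (\<phi> t)))" by (rule summable_mult2[OF bs])
      fix i
      have "(LINT t|lborel. cmod (F i t * \<phi> t)) \<le> (LINT t|lborel. b i * cmod (\<phi> t))"
      proof (rule integral_mono)
        show "integrable lborel (\<lambda>t. cmod (F i t * \<phi> t))"
          by (rule integrable_norm[OF FT_multiplierD(5)[OF F \<phi>]])
        show "integrable lborel (\<lambda>t. b i * cmod (\<phi> t))" by (intro integrable_mult_right integrable_norm \<phi>)
        show "cmod (F i t * \<phi> t) \<le> b i * cmod (\<phi> t)" for t
          unfolding norm_mult by (intro mult_right_mono b) simp
      qed
      then show "norm (LINT t|lborel. cmod (F i t * \<phi> t)) \<le> b i * (LINT t|lborel. cmod (\<phi> t))"
        by simp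
    qed
  qed
  then have "FT (\<lambda>t. G t * \<phi> t) \<xi> = (\<Sum>i. FT (\<lambda>t. F i t * \<phi> t) \<xi>)" by (simp add: sums_iff)
  also have "cmod \<dots> \<le> (\<Sum>i. M i * (C * decay lam \<xi>))"
    by (rule norm_suminf_le[OF bd summable_mult2[OF M]])
  also have "\<dots> = suminf M * C * decay lam \<xi>"
    by (simp add: suminf_mult2[OF M, symmetric] mult.assoc)
  finally show "cmod (FT (\<lambda>t. G t * \<phi> t) \<xi>) \<le> suminf M * C * decay lam \<xi>" .
qed

lemma FT_multiplier_sum:
  fixes F :: "'i \<Rightarrow> real^'n::finite \<Rightarrow> complex"
  assumes "finite I" "\<And>i. i \<in> I \<Longrightarrow> FT_multiplier lam (M i) (F i)"
  shows "FT_multiplier lam (sum M I) (\<lambda>t. \<Sum>i\<in>I. F i t)"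
  using assms
proof (induction I rule: finite_induct)
  case empty
  show ?case by (auto simp: FT_multiplier_def FT_def)
next
  case (insert i I)
  have Fi: "FT_multiplier lam (M i) (F i)" and FI: "FT_multiplier lam (sum M I) (\<lambda>t. \<Sum>i\<in>I. F i t)"
    using insert by auto
  note [measurable] = FT_multiplierD(1)[OF Fi] FT_multiplierD(1)[OF FI]
  have "FT_multiplier lam (M i + sum M I) (\<lambda>t. F i t + (\<Sum>i\<in>I. F i t))"
    unfolding FT_multiplier_def
  proof (intro conjI allI impI)
    show "(\<lambda>t. F i t + (\<Sum>i\<in>I. F i t)) \<in> borel_measurable borel" by measurable
    obtain B1 B2 where B: "\<And>t. cmod (F i t) \<le> B1" "\<And>t. cmod (\<Sum>i\<in>I. F i t) \<le> B2"
      using FT_multiplierD(2)[OF Fi] FT_multiplierD(2)[OF FI] by blast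
    have "cmod (F i t + (\<Sum>i\<in>I. F i t)) \<le> B1 + B2" for t
      by (rule norm_triangle_le[OF add_mono[OF B]])
    then show "\<exists>B. \<forall>t. cmod (F i t + (\<Sum>i\<in>I. F i t)) \<le> B" by blast
    show "0 \<le> M i + sum M I" using FT_multiplierD(3)[OF Fi] FT_multiplierD(3)[OF FI] by simp
    fix \<phi> :: "real^'n \<Rightarrow> complex" and C and \<xi> :: "real^'n" assume \<phi>: "integrable lborel \<phi>" and C: "\<forall>\<xi>. cmod (FT \<phi> \<xi>) \<le> C * decay lam \<xi>"
    have "FT (\<lambda>t. (F i t + (\<Sum>i\<in>I. F i t)) * \<phi> t) \<xi> = FT (\<lambda>t. F i t * \<phi> t) \<xi> + FT (\<lambda>t. (\<Sum>i\<in>I. F i t) * \<phi> t) \<xi>"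
      unfolding FT_def distrib_right
      by (intro Bochner_Integration.integral_add integrable_mult_cis FT_multiplierD(5)[OF Fi \<phi>] FT_multiplierD(5)[OF FI \<phi>]) auto
    also have "cmod \<dots> \<le> M i * C * decay lam \<xi> + sum M I * C * decay lam \<xi>"
      using FT_multiplierD(4)[OF Fi \<phi>, of C \<xi>] FT_multiplierD(4)[OF FI \<phi>, of C \<xi>] C
      by (intro norm_triangle_le add_mono) auto
    finally show "cmod (FT (\<lambda>t. (F i t + (\<Sum>i\<in>I. F i t)) * \<phi> t) \<xi>) \<le> (M i + sum M I) * C * decay lam \<xi>"
      by (simp add: distrib_right)
  qed
  then show ?case using insert by simp
qed

lemma FT_multiplier_const: "FT_multiplier lam (cmod c) (\<lambda>t::real^'n::finite. c)"
  unfolding FT_multiplier_def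
proof (intro conjI allI impI)
  show "\<exists>B. \<forall>t::real^'n. cmod c \<le> B" by blast
  fix \<phi> :: "real^'n \<Rightarrow> complex" and C and \<xi> :: "real^'n"
  assume "\<forall>\<xi>. cmod (FT \<phi> \<xi>) \<le> C * decay lam \<xi>"
  then have "cmod c * cmod (FT \<phi> \<xi>) \<le> cmod c * (C * decay lam \<xi>)"
    by (intro mult_left_mono) auto
  then show "cmod (FT (\<lambda>t. c * \<phi> t) \<xi>) \<le> cmod c * C * decay lam \<xi>"
    by (simp only: FT_cmult norm_mult mult.assoc)
qed simp_all

lemma FT_multiplier_cis:
  fixes \<mu> :: "real^'n::finite"
  assumes "lam \<ge> 0"
  shows "FT_multiplier lam (cmod c * exp (lam * \<omega> (norm \<mu>))) (\<lambda>t. c * cis (\<mu> \<bullet> t))"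
proof (rule FT_multiplier_mult[OF FT_multiplier_const], unfold FT_multiplier_def, intro conjI allI impI)
  show "(\<lambda>t. cis (\<mu> \<bullet> t)) \<in> borel_measurable borel" by measurable
  show "\<exists>B. \<forall>t. cmod (cis (\<mu> \<bullet> t)) \<le> B" by (intro exI[of _ 1]) simp
  fix \<phi> :: "real^'n \<Rightarrow> complex" and C and \<xi> :: "real^'n" assume \<phi>: "integrable lborel \<phi>" and C: "\<forall>\<xi>. cmod (FT \<phi> \<xi>) \<le> C * decay lam \<xi>"
  have "C \<ge> 0" using order_trans[OF norm_ge_zero C[rule_format, of 0]] by (simp add: zero_le_mult_iff)
  have "\<phi> \<in> borel_measurable borel" using borel_measurable_integrable[OF \<phi>] by simp
  then have "cmod (FT (\<lambda>t. cis (\<mu> \<bullet> t) * \<phi> t) \<xi>) \<le> C * decay lam (\<xi> - \<mu>)"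
    using C by (simp add: FT_modulate)
  also have "\<dots> \<le> C * (exp (lam * \<omega> (norm \<mu>)) * decay lam \<xi>)"
    by (intro mult_left_mono exp_weight_shift assms \<open>C \<ge> 0\<close>)
  finally show "cmod (FT (\<lambda>t. cis (\<mu> \<bullet> t) * \<phi> t) \<xi>) \<le> exp (lam * \<omega> (norm \<mu>)) * C * decay lam \<xi>"
    by (simp add: mult_ac)
qed simp

lemma norm_ivec_le_lbox: "m \<in> lbox R \<Longrightarrow> norm (ivec (m::int^'n::finite)) \<le> real CARD('n) * real R"
proof -
  assume m: "m \<in> lbox R"
  have "norm (ivec m) \<le> (\<Sum>j\<in>UNIV. \<bar>ivec m $ j\<bar>)" by (rule norm_le_l1_cart)
  also have "\<dots> \<le> (\<Sum>j\<in>(UNIV::'n set). real R)"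
  proof (rule sum_mono)
    fix j
    have "\<bar>m $ j\<bar> \<le> int R" using m by (simp add: lbox_def)
    then show "\<bar>ivec m $ j\<bar> \<le> real R" by simp
  qed
  finally show ?thesis by simp
qed

text \<open>A crude count: every coefficient is at most \<open>B\<close>, there are
  \<open>(2 * R + 1) ^ CARD('n)\<close> of them, and no frequency exceeds
  \<open>k * CARD('n) * R\<close> in norm.\<close>

lemma trig_poly_multiplier:
  fixes P :: "real^'n::finite \<Rightarrow> complex"
  assumes lam: "lam \<ge> 0" and k: "k > 0" and P: "trig_poly k R P" and B: "\<And>t. cmod (P t) \<le> B"
  shows "FT_multiplier lam (B * ((2 * real R + 1) ^ CARD('n) * exp (lam * \<omega> (k * CARD('n) * R)))) P"
proof -
  have B0: "B \<ge> 0" using B[of 0] norm_ge_zero order_trans by blast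
  obtain a where a: "\<And>t. P t = (\<Sum>m\<in>lbox R. a m * cis (k * (ivec m \<bullet> t)))"
    using P by (auto simp: trig_poly_def)
  have m1: "FT_multiplier lam (\<Sum>m\<in>lbox R. cmod (a m) * exp (lam * \<omega> (norm (k *\<^sub>R ivec m)))) (\<lambda>t. \<Sum>m\<in>lbox R. a m * cis ((k *\<^sub>R ivec m) \<bullet> t))"
    by (intro FT_multiplier_sum FT_multiplier_cis lam) auto
  have e1: "(\<lambda>t. \<Sum>m\<in>lbox R. a m * cis ((k *\<^sub>R ivec m) \<bullet> t)) = P"
    by (auto simp: a)
  have l1: "(\<Sum>m\<in>lbox R. cmod (a m) * exp (lam * \<omega> (norm (k *\<^sub>R ivec m))))
     \<le> (\<Sum>m\<in>(lbox R :: (int^'n) set). B * exp (lam * \<omega> (k * CARD('n) * R)))"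
  proof (rule sum_mono)
    fix m :: "int^'n" assume m: "m \<in> lbox R"
    have "norm (k *\<^sub>R ivec m) \<le> k * CARD('n) * R"
      using norm_ivec_le_lbox[OF m] k by (simp add: mult.assoc)
    then have "lam * \<omega> (norm (k *\<^sub>R ivec m)) \<le> lam * \<omega> (k * CARD('n) * R)"
      using lam by (intro mult_left_mono weight_mono) auto
    then show "cmod (a m) * exp (lam * \<omega> (norm (k *\<^sub>R ivec m))) \<le> B * exp (lam * \<omega> (k * CARD('n) * R))"
      using B0 by (intro mult_mono trig_poly_coeff_bound[OF k a B m]) auto
  qed
  have e2: "(\<Sum>m\<in>(lbox R :: (int^'n) set). B * exp (lam * \<omega> (k * CARD('n) * R))) = B * ((2 * real R + 1) ^ CARD('n) * exp (lam * \<omega> (k * CARD('n) * R)))"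
    by (simp add: card_lbox add.commute)
  show ?thesis by (rule FT_multiplier_mono[OF m1[unfolded e1] l1[unfolded e2]])
qed

text \<open>The frequencies of a \<open>j\<close>-th power grow linearly in \<open>j\<close>, while
  the weight is sublinear, so their weights grow more slowly than any exponential in
  \<open>j\<close>. The polynomial number of frequencies is absorbed into a larger exponent.\<close>

lemma subexponential_growth:
  assumes lam: "lam \<ge> 0" and k: "k > 0" and \<delta>: "\<delta> > 0"
  shows "\<exists>C\<ge>0. \<forall>j::nat. (2 * real (j * R) + 1) ^ d * exp (lam * \<omega> (k * real (j * R))) \<le> C * (1 + \<delta>) ^ j"
proof -
  obtain lam0 C0 where l0: "lam0 > 0" "C0 > 0" "\<And>t. t \<ge> 0 \<Longrightarrow> (1 + t) ^ d \<le> C0 * exp (lam0 * \<omega> t)"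
    using power_le_exp_weight by metis
  \<comment> \<open>One slope dominating both \<open>2 * j * R\<close> and
    \<open>k * j * R\<close>.\<close>
  define s where "s = (2 + k) * real R + 1"
  have s: "s > 0" using k by (simp add: s_def add_nonneg_pos)
  \<comment> \<open>Tuned so that \<open>(lam + lam0) * \<epsilon> * s = ln (1 + \<delta>)\<close>,
    which makes the exponential exactly a power of \<open>1 + \<delta>\<close>.\<close>
  define \<epsilon> where "\<epsilon> = ln (1 + \<delta>) / ((lam + lam0) * s)"
  have \<epsilon>: "\<epsilon> > 0" using \<delta> s lam l0 by (simp add: \<epsilon>_def add_nonneg_pos)
  obtain T0 where T0: "\<And>t. t \<ge> T0 \<Longrightarrow> \<omega> t \<le> \<epsilon> * t" using weight_sublinear[OF \<epsilon>] by blast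
  define T where "T = max T0 0"
  have w: "\<omega> t \<le> \<epsilon> * t + \<omega> T" if "t \<ge> 0" for t
  proof (cases "t \<ge> T")
    case True
    then show ?thesis using T0[of t] weight_nonneg[of T] by (simp add: T_def)
  next
    case False
    then show ?thesis using weight_mono[of t T] that \<epsilon> by (simp add: add_increasing)
  qed
  show ?thesis
  proof (intro exI[of _ "C0 * exp ((lam + lam0) * \<omega> T)"] conjI allI)
    show "0 \<le> C0 * exp ((lam + lam0) * \<omega> T)" using l0 by simp
    fix j :: nat
    have sj: "2 * real (j * R) \<le> s * j" "k * real (j * R) \<le> s * j" "0 \<le> s * j"
      using s k by (auto simp: s_def algebra_simps)
    have "(2 * real (j * R) + 1) ^ d \<le> (1 + s * j) ^ d"
      using sj by (intro power_mono) auto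
    also have "\<dots> \<le> C0 * exp (lam0 * \<omega> (s * j))" by (rule l0(3)) (use sj in simp)
    finally have "(2 * real (j * R) + 1) ^ d * exp (lam * \<omega> (k * real (j * R))) \<le> C0 * exp (lam0 * \<omega> (s * j)) * exp (lam * \<omega> (s * j))"
      using sj lam k by (intro mult_mono) (auto intro!: mult_left_mono weight_mono simp: l0(2) less_imp_le)
    also have "\<dots> = C0 * exp ((lam + lam0) * \<omega> (s * j))"
      by (simp add: distrib_right exp_add)
    also have "\<dots> \<le> C0 * exp ((lam + lam0) * (\<epsilon> * (s * j) + \<omega> T))"
      using w[of "s * j"] sj lam l0 by (auto intro!: mult_left_mono)
    also have "(lam + lam0) * (\<epsilon> * (s * j) + \<omega> T) = j * ln (1 + \<delta>) + (lam + lam0) * \<omega> T"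
      using s lam l0 by (simp add: \<epsilon>_def distrib_left add_nonneg_eq_0_iff)
    also have "exp (j * ln (1 + \<delta>) + (lam + lam0) * \<omega> T) = (1 + \<delta>) ^ j * exp ((lam + lam0) * \<omega> T)"
      using \<delta> by (simp add: exp_add exp_of_nat_mult)
    also have "C0 * ((1 + \<delta>) ^ j * exp ((lam + lam0) * \<omega> T)) = C0 * exp ((lam + lam0) * \<omega> T) * (1 + \<delta>) ^ j"
      by (simp only: mult_ac)
    finally show "(2 * real (j * R) + 1) ^ d * exp (lam * \<omega> (k * real (j * R))) \<le> C0 * exp ((lam + lam0) * \<omega> T) * (1 + \<delta>) ^ j" .
  qed
qed

text \<open>A Wiener lemma: \<open>1 / G\<close> is a Neumann series in \<open>F = 1 - G / C\<close>, and \<open>F\<close> is a trigonometric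
  polynomial \<open>P\<close> plus a part \<open>r\<close> that is small in the weighted norm. The coefficients of \<open>P ^ j\<close> are
  bounded by \<open>sup \<bar>P\<bar> ^ j\<close>, while their number and weights grow subexponentially in \<open>j\<close>.\<close>

lemma inverse_multiplier:
  fixes G :: "real^'n::finite \<Rightarrow> real"
  assumes lam: "lam \<ge> 0" and k: "k > 0"
    and G: "\<And>t. (\<lambda>i. c i * cis (k * (ivec (\<mu> i) \<bullet> t))) sums complex_of_real (G t)"
    and sm: "summable (\<lambda>i. cmod (c i) * exp (lam * \<omega> (norm (k *\<^sub>R ivec (\<mu> i)))))"
    and b: "b > 0" "\<And>t. b \<le> G t"
  shows "\<exists>M. FT_multiplier lam M (\<lambda>t. complex_of_real (1 / G t))"
proof -
  let ?w = "\<lambda>i. exp (lam * \<omega> (norm (k *\<^sub>R ivec (\<mu> i))))"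
  have w1: "1 \<le> ?w i" for i using lam weight_norm_nonneg[of "k *\<^sub>R ivec (\<mu> i)"] by (simp del: weight_norm_nonneg norm_scaleR)
  have sc: "summable (\<lambda>i. cmod (c i))"
    by (rule summable_comparison_test'[OF sm, of 0]) (use mult_left_mono[OF w1] in \<open>fastforce simp del: norm_scaleR\<close>)
  \<comment> \<open>The sum of coefficient norms dominates \<open>G\<close>, so
    \<open>1 - G / C\<close> lies between 0 and \<open>1 - b / C < 1\<close>.\<close>
  define C where "C = (\<Sum>i. cmod (c i))"
  have GC: "G t \<le> C" for t
  proof -
    have "cmod (of_real (G t)) \<le> (\<Sum>i. cmod (c i * cis (k * (ivec (\<mu> i) \<bullet> t))))"
      unfolding sums_unique[OF G] by (rule summable_norm) (use sc in \<open>simp add: norm_mult\<close>)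
    then show ?thesis by (simp add: C_def norm_mult)
  qed
  have C0: "C > 0" using b GC[of 0] b(2)[of 0] by linarith
  define \<rho> where "\<rho> = 1 - b / C"
  have bC: "b \<le> C" using order_trans[OF b(2) GC] .
  have \<rho>: "0 \<le> \<rho>" "\<rho> < 1" using b bC C0 by (auto simp: \<rho>_def)
  \<comment> \<open>A quarter of the gap below 1, because the ratio \<open>\<rho>\<close>
    deteriorates three times: passing from \<open>F\<close> to \<open>P\<close>, the subexponential
    factor of the powers of \<open>P\<close>, and the remainder \<open>r\<close>.\<close>
  define \<eta> where "\<eta> = (1 - \<rho>) / 4"
  have \<eta>: "\<eta> > 0" "\<rho> + 3 * \<eta> < 1" "\<rho> + \<eta> \<le> 1" using \<rho> by (auto simp: \<eta>_def field_simps)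
  define F where "F t = complex_of_real (1 - G t / C)" for t
  have Fb: "cmod (F t) \<le> \<rho>" for t
  proof -
    have "b / C \<le> G t / C" "G t / C \<le> 1" using b(2)[of t] GC[of t] C0 by (auto intro: divide_right_mono)
    then show ?thesis unfolding F_def norm_of_real \<rho>_def by (simp add: abs_le_iff)
  qed
  obtain n0 where n0: "(\<Sum>i. cmod (c (i + n0)) * ?w (i + n0)) < C * \<eta>"
  proof -
    have "(\<lambda>n. \<Sum>i. cmod (c (i + n)) * ?w (i + n)) \<longlonglongrightarrow> 0"
      using suminf_exist_split2[OF sm] .
    moreover have "C * \<eta> > 0" using C0 \<eta> by simp
    ultimately have "eventually (\<lambda>n. (\<Sum>i. cmod (c (i + n)) * ?w (i + n)) < C * \<eta>) sequentially"
      by (rule order_tendstoD(2))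
    then show ?thesis using that by (auto simp: eventually_sequentially)
  qed
  define P where "P t = 1 - (\<Sum>i<n0. (c i / of_real C) * cis (k * (ivec (\<mu> i) \<bullet> t)))" for t
  define r where "r t = F t - P t" for t
  have rs: "(\<lambda>i. (- (c (i + n0) / of_real C)) * cis ((k *\<^sub>R ivec (\<mu> (i + n0))) \<bullet> t)) sums r t" for t
  proof -
    have "(\<lambda>i. c (i + n0) * cis (k * (ivec (\<mu> (i + n0)) \<bullet> t))) sums (of_real (G t) - (\<Sum>i<n0. c i * cis (k * (ivec (\<mu> i) \<bullet> t))))"
      by (rule sums_split_initial_segment[OF G])
    from sums_mult[OF this, of "- 1 / of_real C"] show ?thesis
      using C0 by (simp add: r_def F_def P_def sum_divide_distrib[symmetric] sum_distrib_left diff_divide_distrib)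
  qed
  have smt: "summable (\<lambda>i. cmod (- (c (i + n0) / of_real C)) * ?w (i + n0))"
    using summable_divide[OF summable_ignore_initial_segment[OF sm, of n0], of C] C0
    by (simp add: norm_divide)
  have rM: "FT_multiplier lam \<eta> r"
  proof (rule FT_multiplier_mono)
    show "FT_multiplier lam (\<Sum>i. cmod (- (c (i + n0) / of_real C)) * ?w (i + n0)) r"
    proof (rule FT_multiplier_sums[OF FT_multiplier_cis[OF lam] smt _ smt rs])
      show "cmod (- (c (i + n0) / complex_of_real C) * cis (k *\<^sub>R ivec (\<mu> (i + n0)) \<bullet> t))
          \<le> cmod (- (c (i + n0) / of_real C)) * ?w (i + n0)" for i t
        unfolding norm_mult norm_cis by (rule mult_left_mono[OF w1]) simp
    qed
    have "(\<Sum>i. cmod (- (c (i + n0) / of_real C)) * ?w (i + n0)) = (\<Sum>i. cmod (c (i + n0)) * ?w (i + n0)) / C"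
      using C0 suminf_divide[OF summable_ignore_initial_segment[OF sm, of n0], of C] by (simp add: norm_divide)
    also have "\<dots> \<le> \<eta>" using n0 C0 by (simp add: divide_le_eq mult.commute less_imp_le)
    finally show "(\<Sum>i. cmod (- (c (i + n0) / of_real C)) * ?w (i + n0)) \<le> \<eta>" .
  qed
  have rb: "cmod (r t) \<le> \<eta>" for t
  proof -
    have "cmod (r t) \<le> (\<Sum>i. cmod (- (c (i + n0) / of_real C)) * ?w (i + n0))"
      unfolding sums_unique[OF rs[of t]]
    proof (rule norm_suminf_le[OF _ smt])
      show "cmod (- (c (i + n0) / complex_of_real C) * cis (k *\<^sub>R ivec (\<mu> (i + n0)) \<bullet> t))
          \<le> cmod (- (c (i + n0) / of_real C)) * ?w (i + n0)" for i
        unfolding norm_mult norm_cis by (rule mult_left_mono[OF w1]) simp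
    qed
    also have "(\<Sum>i. cmod (- (c (i + n0) / of_real C)) * ?w (i + n0)) = (\<Sum>i. cmod (c (i + n0)) * ?w (i + n0)) / C"
      using C0 suminf_divide[OF summable_ignore_initial_segment[OF sm, of n0], of C] by (simp add: norm_divide)
    also have "\<dots> \<le> \<eta>" using n0 C0 by (simp add: divide_le_eq mult.commute less_imp_le)
    finally show ?thesis .
  qed
  have Pb: "cmod (P t) \<le> \<rho> + \<eta>" for t
  proof -
    have "P t = F t - r t" by (simp add: r_def)
    then show ?thesis using norm_triangle_ineq4[of "F t" "r t"] Fb[of t] rb[of t] by simp
  qed
  obtain R where R: "\<mu> ` {..<n0} \<subseteq> lbox R" using finite_subset_lbox by blast
  have Pt: "trig_poly k R P"
    unfolding P_def by (intro trig_poly_diff trig_poly_const trig_poly_finite_sum R) simp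
  obtain K where K: "K \<ge> 0" "\<And>j. (2 * real (j * R) + 1) ^ CARD('n) * exp (lam * \<omega> ((k * CARD('n)) * real (j * R))) \<le> K * (1 + \<eta>) ^ j"
    using subexponential_growth[OF lam _ \<eta>(1), of "k * CARD('n)" R "CARD('n)"] k by auto
  \<comment> \<open>The geometric ratio for the powers of \<open>P\<close>: supremum
    \<open>\<rho> + \<eta>\<close> times the allowed growth rate \<open>1 + \<eta>\<close>.\<close>
  define q where "q = (1 + \<eta>) * (\<rho> + \<eta>)"
  have q: "0 \<le> q" "q \<le> \<rho> + 2 * \<eta>"
  proof -
    show "0 \<le> q" using \<rho> \<eta> by (simp add: q_def)
    have "q = \<rho> + \<eta> + \<eta> * (\<rho> + \<eta>)" by (simp add: q_def algebra_simps)
    also have "\<eta> * (\<rho> + \<eta>) \<le> \<eta> * 1" using \<eta> by (intro mult_left_mono) auto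
    finally show "q \<le> \<rho> + 2 * \<eta>" by simp
  qed
  have Pj: "FT_multiplier lam (K * q ^ j) (\<lambda>t. P t ^ j)" for j
  proof (rule FT_multiplier_mono)
    show "FT_multiplier lam ((\<rho> + \<eta>) ^ j * ((2 * real (j * R) + 1) ^ CARD('n) * exp (lam * \<omega> (k * CARD('n) * real (j * R))))) (\<lambda>t. P t ^ j)"
      by (intro trig_poly_multiplier lam k trig_poly_power Pt) (simp add: norm_power power_mono Pb)
    have "(\<rho> + \<eta>) ^ j * ((2 * real (j * R) + 1) ^ CARD('n) * exp (lam * \<omega> (k * CARD('n) * real (j * R)))) \<le> (\<rho> + \<eta>) ^ j * (K * (1 + \<eta>) ^ j)"
      using \<rho> \<eta> by (intro mult_left_mono K) auto
    then show "(\<rho> + \<eta>) ^ j * ((2 * real (j * R) + 1) ^ CARD('n) * exp (lam * \<omega> (k * CARD('n) * real (j * R)))) \<le> K * q ^ j"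
      by (simp add: q_def power_mult_distrib mult_ac)
  qed
  have rj: "FT_multiplier lam (\<eta> ^ j) (\<lambda>t. r t ^ j)" for j
  proof (induction j)
    case 0
    show ?case using FT_multiplier_const[of lam 1] by simp
  next
    case (Suc j)
    show ?case using FT_multiplier_mult[OF rM Suc] by simp
  qed
  \<comment> \<open>Binomial expansion of \<open>(P + r) ^ n\<close>. Each power of \<open>P\<close>
    is estimated as a whole, so the constant \<open>K\<close> enters once and not to the
    \<open>n\<close>-th power; this makes the Neumann series converge although the operator bound of
    \<open>F\<close> itself may exceed 1.\<close>
  have Fn: "FT_multiplier lam (K * (q + \<eta>) ^ n) (\<lambda>t. F t ^ n)" for n
  proof -
    have "FT_multiplier lam (\<Sum>j\<le>n. real (n choose j) * (K * q ^ j * \<eta> ^ (n - j))) (\<lambda>t. \<Sum>j\<le>n. of_nat (n choose j) * (P t ^ j * r t ^ (n - j)))"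
    proof (rule FT_multiplier_sum)
      show "FT_multiplier lam (real (n choose j) * (K * q ^ j * \<eta> ^ (n - j))) (\<lambda>t. of_nat (n choose j) * (P t ^ j * r t ^ (n - j)))" for j
        using FT_multiplier_mult[OF FT_multiplier_const[of lam "of_nat (n choose j)"] FT_multiplier_mult[OF Pj rj]]
        by (simp only: norm_of_nat)
    qed simp
    moreover have "(\<lambda>t. \<Sum>j\<le>n. of_nat (n choose j) * (P t ^ j * r t ^ (n - j))) = (\<lambda>t. F t ^ n)"
    proof
      fix t
      have "F t = P t + r t" by (simp add: r_def)
      then show "(\<Sum>j\<le>n. of_nat (n choose j) * (P t ^ j * r t ^ (n - j))) = F t ^ n"
        by (simp only: binomial_ring mult.assoc)
    qed
    moreover have "(\<Sum>j\<le>n. real (n choose j) * (K * q ^ j * \<eta> ^ (n - j))) = K * (q + \<eta>) ^ n"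
      by (simp add: binomial_ring sum_distrib_left mult_ac)
    ultimately show ?thesis by simp
  qed
  have qe: "q + \<eta> < 1" "0 \<le> q + \<eta>" using q \<eta> by auto
  have "FT_multiplier lam (\<Sum>n. K * (q + \<eta>) ^ n) (\<lambda>t. 1 / (1 - F t))"
  proof (rule FT_multiplier_sums[OF Fn])
    show "summable (\<lambda>n. K * (q + \<eta>) ^ n)" using qe by (intro summable_mult summable_geometric) auto
    show "cmod (F t ^ n) \<le> \<rho> ^ n" for n t unfolding norm_power by (intro power_mono Fb) auto
    show "summable (\<lambda>n. \<rho> ^ n)" using \<rho> by (intro summable_geometric) auto
    show "(\<lambda>n. F t ^ n) sums (1 / (1 - F t))" for t
      by (rule geometric_sums) (use Fb[of t] \<rho> in linarith)
  qed
  from FT_multiplier_mult[OF FT_multiplier_const[of lam "of_real (1 / C)"] this]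
  have "\<exists>M. FT_multiplier lam M (\<lambda>t. complex_of_real (1 / C) * (1 / (1 - F t)))" by blast
  moreover have "complex_of_real (1 / C) * (1 / (1 - F t)) = complex_of_real (1 / G t)" for t
    using C0 b(2)[of t] b(1) by (simp add: F_def)
  ultimately show ?thesis by simp
qed

end

section \<open>Iterated partial derivatives\<close>

text \<open>Only derivatives along the axes, which is all that the recursion of \<open>Dl\<close>
  uses. For Fourier transforms these are computed directly, without a total derivative.\<close>

definition partially_smooth :: "(real^'n::finite \<Rightarrow> complex) \<Rightarrow> bool" where
  "partially_smooth f \<longleftrightarrow> (\<forall>ks j x. (\<lambda>s. Dl ks f (x + s *\<^sub>R axis j 1)) differentiable (at 0))"

lemma partially_smooth_has_derivative:
  assumes "partially_smooth f"
  shows "((\<lambda>s. Dl ks f (x + s *\<^sub>R axis j 1)) has_vector_derivative Dl (j # ks) f x) (at 0)"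
  using assms vector_derivative_works unfolding partially_smooth_def Dl.simps partial_deriv_def by blast

lemma partial_deriv_eq:
  "((\<lambda>s. f (x + s *\<^sub>R axis j 1)) has_vector_derivative D) (at 0) \<Longrightarrow> partial_deriv j f x = D"
  unfolding partial_deriv_def by (rule vector_derivative_at)

lemma differentiable_along_axis:
  fixes f :: "real^'n::finite \<Rightarrow> complex"
  assumes "f differentiable (at x)"
  shows "(\<lambda>s. f (x + s *\<^sub>R axis j 1)) differentiable (at 0)"
proof -
  have "(\<lambda>s::real. x + s *\<^sub>R axis j 1) differentiable (at 0)"
    by (intro differentiable_add differentiable_const differentiable_scaleR differentiable_ident)
  then have "(f \<circ> (\<lambda>s. x + s *\<^sub>R axis j 1)) differentiable (at 0)"
    by (rule differentiable_chain_at) (use assms in simp)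
  then show ?thesis by (simp add: o_def)
qed

lemma partially_smoothI: "(\<And>ks x. Dl ks f differentiable (at x)) \<Longrightarrow> partially_smooth f"
  by (simp add: partially_smooth_def differentiable_along_axis)

text \<open>Index set for a Leibniz rule without binomial coefficients: every distribution of the
  listed directions over two factors, kept with multiplicity.\<close>

fun splits :: "'a list \<Rightarrow> ('a list \<times> 'a list) list" where
  "splits [] = [([], [])]"
| "splits (j # ks) = map (\<lambda>p. (j # fst p, snd p)) (splits ks) @ map (\<lambda>p. (fst p, j # snd p)) (splits ks)"

lemma length_splits: "length (splits ks) = 2 ^ length ks"
  by (induction ks) auto

lemma splits_length_le: "p \<in> set (splits ks) \<Longrightarrow> length (fst p) \<le> length ks \<and> length (snd p) \<le> length ks"
  by (induction ks arbitrary: p) (auto, fastforce+)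

lemma has_vector_derivative_sum_list:
  assumes "\<And>p. p \<in> set xs \<Longrightarrow> (F p has_vector_derivative F' p) (at x)"
  shows "((\<lambda>s. \<Sum>p\<leftarrow>xs. F p s) has_vector_derivative (\<Sum>p\<leftarrow>xs. F' p)) (at x)"
  using assms by (induction xs) (auto intro!: has_vector_derivative_add)

lemma Dl_mult:
  assumes f: "partially_smooth f" and g: "partially_smooth g"
  shows "Dl ks (\<lambda>x. f x * g x) = (\<lambda>x. \<Sum>p\<leftarrow>splits ks. Dl (fst p) f x * Dl (snd p) g x)"
proof (induction ks)
  case (Cons j ks)
  show ?case
  proof
    fix x
    let ?F = "\<lambda>p s. Dl (fst p) f (x + s *\<^sub>R axis j 1) * Dl (snd p) g (x + s *\<^sub>R axis j 1)"
    let ?F' = "\<lambda>p. Dl (fst p) f x * Dl (j # snd p) g x + Dl (j # fst p) f x * Dl (snd p) g x"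
    have "((\<lambda>s. \<Sum>p\<leftarrow>splits ks. ?F p s) has_vector_derivative (\<Sum>p\<leftarrow>splits ks. ?F' p)) (at 0)"
    proof (rule has_vector_derivative_sum_list)
      fix p
      show "(?F p has_vector_derivative ?F' p) (at 0)"
        using has_vector_derivative_mult[OF partially_smooth_has_derivative[OF f, of "fst p" x j]
            partially_smooth_has_derivative[OF g, of "snd p" x j]] by (simp only: scale_zero_left add_0_right)
    qed
    then have "partial_deriv j (Dl ks (\<lambda>x. f x * g x)) x = (\<Sum>p\<leftarrow>splits ks. ?F' p)"
      unfolding Cons by (rule partial_deriv_eq)
    then show "Dl (j # ks) (\<lambda>x. f x * g x) x = (\<Sum>p\<leftarrow>splits (j # ks). Dl (fst p) f x * Dl (snd p) g x)"
      by (simp add: sum_list_addf o_def add.commute)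
  qed
qed simp

lemma differentiable_sum_list:
  assumes "\<And>p. p \<in> set xs \<Longrightarrow> F p differentiable (at x)"
  shows "(\<lambda>s. \<Sum>p\<leftarrow>xs. F p s) differentiable (at x)"
  using assms by (induction xs) (auto intro!: differentiable_add)

lemma Dl_mult_differentiable:
  assumes f: "\<And>ks x. Dl ks f differentiable (at x)" and g: "\<And>ks x. Dl ks g differentiable (at x)"
  shows "Dl ks (\<lambda>x. f x * g x) differentiable (at x)"
  unfolding Dl_mult[OF partially_smoothI[OF f] partially_smoothI[OF g]]
  by (intro differentiable_sum_list differentiable_mult f g)

lemma Dl_mult_bound:
  assumes f: "partially_smooth f" and g: "partially_smooth g"
    and A: "\<And>a. length a \<le> length ks \<Longrightarrow> cmod (Dl a f x) \<le> A"
    and B: "\<And>b. length b \<le> length ks \<Longrightarrow> cmod (Dl b g x) \<le> B"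
  shows "cmod (Dl ks (\<lambda>x. f x * g x) x) \<le> 2 ^ length ks * (A * B)"
proof -
  have A0: "A \<ge> 0" using A[of "[]"] norm_ge_zero order_trans by (metis le0 list.size(3))
  have "cmod (\<Sum>p\<leftarrow>xs. Dl (fst p) f x * Dl (snd p) g x) \<le> real (length xs) * (A * B)"
    if "set xs \<subseteq> set (splits ks)" for xs
    using that
  proof (induction xs)
    case (Cons p xs)
    then have "cmod (Dl (fst p) f x * Dl (snd p) g x) \<le> A * B"
      unfolding norm_mult using splits_length_le[of p ks] A0 by (intro mult_mono A B) auto
    then show ?case using Cons
      by (auto simp: algebra_simps intro!: norm_triangle_le)
  qed simp
  from this[of "splits ks"] show ?thesis
    by (simp add: Dl_mult[OF f g] length_splits)
qed

lemma Dl_translate: "Dl ks (\<lambda>t. f (t - x)) = (\<lambda>t. Dl ks f (t - x))"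
  by (induction ks) (auto simp: partial_deriv_def[abs_def] diff_add_eq)

lemma Dl_cmult:
  assumes "partially_smooth f"
  shows "Dl ks (\<lambda>t. c * f t) = (\<lambda>t. c * Dl ks f t)"
proof (induction ks)
  case (Cons j ks)
  show ?case
  proof
    fix x
    have "partial_deriv j (\<lambda>t. c * Dl ks f t) x = c * Dl (j # ks) f x"
      by (rule partial_deriv_eq) (rule has_vector_derivative_mult_right[OF partially_smooth_has_derivative[OF assms]])
    then show "Dl (j # ks) (\<lambda>t. c * f t) x = c * Dl (j # ks) f x"
      by (simp add: Cons)
  qed
qed simp

lemma Dl_cis: "Dl ks (\<lambda>t. cis (t \<bullet> \<xi>)) = (\<lambda>t. (\<Prod>j\<leftarrow>ks. \<i> * of_real (\<xi> $ j)) * cis (t \<bullet> \<xi>))"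
proof (induction ks)
  case (Cons j ks)
  show ?case
  proof
    fix x
    let ?c = "\<Prod>j\<leftarrow>ks. \<i> * of_real (\<xi> $ j)"
    have "((\<lambda>s. ?c * cis (x \<bullet> \<xi> + \<xi> $ j * s)) has_vector_derivative ?c * (\<i> * of_real (\<xi> $ j) * cis (x \<bullet> \<xi> + \<xi> $ j * 0))) (at 0)"
      by (rule has_vector_derivative_mult_right[OF has_vector_derivative_cis_affine])
    then have "partial_deriv j (\<lambda>t. ?c * cis (t \<bullet> \<xi>)) x = ?c * (\<i> * of_real (\<xi> $ j) * cis (x \<bullet> \<xi>))"
      by (intro partial_deriv_eq) (simp add: inner_add_left inner_axis' mult.commute)
    then show "Dl (j # ks) (\<lambda>t. cis (t \<bullet> \<xi>)) x = (\<Prod>j\<leftarrow>j # ks. \<i> * of_real (\<xi> $ j)) * cis (x \<bullet> \<xi>)"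
      by (simp add: Cons mult_ac)
  qed
qed simp

lemma differentiable_cis_inner: "(\<lambda>t. cis (t \<bullet> \<xi>)) differentiable (at (x :: real^'n::finite))"
proof -
  have "(cis \<circ> (\<lambda>t. t \<bullet> \<xi>)) differentiable (at x)"
  proof (rule differentiable_chain_at)
    show "(\<lambda>t. t \<bullet> \<xi>) differentiable (at x)" by (intro differentiable_inner differentiable_ident differentiable_const)
    show "cis differentiable (at (x \<bullet> \<xi>))"
      using has_vector_derivative_cis_affine[of 0 1 "x \<bullet> \<xi>" UNIV] has_vector_derivative_def differentiable_def
      by fastforce
  qed
  then show ?thesis by (simp add: o_def)
qed

lemma Dl_cis_differentiable: "Dl ks (\<lambda>t. cis (t \<bullet> \<xi>)) differentiable (at (x :: real^'n::finite))"
  unfolding Dl_cis by (intro differentiable_mult differentiable_const differentiable_cis_inner)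

lemma norm_Dl_cis: "length ks \<le> n \<Longrightarrow> cmod (Dl ks (\<lambda>t. cis (t \<bullet> \<xi>)) t) \<le> (1 + norm \<xi>) ^ n"
proof -
  have "cmod (\<Prod>j\<leftarrow>ks. \<i> * of_real (\<xi> $ j)) \<le> (1 + norm \<xi>) ^ length ks"
  proof (induction ks)
    case (Cons j ks)
    have "\<bar>\<xi> $ j\<bar> \<le> 1 + norm \<xi>" using component_le_norm_cart[of \<xi> j] by linarith
    then show ?case using Cons by (auto simp: norm_mult intro!: mult_mono)
  qed simp
  also assume "length ks \<le> n"
  then have "(1 + norm \<xi>) ^ length ks \<le> (1 + norm \<xi>) ^ n" by (intro power_increasing) auto
  finally show ?thesis by (simp add: Dl_cis norm_mult)
qed

lemma Dl_tf_shift_bound: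
  assumes f: "partially_smooth f" and A: "\<And>a. length a \<le> length ks \<Longrightarrow> cmod (Dl a f (t - x)) \<le> A"
  shows "cmod (Dl ks (tf_shift x \<xi> f) t) \<le> 2 ^ length ks * ((1 + norm \<xi>) ^ length ks * A)"
proof -
  have "partially_smooth (\<lambda>t. f (t - x))"
  proof -
    have "x' + s *\<^sub>R axis j 1 - x = (x' - x) + s *\<^sub>R axis j 1" for x' s j by simp
    then show ?thesis using f by (simp only: partially_smooth_def Dl_translate) blast
  qed
  moreover have "partially_smooth (\<lambda>t. cis (t \<bullet> \<xi>))"
    by (intro partially_smoothI Dl_cis_differentiable)
  ultimately show ?thesis
    unfolding tf_shift_def[abs_def] by (intro Dl_mult_bound) (auto simp: Dl_translate A norm_Dl_cis)
qed

lemma differentiable_translate: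
  fixes f :: "real^'n::finite \<Rightarrow> complex"
  assumes "\<And>x. f differentiable (at x)"
  shows "(\<lambda>t. f (t - c)) differentiable (at x)"
proof -
  have "(f \<circ> (\<lambda>t. t - c)) differentiable (at x)"
    by (intro differentiable_chain_at assms) auto
  then show ?thesis by (simp add: o_def)
qed

lemma Dl_tf_shift_differentiable:
  assumes f: "\<And>ks x. Dl ks f differentiable (at x)"
  shows "Dl ks (tf_shift x \<xi> f) differentiable (at t)"
  unfolding tf_shift_def[abs_def]
  by (intro Dl_mult_differentiable Dl_cis_differentiable) (unfold Dl_translate, rule differentiable_translate[OF f])

text \<open>The total differential of each term is determined by its partial derivatives through
  linearity, so summable bounds on these give uniform convergence of the differentials. Total
  differentiability has to be recovered because membership in \<open>S_omega\<close> asks for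
  it.\<close>

lemma differentiable_series:
  fixes g :: "nat \<Rightarrow> real^'n::finite \<Rightarrow> complex"
  assumes g: "\<And>i x. g i differentiable (at x)" and M: "\<And>i j x. cmod (partial_deriv j (g i) x) \<le> M i" "summable M"
    and G: "\<And>x. (\<lambda>i. g i x) sums G x"
  shows "G differentiable (at x)" and "(\<lambda>i. partial_deriv j (g i) x) sums partial_deriv j G x"
proof -
  let ?p = "\<lambda>i j x. partial_deriv j (g i) x"
  have sp: "summable (\<lambda>i. ?p i j x)" for j x
    by (rule summable_comparison_test'[OF M(2), of 0]) (rule M(1))
  have along: "((\<lambda>s. F (x + s *\<^sub>R axis j 1)) has_vector_derivative D (axis j 1)) (at 0)"
    if "(F has_derivative D) (at x)" for F :: "real^'n \<Rightarrow> complex" and D x j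
  proof -
    have "((\<lambda>s::real. x + s *\<^sub>R axis j 1) has_derivative (\<lambda>s. s *\<^sub>R axis j 1)) (at 0)"
      by (auto intro!: derivative_eq_intros)
    then have "((F \<circ> (\<lambda>s. x + s *\<^sub>R axis j 1)) has_derivative (D \<circ> (\<lambda>s. s *\<^sub>R axis j 1))) (at 0)"
      by (rule diff_chain_at) (use that in simp)
    then show ?thesis
      using linear_cmul[OF has_derivative_linear[OF that]] by (simp add: has_vector_derivative_def o_def)
  qed
  have der: "(g i has_derivative (\<lambda>h. \<Sum>j\<in>UNIV. h $ j *\<^sub>R ?p i j x)) (at x)" for i x
  proof -
    obtain D where D: "(g i has_derivative D) (at x)" using g by (auto simp: differentiable_def)
    have "D h = (\<Sum>j\<in>UNIV. h $ j *\<^sub>R ?p i j x)" for h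
    proof -
      have "h = (\<Sum>j\<in>UNIV. h $ j *\<^sub>R axis j 1)"
        using basis_expansion[of h] by (simp add: scalar_mult_eq_scaleR)
      then have "D h = D (\<Sum>j\<in>UNIV. h $ j *\<^sub>R axis j 1)" by simp
      also have "\<dots> = (\<Sum>j\<in>UNIV. h $ j *\<^sub>R D (axis j 1))"
        using has_derivative_linear[OF D] by (simp add: linear_sum linear_cmul)
      also have "\<dots> = (\<Sum>j\<in>UNIV. h $ j *\<^sub>R ?p i j x)"
        using partial_deriv_eq[OF along[OF D]] by simp
      finally show ?thesis .
    qed
    then show ?thesis using D by (metis (no_types, lifting) ext)
  qed
  define P where "P j x = (\<Sum>i. ?p i j x)" for j x
  have tail: "cmod ((\<Sum>i<n. ?p i j x) - P j x) \<le> (\<Sum>i. M (i + n))" for n j x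
  proof -
    have "P j x - (\<Sum>i<n. ?p i j x) = (\<Sum>i. ?p (i + n) j x)"
      unfolding P_def by (rule suminf_minus_initial_segment[symmetric, OF sp])
    also have "cmod \<dots> \<le> (\<Sum>i. M (i + n))"
      by (rule norm_suminf_le[OF M(1) summable_ignore_initial_segment[OF M(2)]])
    finally show ?thesis by (simp add: norm_minus_commute)
  qed
  have "\<exists>G'. \<forall>x\<in>UNIV. (\<lambda>n. g n x) sums G' x \<and> (G' has_derivative (\<lambda>h. \<Sum>j\<in>UNIV. h $ j *\<^sub>R P j x)) (at x within UNIV)"
  proof (rule has_derivative_series[where x = 0])
    show "(\<lambda>n. g n 0) sums G 0" by (rule G)
    fix e :: real assume e: "e > 0"
    have "(\<lambda>n. \<Sum>i. M (i + n)) \<longlonglongrightarrow> 0" by (rule suminf_exist_split2[OF M(2)])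
    then have "eventually (\<lambda>n. (\<Sum>i. M (i + n)) < e / CARD('n)) sequentially"
      using e by (intro order_tendstoD(2)) auto
    then show "\<forall>\<^sub>F n in sequentially. \<forall>x\<in>UNIV. \<forall>h. norm ((\<Sum>i<n. \<Sum>j\<in>UNIV. h $ j *\<^sub>R ?p i j x) - (\<Sum>j\<in>UNIV. h $ j *\<^sub>R P j x)) \<le> e * norm h"
    proof (eventually_elim, intro ballI allI)
      fix n x h assume n: "(\<Sum>i. M (i + n)) < e / CARD('n)"
      have "(\<Sum>i<n. \<Sum>j\<in>UNIV. h $ j *\<^sub>R ?p i j x) - (\<Sum>j\<in>UNIV. h $ j *\<^sub>R P j x) = (\<Sum>j\<in>(UNIV::'n set). h $ j *\<^sub>R ((\<Sum>i<n. ?p i j x) - P j x))"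
        by (subst sum.swap) (simp add: sum_subtractf scaleR_diff_right scaleR_sum_right)
      also have "norm \<dots> \<le> (\<Sum>j\<in>(UNIV::'n set). norm h * (e / CARD('n)))"
      proof (rule order_trans[OF norm_sum sum_mono])
        fix j
        have "\<bar>h $ j\<bar> * cmod ((\<Sum>i<n. ?p i j x) - P j x) \<le> norm h * (e / CARD('n))"
          using tail[where n = n and j = j and x = x] n by (intro mult_mono component_le_norm_cart) auto
        then show "norm (h $ j *\<^sub>R ((\<Sum>i<n. ?p i j x) - P j x)) \<le> norm h * (e / CARD('n))" by simp
      qed
      also have "\<dots> = e * norm h" by simp
      finally show "norm ((\<Sum>i<n. \<Sum>j\<in>UNIV. h $ j *\<^sub>R ?p i j x) - (\<Sum>j\<in>UNIV. h $ j *\<^sub>R P j x)) \<le> e * norm h" .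
    qed
  qed (use der in auto)
  then obtain G' where G': "\<And>x. (\<lambda>n. g n x) sums G' x" "\<And>x. (G' has_derivative (\<lambda>h. \<Sum>j\<in>UNIV. h $ j *\<^sub>R P j x)) (at x)"
    by auto
  have "G' = G" using G G'(1) sums_unique2 by blast
  with G'(2) have GD: "(G has_derivative (\<lambda>h. \<Sum>j\<in>UNIV. h $ j *\<^sub>R P j x)) (at x)" for x by simp
  then show "G differentiable (at x)" by (auto simp: differentiable_def)
  have "(\<Sum>i\<in>UNIV. axis j 1 $ i *\<^sub>R P i x) = P j x"
    by (simp add: axis_def if_distrib[of "\<lambda>r. r *\<^sub>R _"] cong: if_cong)
  then have "partial_deriv j G x = P j x"
    using partial_deriv_eq[OF along[OF GD, of x j]] by simp
  then show "(\<lambda>i. partial_deriv j (g i) x) sums partial_deriv j G x"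
    using summable_sums[OF sp[of j x]] by (simp add: P_def)
qed

section \<open>Derivatives of the Fourier transform\<close>

text \<open>Decay without smoothness: stable under multiplication by coordinates, and enough to
  differentiate the Fourier transform under the integral to any order.\<close>

definition rapidly_decreasing :: "(real^'n::finite \<Rightarrow> complex) \<Rightarrow> bool" where
  "rapidly_decreasing f \<longleftrightarrow> f \<in> borel_measurable borel \<and> (\<forall>N. \<exists>C. \<forall>t. (1 + norm t) ^ N * cmod (f t) \<le> C)"

lemma rapidly_decreasing_integrable:
  fixes f :: "real^'n::finite \<Rightarrow> complex"
  assumes f: "rapidly_decreasing f"
  shows "integrable lborel (\<lambda>t. (1 + norm t) ^ N * cmod (f t))"
proof -
  have [measurable]: "f \<in> borel_measurable borel" using f by (simp add: rapidly_decreasing_def)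
  obtain C where C: "\<And>t. (1 + norm t) ^ (N + 2 * CARD('n)) * cmod (f t) \<le> C"
    using f by (auto simp: rapidly_decreasing_def)
  show ?thesis
  proof (rule Bochner_Integration.integrable_bound[OF integrable_mult_right[OF integrable_kernel]])
    show "(\<lambda>t. (1 + norm t) ^ N * cmod (f t)) \<in> borel_measurable lborel" by measurable
    have "norm ((1 + norm t) ^ N * cmod (f t)) \<le> norm (C * (1 / (1 + norm t) ^ (2 * CARD('n))))" for t :: "real^'n"
    proof -
      have p: "0 < (1 + norm t) ^ (2 * CARD('n))" by (simp add: add_pos_nonneg)
      have "(1 + norm t) ^ N * cmod (f t) \<le> C / (1 + norm t) ^ (2 * CARD('n))"
        using C[of t] p by (simp add: pos_le_divide_eq power_add mult_ac)
      also have "\<dots> \<le> \<bar>C\<bar> / (1 + norm t) ^ (2 * CARD('n))"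
        using p by (intro divide_right_mono) auto
      finally show ?thesis by simp
    qed
    then show "AE t in lborel. norm ((1 + norm t) ^ N * cmod (f t)) \<le> norm (C * (1 / (1 + norm t) ^ (2 * CARD('n))))"
      by simp
  qed
qed

lemma rapidly_decreasing_integrable0:
  assumes f: "rapidly_decreasing f" shows "integrable lborel f"
proof -
  have "f \<in> borel_measurable lborel" using f by (simp add: rapidly_decreasing_def)
  then show ?thesis using rapidly_decreasing_integrable[OF f, of 0] by (simp add: integrable_norm_iff)
qed

lemma rapidly_decreasing_mult_coord:
  assumes f: "rapidly_decreasing f" and c: "cmod c = 1"
  shows "rapidly_decreasing (\<lambda>t. c * of_real (t $ j) * f t)"
  unfolding rapidly_decreasing_def
proof (intro conjI allI)
  have [measurable]: "f \<in> borel_measurable borel" using f by (simp add: rapidly_decreasing_def)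
  have [measurable]: "(\<lambda>x::real^'a. x $ j) \<in> borel_measurable borel"
    by (intro borel_measurable_continuous_onI continuous_intros)
  show "(\<lambda>t. c * of_real (t $ j) * f t) \<in> borel_measurable borel" by measurable
  fix N
  obtain C where C: "\<And>t. (1 + norm t) ^ Suc N * cmod (f t) \<le> C"
    using f unfolding rapidly_decreasing_def by blast
  have "(1 + norm t) ^ N * cmod (c * of_real (t $ j) * f t) \<le> C" for t
  proof -
    have "\<bar>t $ j\<bar> \<le> 1 + norm t" using component_le_norm_cart[of t j] by linarith
    then have "(1 + norm t) ^ N * (\<bar>t $ j\<bar> * cmod (f t)) \<le> (1 + norm t) ^ N * ((1 + norm t) * cmod (f t))"
      by (intro mult_left_mono mult_right_mono) auto
    then show ?thesis using C[of t] c by (simp add: norm_mult mult_ac)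
  qed
  then show "\<exists>C. \<forall>t. (1 + norm t) ^ N * cmod (c * of_real (t $ j) * f t) \<le> C" by blast
qed

lemma norm_cis_linear_approx: "cmod (cis y - 1 - \<i> * of_real y) \<le> y\<^sup>2"
  using Taylor_exp[of "\<i> * of_real y" 1] by (simp add: cis_conv_exp norm_mult power2_eq_square diff_diff_eq)

lemma FT_has_partial_derivative:
  fixes f :: "real^'n::finite \<Rightarrow> complex"
  assumes f: "rapidly_decreasing f"
  shows "((\<lambda>s. FT f (\<xi> + s *\<^sub>R axis j 1)) has_vector_derivative FT (\<lambda>t. - \<i> * of_real (t $ j) * f t) \<xi>) (at 0)"
proof -
  define K where "K = (LINT t|lborel. (1 + norm t) ^ 2 * cmod (f t))"
  let ?D = "FT (\<lambda>t. - \<i> * of_real (t $ j) * f t) \<xi>"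
  have fi: "integrable lborel f" by (rule rapidly_decreasing_integrable0[OF f])
  have fj: "integrable lborel (\<lambda>t. - \<i> * of_real (t $ j) * f t)"
    by (rule rapidly_decreasing_integrable0[OF rapidly_decreasing_mult_coord[OF f]]) simp
  have bound: "cmod (FT f (\<xi> + s *\<^sub>R axis j 1) - FT f \<xi> - s *\<^sub>R ?D) \<le> K * s\<^sup>2" for s
  proof -
    let ?g = "\<lambda>t. f t * cis (- (t \<bullet> (\<xi> + s *\<^sub>R axis j 1))) - f t * cis (- (t \<bullet> \<xi>)) - s *\<^sub>R ((- \<i> * of_real (t $ j) * f t) * cis (- (t \<bullet> \<xi>)))"
    have i: "integrable lborel (\<lambda>t. f t * cis (- (t \<bullet> (\<xi> + s *\<^sub>R axis j 1))))" "integrable lborel (\<lambda>t. f t * cis (- (t \<bullet> \<xi>)))"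
      "integrable lborel (\<lambda>t. s *\<^sub>R ((- \<i> * of_real (t $ j) * f t) * cis (- (t \<bullet> \<xi>))))"
      by (intro integrable_scaleR_right integrable_mult_cis fi fj; simp)+
    have "FT f (\<xi> + s *\<^sub>R axis j 1) - FT f \<xi> - s *\<^sub>R ?D = (LINT t|lborel. ?g t)"
      unfolding FT_def by (subst Bochner_Integration.integral_diff Bochner_Integration.integrable_diff; (intro i Bochner_Integration.integrable_diff)?)+ simp
    also have "cmod \<dots> \<le> (LINT t|lborel. s\<^sup>2 * ((1 + norm t) ^ 2 * cmod (f t)))"
    proof (rule order_trans[OF integral_norm_bound integral_mono])
      show "integrable lborel (\<lambda>t. cmod (?g t))"
        by (intro integrable_norm Bochner_Integration.integrable_diff i)
      show "integrable lborel (\<lambda>t. s\<^sup>2 * ((1 + norm t) ^ 2 * cmod (f t)))"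
        by (intro integrable_mult_right rapidly_decreasing_integrable f)
      fix t :: "real^'n"
      have "cis (- (t \<bullet> (\<xi> + s *\<^sub>R axis j 1))) = cis (- (t \<bullet> \<xi>)) * cis (- (s * t $ j))"
        by (simp add: cis_mult inner_add_right inner_axis)
      then have "?g t = f t * cis (- (t \<bullet> \<xi>)) * (cis (- (s * t $ j)) - 1 - \<i> * of_real (- (s * t $ j)))"
        by (simp add: scaleR_conv_of_real algebra_simps)
      then have "cmod (?g t) = cmod (f t) * cmod (cis (- (s * t $ j)) - 1 - \<i> * of_real (- (s * t $ j)))"
        by (simp only: norm_mult norm_cis mult_1_right)
      also have "\<dots> \<le> cmod (f t) * (- (s * t $ j))\<^sup>2"
        by (intro mult_left_mono norm_cis_linear_approx) simp
      also have "\<dots> \<le> cmod (f t) * (s\<^sup>2 * (1 + norm t)\<^sup>2)"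
      proof (rule mult_left_mono)
        have "\<bar>t $ j\<bar> \<le> 1 + norm t" using component_le_norm_cart[of t j] by linarith
        then have "(t $ j)\<^sup>2 \<le> (1 + norm t)\<^sup>2" by (intro abs_le_square_iff[THEN iffD1]) simp
        then show "(- (s * t $ j))\<^sup>2 \<le> s\<^sup>2 * (1 + norm t)\<^sup>2" by (simp add: power_mult_distrib mult_left_mono)
      qed simp
      also have "\<dots> = s\<^sup>2 * ((1 + norm t) ^ 2 * cmod (f t))" by (simp only: mult_ac)
      finally show "cmod (?g t) \<le> s\<^sup>2 * ((1 + norm t) ^ 2 * cmod (f t))" .
    qed
    also have "\<dots> = K * s\<^sup>2" by (simp add: K_def)
    finally show ?thesis .
  qed
  have "(\<lambda>s. cmod (FT f (\<xi> + (0 + s) *\<^sub>R axis j 1) - FT f (\<xi> + 0 *\<^sub>R axis j 1) - s *\<^sub>R ?D) / norm s) \<midarrow>0\<rightarrow> 0"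
  proof (rule Lim_null_comparison)
    show "\<forall>\<^sub>F s in at 0. norm (cmod (FT f (\<xi> + (0 + s) *\<^sub>R axis j 1) - FT f (\<xi> + 0 *\<^sub>R axis j 1) - s *\<^sub>R ?D) / norm s) \<le> K * \<bar>s\<bar>"
      unfolding eventually_at
    proof (intro exI[of _ 1] conjI ballI impI)
      fix s :: real assume "s \<noteq> 0 \<and> dist s 0 < 1"
      then have "s \<noteq> 0" by simp
      then show "norm (cmod (FT f (\<xi> + (0 + s) *\<^sub>R axis j 1) - FT f (\<xi> + 0 *\<^sub>R axis j 1) - s *\<^sub>R ?D) / norm s) \<le> K * \<bar>s\<bar>"
        using bound[of s] by (simp add: divide_le_eq power2_eq_square mult.assoc flip: abs_mult)
    qed simp
    show "((\<lambda>s. K * \<bar>s\<bar>) \<longlongrightarrow> 0) (at 0)"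
      by (auto intro!: tendsto_eq_intros)
  qed
  then show ?thesis
    unfolding has_vector_derivative_def has_derivative_at by (simp add: bounded_linear_scaleR_left)
qed

text \<open>Each derivative of a Fourier transform in direction \<open>j\<close> becomes one factor
  \<open>- \<i> * t $ j\<close> under the integral.\<close>

definition monomial_mult :: "'n::finite list \<Rightarrow> (real^'n \<Rightarrow> complex) \<Rightarrow> real^'n \<Rightarrow> complex" where
  "monomial_mult ks f t = (\<Prod>j\<leftarrow>ks. - \<i> * of_real (t $ j)) * f t"

lemma monomial_mult_Cons: "monomial_mult (j # ks) f = (\<lambda>t. - \<i> * of_real (t $ j) * monomial_mult ks f t)"
  by (simp add: monomial_mult_def fun_eq_iff)

lemma rapidly_decreasing_monomial_mult: "rapidly_decreasing f \<Longrightarrow> rapidly_decreasing (monomial_mult ks f)"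
proof (induction ks)
  case Nil
  then show ?case by (simp add: monomial_mult_def[abs_def])
next
  case (Cons j ks)
  then show ?case unfolding monomial_mult_Cons by (intro rapidly_decreasing_mult_coord) auto
qed

lemma Dl_FT:
  assumes "rapidly_decreasing f"
  shows "Dl ks (FT f) = FT (monomial_mult ks f)"
proof (induction ks)
  case Nil
  then show ?case by (simp add: monomial_mult_def[abs_def])
next
  case (Cons j ks)
  then show ?case
    using partial_deriv_eq[OF FT_has_partial_derivative[OF rapidly_decreasing_monomial_mult[OF assms]]]
    by (auto simp: monomial_mult_Cons)
qed

lemma partially_smooth_FT: "rapidly_decreasing f \<Longrightarrow> partially_smooth (FT f)"
  unfolding partially_smooth_def
  by (auto simp: Dl_FT intro!: differentiableI_vector FT_has_partial_derivative rapidly_decreasing_monomial_mult)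

lemma norm_monomial_mult: "cmod (monomial_mult ks f t) \<le> (1 + norm t) ^ length ks * cmod (f t)"
proof -
  have "cmod (\<Prod>j\<leftarrow>ks. - \<i> * of_real (t $ j)) \<le> (1 + norm t) ^ length ks"
  proof (induction ks)
    case (Cons j ks)
    have "\<bar>t $ j\<bar> \<le> 1 + norm t" using component_le_norm_cart[of t j] by linarith
    then show ?case using Cons by (auto simp: norm_mult intro!: mult_mono)
  qed simp
  then show ?thesis by (simp add: monomial_mult_def norm_mult mult_right_mono)
qed

section \<open>The space \<open>S_omega\<close> and its dual\<close>

context weight
begin

lemma bdd_above_weighted_iff:
  "bdd_above (range (\<lambda>x. cmod (F x) * exp (lam * \<omega> (norm x)))) \<longleftrightarrow> (\<exists>C. \<forall>x. cmod (F x) \<le> C * decay lam x)"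
  by (auto simp: bdd_above_def exp_minus field_simps)

lemma S_omega_iff:
  "f \<in> S_omega \<omega> \<longleftrightarrow> (\<forall>ks x. Dl ks f differentiable (at x)) \<and>
     (\<forall>lam>0. \<forall>ks. (\<exists>C. \<forall>x. cmod (Dl ks f x) \<le> C * decay lam x) \<and>
        (\<exists>C. \<forall>x. cmod (Dl ks (FT f) x) \<le> C * decay lam x))"
  by (simp add: S_omega_def bdd_above_weighted_iff)

lemma S_omega_differentiable: "f \<in> S_omega \<omega> \<Longrightarrow> Dl ks f differentiable (at x)"
  by (simp add: S_omega_iff)

lemma S_omega_partially_smooth: "f \<in> S_omega \<omega> \<Longrightarrow> partially_smooth f"
  by (intro partially_smoothI S_omega_differentiable)

lemma S_omega_continuous: "f \<in> S_omega \<omega> \<Longrightarrow> continuous_on UNIV f"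
  using S_omega_differentiable[of f "[]"]
  by (auto simp: continuous_on_eq_continuous_at intro: differentiable_imp_continuous_within)

lemma finite_lists_le: "finite {ks::'n::finite list. length ks \<le> N}"
  using finite_lists_length_le[of "UNIV::'n set" N] by simp

lemma S_omega_bound:
  fixes f :: "real^'n::finite \<Rightarrow> complex"
  assumes f: "f \<in> S_omega \<omega>" and lam: "lam > 0"
  shows "\<exists>C\<ge>0. \<forall>ks x. length ks \<le> N \<longrightarrow> cmod (Dl ks f x) \<le> C * decay lam x \<and>
      cmod (Dl ks (FT f) x) \<le> C * decay lam x"
proof -
  have "\<forall>ks. \<exists>C. \<forall>x. cmod (Dl ks f x) \<le> C * decay lam x"
    "\<forall>ks. \<exists>C. \<forall>x. cmod (Dl ks (FT f) x) \<le> C * decay lam x"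
    using f lam by (simp_all add: S_omega_iff)
  then obtain A B where A: "\<And>ks x. cmod (Dl ks f x) \<le> A ks * decay lam x"
    and B: "\<And>ks x. cmod (Dl ks (FT f) x) \<le> B ks * decay lam x"
    by metis
  have A0: "A ks \<ge> 0" for ks using order_trans[OF norm_ge_zero A[of ks 0]] by (simp add: zero_le_mult_iff)
  have B0: "B ks \<ge> 0" for ks using order_trans[OF norm_ge_zero B[of ks 0]] by (simp add: zero_le_mult_iff)
  define C where "C = (\<Sum>ks\<in>{ks. length ks \<le> N}. A ks + B ks)"
  have le: "A ks + B ks \<le> C" if "length ks \<le> N" for ks
    unfolding C_def using that A0 B0 by (intro member_le_sum finite_lists_le) auto
  show ?thesis
  proof (intro exI[of _ C] conjI allI impI)
    show "C \<ge> 0" using A0 B0 by (auto simp: C_def intro!: sum_nonneg)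
    fix ks :: "'n list" and x assume "length ks \<le> N"
    then have "A ks \<le> C" "B ks \<le> C" using le[of ks] A0[of ks] B0[of ks] by auto
    then show "cmod (Dl ks f x) \<le> C * decay lam x" "cmod (Dl ks (FT f) x) \<le> C * decay lam x"
      by (auto intro: order_trans[OF A] order_trans[OF B] mult_right_mono)
  qed
qed

lemma S_omega_bound0:
  fixes f :: "real^'n::finite \<Rightarrow> complex"
  assumes f: "f \<in> S_omega \<omega>" and lam: "lam > 0"
  shows "\<exists>C\<ge>0. \<forall>x. cmod (f x) \<le> C * decay lam x \<and> cmod (FT f x) \<le> C * decay lam x"
proof -
  obtain C where "C \<ge> 0" and "\<And>ks x. length ks \<le> 0 \<Longrightarrow> cmod (Dl ks f x) \<le> C * decay lam x \<and>
      cmod (Dl ks (FT f) x) \<le> C * decay lam x"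
    using S_omega_bound[OF f lam, of 0] by blast
  from this(1) this(2)[of "[]"] show ?thesis by auto
qed

lemma rapidly_decreasingI:
  fixes f :: "real^'n::finite \<Rightarrow> complex"
  assumes "continuous_on UNIV f" and f: "\<And>lam. lam > 0 \<Longrightarrow> \<exists>C. \<forall>x. cmod (f x) \<le> C * decay lam x"
  shows "rapidly_decreasing f"
  unfolding rapidly_decreasing_def
proof (intro conjI allI)
  show "f \<in> borel_measurable borel" by (rule borel_measurable_continuous_onI) fact
  fix N
  obtain lam K where lam: "lam > 0" and K: "\<And>t. t \<ge> 0 \<Longrightarrow> (1 + t) ^ N \<le> K * exp (lam * \<omega> t)"
    using power_le_exp_weight by metis
  obtain C where C: "\<And>x. cmod (f x) \<le> C * decay lam x" using f[OF lam] by blast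
  have C0: "C \<ge> 0" using order_trans[OF norm_ge_zero C[of 0]] by (simp add: zero_le_mult_iff)
  have "(1 + norm t) ^ N * cmod (f t) \<le> K * C" for t
  proof -
    have "(1 + norm t) ^ N * cmod (f t) \<le> (K * exp (lam * \<omega> (norm t))) * (C * decay lam t)"
    proof (rule mult_mono[OF K C])
      show "0 \<le> K * exp (lam * \<omega> (norm t))" by (rule order_trans[OF _ K[of "norm t"]]) auto
    qed auto
    then show ?thesis by (simp add: exp_minus mult_ac)
  qed
  then show "\<exists>C. \<forall>t. (1 + norm t) ^ N * cmod (f t) \<le> C" by blast
qed

lemma S_omega_rapidly_decreasing: "f \<in> S_omega \<omega> \<Longrightarrow> rapidly_decreasing f"
  by (intro rapidly_decreasingI S_omega_continuous) (use S_omega_bound0 in blast)+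

lemma S_omega_integrable: "f \<in> S_omega \<omega> \<Longrightarrow> integrable lborel f"
  by (intro rapidly_decreasing_integrable0 S_omega_rapidly_decreasing)

lemma S_omega_measurable: "f \<in> S_omega \<omega> \<Longrightarrow> f \<in> borel_measurable borel"
  by (intro borel_measurable_continuous_onI S_omega_continuous)

lemma semi_le:
  fixes f :: "real^'n::finite \<Rightarrow> complex"
  assumes "\<And>x. cmod (Dl ks f x) \<le> A * decay lam x"
    and "\<And>x. cmod (Dl ks (FT f) x) \<le> B * decay lam x"
  shows "semi \<omega> lam ks f \<le> A + B"
  unfolding semi_def
  by (intro add_mono cSUP_least) (use assms in \<open>auto simp: exp_minus field_simps\<close>)

lemma semi_ge:
  fixes f :: "real^'n::finite \<Rightarrow> complex"
  assumes f: "f \<in> S_omega \<omega>" and lam: "lam > 0"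
  shows "cmod (Dl ks f x) \<le> semi \<omega> lam ks f * decay lam x"
    and "cmod (Dl ks (FT f) x) \<le> semi \<omega> lam ks f * decay lam x"
    and "0 \<le> semi \<omega> lam ks f"
proof -
  let ?a = "\<lambda>x. cmod (Dl ks f x) * exp (lam * \<omega> (norm x))"
  let ?b = "\<lambda>x. cmod (Dl ks (FT f) x) * exp (lam * \<omega> (norm x))"
  have bdd: "bdd_above (range ?a)" "bdd_above (range ?b)"
    using f lam by (auto simp: S_omega_def)
  have a: "?a x \<le> (SUP x. ?a x)" and b: "?b x \<le> (SUP x. ?b x)" for x
    using bdd by (auto intro: cSUP_upper)
  have a0: "0 \<le> (SUP x. ?a x)" by (rule order_trans[OF _ a[of 0]]) simp
  have b0: "0 \<le> (SUP x. ?b x)" by (rule order_trans[OF _ b[of 0]]) simp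
  show "0 \<le> semi \<omega> lam ks f" unfolding semi_def using a0 b0 by simp
  have "?a x \<le> semi \<omega> lam ks f" "?b x \<le> semi \<omega> lam ks f"
    unfolding semi_def using a[of x] b[of x] a0 b0 by linarith+
  then show "cmod (Dl ks f x) \<le> semi \<omega> lam ks f * decay lam x"
     "cmod (Dl ks (FT f) x) \<le> semi \<omega> lam ks f * decay lam x"
    by (auto simp: exp_minus field_simps)
qed

text \<open>The factor 2 arises because each of the two suprema in \<open>semi\<close> is estimated
  by the whole seminorm; such constants are immaterial later. The same happens in
  \<open>S_omega_series\<close>.\<close>

lemma S_omega_cmult:
  assumes f: "f \<in> S_omega \<omega>"
  shows "(\<lambda>t. c * f t) \<in> S_omega \<omega>" and "lam > 0 \<Longrightarrow> semi \<omega> lam ks (\<lambda>t. c * f t) \<le> 2 * (cmod c * semi \<omega> lam ks f)"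
proof -
  have D: "Dl ks (\<lambda>t. c * f t) = (\<lambda>t. c * Dl ks f t)" for ks
    by (rule Dl_cmult[OF S_omega_partially_smooth[OF f]])
  have DF: "Dl ks (FT (\<lambda>t. c * f t)) = (\<lambda>t. c * Dl ks (FT f) t)" for ks
    using Dl_cmult[OF partially_smooth_FT[OF S_omega_rapidly_decreasing[OF f]], of ks c] by (simp add: FT_cmult[abs_def])
  have b: "cmod (c * Dl ks f x) \<le> cmod c * semi \<omega> lam ks f * decay lam x"
      "cmod (c * Dl ks (FT f) x) \<le> cmod c * semi \<omega> lam ks f * decay lam x" if "lam > 0" for lam ks x
    unfolding norm_mult mult.assoc using that by (intro mult_left_mono semi_ge f; simp)+
  show "(\<lambda>t. c * f t) \<in> S_omega \<omega>"
    unfolding S_omega_iff D DF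
    by (intro conjI allI impI differentiable_mult differentiable_const S_omega_differentiable f)
      (use b in blast)+
  show "lam > 0 \<Longrightarrow> semi \<omega> lam ks (\<lambda>t. c * f t) \<le> 2 * (cmod c * semi \<omega> lam ks f)"
    using semi_le[of ks "\<lambda>t. c * f t", unfolded D DF, OF b] by simp
qed

text \<open>Differentiating the modulation produces powers of \<open>\<xi>\<close>, which are
  absorbed into an exponential weight; the translation costs
  \<open>exp (lam * \<omega> (norm x))\<close> by subadditivity.\<close>

lemma tf_shift_weighted_bound:
  fixes F :: "real^'n::finite \<Rightarrow> complex"
  assumes F: "partially_smooth F" and C: "C \<ge> 0" and lam: "lam \<ge> 0"
    and b: "\<And>ks x. length ks \<le> N \<Longrightarrow> cmod (Dl ks F x) \<le> C * decay lam x"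
    and K: "\<And>t. t \<ge> 0 \<Longrightarrow> (1 + t) ^ N \<le> K * exp (lam0 * \<omega> t)" "K \<ge> 0" and ks: "length ks \<le> N"
  shows "cmod (Dl ks (tf_shift x \<xi> F) t) \<le> 2 ^ N * K * C * exp (lam0 * \<omega> (norm \<xi>) + lam * \<omega> (norm x)) * decay lam t"
proof -
  have "cmod (Dl ks (tf_shift x \<xi> F) t) \<le> 2 ^ length ks * ((1 + norm \<xi>) ^ length ks * (C * decay lam (t - x)))"
    by (rule Dl_tf_shift_bound[OF F]) (use ks in \<open>auto intro: b\<close>)
  also have "\<dots> \<le> 2 ^ N * ((K * exp (lam0 * \<omega> (norm \<xi>))) * (C * (exp (lam * \<omega> (norm x)) * decay lam t)))"
  proof (intro mult_mono)
    have "(1 + norm \<xi>) ^ length ks \<le> (1 + norm \<xi>) ^ N" using ks by (intro power_increasing) auto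
    then show "(1 + norm \<xi>) ^ length ks \<le> K * exp (lam0 * \<omega> (norm \<xi>))" using K(1)[of "norm \<xi>"] by simp
    show "decay lam (t - x) \<le> exp (lam * \<omega> (norm x)) * decay lam t"
      by (rule exp_weight_shift[OF lam])
  qed (use ks C K in auto)
  finally show ?thesis by (simp add: exp_add mult_ac)
qed

text \<open>Up to a phase the Fourier transform exchanges translation and modulation, so frequency
  side estimates are the space side ones with the two shifts swapped.\<close>

lemma FT_tf_shift_eq:
  assumes "f \<in> borel_measurable borel"
  shows "FT (tf_shift x \<xi> f) = (\<lambda>\<eta>. cis (x \<bullet> \<xi>) * tf_shift \<xi> (- x) (FT f) \<eta>)"
proof
  fix \<eta>
  have "cis (- (x \<bullet> (\<eta> - \<xi>))) = cis (x \<bullet> \<xi>) * cis (\<eta> \<bullet> (- x))"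
    by (simp add: cis_mult inner_diff_right inner_commute)
  then show "FT (tf_shift x \<xi> f) \<eta> = cis (x \<bullet> \<xi>) * tf_shift \<xi> (- x) (FT f) \<eta>"
    by (simp add: FT_tf_shift[OF assms] tf_shift_def mult.assoc)
qed

lemma partially_smooth_mult:
  assumes f: "partially_smooth f" and g: "partially_smooth g"
  shows "partially_smooth (\<lambda>x. f x * g x)"
  unfolding partially_smooth_def Dl_mult[OF f g]
proof (intro allI differentiable_sum_list)
  fix j x p
  show "(\<lambda>s. Dl (fst p) f (x + s *\<^sub>R axis j 1) * Dl (snd p) g (x + s *\<^sub>R axis j 1)) differentiable (at 0)"
    using f g unfolding partially_smooth_def by (intro differentiable_mult) auto
qed

lemma partially_smooth_tf_shift:
  assumes f: "partially_smooth f"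
  shows "partially_smooth (tf_shift x \<xi> f)"
proof -
  have "x' + s *\<^sub>R axis j 1 - x = (x' - x) + s *\<^sub>R axis j 1" for x' s j by simp
  then have "partially_smooth (\<lambda>t. f (t - x))" using f by (simp only: partially_smooth_def Dl_translate) blast
  then show ?thesis unfolding tf_shift_def[abs_def]
    by (rule partially_smooth_mult[rotated]) (intro partially_smoothI Dl_cis_differentiable)
qed

lemma tf_shift_estimates:
  fixes f :: "real^'n::finite \<Rightarrow> complex"
  assumes f: "f \<in> S_omega \<omega>" and lam: "lam > 0"
  shows "\<exists>C mu. C \<ge> 0 \<and> mu > 0 \<and> (\<forall>ks x \<xi> t. length ks \<le> N \<longrightarrow>
     cmod (Dl ks (tf_shift x \<xi> f) t) \<le> C * exp (mu * (\<omega> (norm x) + \<omega> (norm \<xi>))) * decay lam t \<and>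
     cmod (Dl ks (FT (tf_shift x \<xi> f)) t) \<le> C * exp (mu * (\<omega> (norm x) + \<omega> (norm \<xi>))) * decay lam t)"
proof -
  obtain C where C: "C \<ge> 0" and b: "\<And>ks x. length ks \<le> N \<Longrightarrow> cmod (Dl ks f x) \<le> C * decay lam x"
     "\<And>ks x. length ks \<le> N \<Longrightarrow> cmod (Dl ks (FT f) x) \<le> C * decay lam x"
    using S_omega_bound[OF f lam, of N] by blast
  obtain lam0 K where lam0: "lam0 > 0" "K > 0" and K: "\<And>t. t \<ge> 0 \<Longrightarrow> (1 + t) ^ N \<le> K * exp (lam0 * \<omega> t)"
    using power_le_exp_weight by metis
  let ?mu = "lam0 + lam"
  have e1: "exp (lam0 * \<omega> (norm \<xi>) + lam * \<omega> (norm x)) \<le> exp (?mu * (\<omega> (norm x) + \<omega> (norm \<xi>)))"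
    and e2: "exp (lam0 * \<omega> (norm (- x)) + lam * \<omega> (norm \<xi>)) \<le> exp (?mu * (\<omega> (norm x) + \<omega> (norm \<xi>)))" for x \<xi> :: "real^'n"
    using lam lam0 by (auto simp: algebra_simps)
  have ps: "partially_smooth (FT f)" by (rule partially_smooth_FT[OF S_omega_rapidly_decreasing[OF f]])
  show ?thesis
  proof (rule exI[of _ "2 ^ N * K * C"], rule exI[of _ ?mu], intro conjI allI impI)
    show "0 \<le> 2 ^ N * K * C" "?mu > 0" using C lam0 lam by auto
    fix ks :: "'n list" and x \<xi> t :: "real^'n" assume ks: "length ks \<le> N"
    have "cmod (Dl ks (tf_shift x \<xi> f) t) \<le> 2 ^ N * K * C * exp (lam0 * \<omega> (norm \<xi>) + lam * \<omega> (norm x)) * decay lam t"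
      using lam lam0 by (intro tf_shift_weighted_bound[where N = N] S_omega_partially_smooth f C b K ks) auto
    also have "\<dots> \<le> 2 ^ N * K * C * exp (?mu * (\<omega> (norm x) + \<omega> (norm \<xi>))) * decay lam t"
      using C lam0 by (intro mult_right_mono mult_left_mono e1) auto
    finally show "cmod (Dl ks (tf_shift x \<xi> f) t) \<le> 2 ^ N * K * C * exp (?mu * (\<omega> (norm x) + \<omega> (norm \<xi>))) * decay lam t" .
    have "cmod (Dl ks (FT (tf_shift x \<xi> f)) t) = cmod (Dl ks (tf_shift \<xi> (- x) (FT f)) t)"
      unfolding FT_tf_shift_eq[OF S_omega_measurable[OF f]] Dl_cmult[OF partially_smooth_tf_shift[OF ps]] by (simp add: norm_mult)
    also have "\<dots> \<le> 2 ^ N * K * C * exp (lam0 * \<omega> (norm (- x)) + lam * \<omega> (norm \<xi>)) * decay lam t"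
      using lam lam0 by (intro tf_shift_weighted_bound[where N = N] ps C b K ks) auto
    also have "\<dots> \<le> 2 ^ N * K * C * exp (?mu * (\<omega> (norm x) + \<omega> (norm \<xi>))) * decay lam t"
      using C lam0 by (intro mult_right_mono mult_left_mono e2) auto
    finally show "cmod (Dl ks (FT (tf_shift x \<xi> f)) t) \<le> 2 ^ N * K * C * exp (?mu * (\<omega> (norm x) + \<omega> (norm \<xi>))) * decay lam t" .
  qed
qed

lemma S_omega_tf_shift:
  assumes f: "f \<in> S_omega \<omega>"
  shows "tf_shift x \<xi> f \<in> S_omega \<omega>"
  unfolding S_omega_iff
proof (intro conjI allI impI)
  show "Dl ks (tf_shift x \<xi> f) differentiable (at t)" for ks t
    by (rule Dl_tf_shift_differentiable[OF S_omega_differentiable[OF f]])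
  fix lam :: real and ks assume "lam > 0"
  from tf_shift_estimates[OF f this, of "length ks"]
  show "\<exists>C. \<forall>t. cmod (Dl ks (tf_shift x \<xi> f) t) \<le> C * decay lam t"
    "\<exists>C. \<forall>t. cmod (Dl ks (FT (tf_shift x \<xi> f)) t) \<le> C * decay lam t"
    by blast+
qed

lemma semi_tf_shift:
  fixes f :: "real^'n::finite \<Rightarrow> complex"
  assumes f: "f \<in> S_omega \<omega>" and lam: "lam > 0"
  shows "\<exists>C mu. C \<ge> 0 \<and> mu > 0 \<and> (\<forall>ks x \<xi>. length ks \<le> N \<longrightarrow>
     semi \<omega> lam ks (tf_shift x \<xi> f) \<le> C * exp (mu * (\<omega> (norm x) + \<omega> (norm \<xi>))))"
proof -
  obtain C mu where C: "C \<ge> 0" "mu > 0" and b: "\<And>ks x \<xi> t. length ks \<le> N \<Longrightarrow>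
     cmod (Dl ks (tf_shift x \<xi> f) t) \<le> C * exp (mu * (\<omega> (norm x) + \<omega> (norm \<xi>))) * decay lam t"
    "\<And>ks x \<xi> t. length ks \<le> N \<Longrightarrow>
     cmod (Dl ks (FT (tf_shift x \<xi> f)) t) \<le> C * exp (mu * (\<omega> (norm x) + \<omega> (norm \<xi>))) * decay lam t"
    using tf_shift_estimates[OF f lam, of N] by blast
  show ?thesis
  proof (rule exI[of _ "2 * C"], rule exI[of _ mu], intro conjI allI impI)
    show "semi \<omega> lam ks (tf_shift x \<xi> f) \<le> 2 * C * exp (mu * (\<omega> (norm x) + \<omega> (norm \<xi>)))" if "length ks \<le> N" for ks x \<xi>
      using semi_le[OF b(1)[OF that, of x \<xi>] b(2)[OF that, of x \<xi>]] by simp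
  qed (use C in auto)
qed

text \<open>A completeness statement for absolutely convergent series. On the space side the
  derivatives are summed by induction on their order; on the frequency side they are transforms of
  monomial multiples, so only a sum and an integral have to be exchanged.\<close>

lemma S_omega_series:
  fixes f :: "nat \<Rightarrow> real^'n::finite \<Rightarrow> complex"
  assumes f: "\<And>i. f i \<in> S_omega \<omega>" and sm: "\<And>lam ks. lam > 0 \<Longrightarrow> summable (\<lambda>i. semi \<omega> lam ks (f i))"
    and F: "\<And>t. (\<lambda>i. f i t) sums F t"
  shows "F \<in> S_omega \<omega>" and "lam > 0 \<Longrightarrow> semi \<omega> lam ks F \<le> 2 * (\<Sum>i. semi \<omega> lam ks (f i))"
proof -
  have e1: "decay lam x \<le> 1" if "lam > 0" for lam and x :: "real^'n"
    using that by simp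
  \<comment> \<open>The exponent 1 is an arbitrary choice; some unweighted summable majorant is all
    that termwise differentiation needs.\<close>
  have D1: "cmod (Dl ks (f i) x) \<le> semi \<omega> 1 ks (f i)" for ks i x
    using order_trans[OF semi_ge(1)[OF f zero_less_one] mult_left_mono[OF e1[of 1] semi_ge(3)[OF f zero_less_one]]] by simp
  have step: "(Dl ks F differentiable (at x)) \<and> (\<lambda>i. Dl (j # ks) (f i) x) sums Dl (j # ks) F x"
    if IH: "\<And>x. (\<lambda>i. Dl ks (f i) x) sums Dl ks F x" for ks x j
  proof -
    have M: "cmod (partial_deriv j (Dl ks (f i)) x) \<le> (\<Sum>j\<in>UNIV. semi \<omega> 1 (j # ks) (f i))" for i j x
    proof -
      have "cmod (partial_deriv j (Dl ks (f i)) x) \<le> semi \<omega> 1 (j # ks) (f i)"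
        using D1[of "j # ks" i x] by simp
      also have "\<dots> \<le> (\<Sum>j\<in>UNIV. semi \<omega> 1 (j # ks) (f i))"
        by (rule member_le_sum) (auto intro: semi_ge(3)[OF f])
      finally show ?thesis .
    qed
    have "summable (\<lambda>i. \<Sum>j\<in>UNIV. semi \<omega> 1 (j # ks) (f i))"
      by (intro summable_sum sm) simp
    from differentiable_series[OF S_omega_differentiable[OF f] M this IH]
    show ?thesis by simp
  qed
  have sums: "\<forall>x. (\<lambda>i. Dl ks (f i) x) sums Dl ks F x" for ks
  proof (induction ks)
    case Nil
    show ?case using F by simp
  next
    case (Cons j ks)
    then show ?case using step by blast
  qed
  then have diff: "Dl ks F differentiable (at x)" for ks x using step by blast
  have x_side: "cmod (Dl ks F x) \<le> (\<Sum>i. semi \<omega> lam ks (f i)) * decay lam x" if "lam > 0" for lam ks x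
  proof -
    have "cmod (Dl ks F x) = cmod (\<Sum>i. Dl ks (f i) x)" using sums by (simp add: sums_iff)
    also have "\<dots> \<le> (\<Sum>i. semi \<omega> lam ks (f i) * decay lam x)"
      by (rule norm_suminf_le[OF semi_ge(1)[OF f that] summable_mult2[OF sm[OF that]]])
    also have "\<dots> = (\<Sum>i. semi \<omega> lam ks (f i)) * decay lam x"
      by (rule suminf_mult2[symmetric, OF sm[OF that]])
    finally show ?thesis .
  qed
  have Fr: "rapidly_decreasing F"
  proof (rule rapidly_decreasingI)
    show "continuous_on UNIV F"
      using diff[of "[]"] by (auto simp: continuous_on_eq_continuous_at intro: differentiable_imp_continuous_within)
    show "\<exists>C. \<forall>x. cmod (F x) \<le> C * decay lam x" if "lam > 0" for lam
      using x_side[OF that, of "[]"] by auto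
  qed
  have FTs: "(\<lambda>i. Dl ks (FT (f i)) \<xi>) sums Dl ks (FT F) \<xi>" for ks \<xi>
    unfolding Dl_FT[OF S_omega_rapidly_decreasing[OF f]] Dl_FT[OF Fr]
  proof (rule FT_sums)
    \<comment> \<open>The exponent is large enough to absorb the monomial and leave an integrable
      kernel.\<close>
    obtain lam K where lam: "lam > 0" and K0: "K > 0"
      and K: "\<And>t. t \<ge> 0 \<Longrightarrow> (1 + t) ^ (length ks + 2 * CARD('n)) \<le> K * exp (lam * \<omega> t)"
      using power_le_exp_weight by metis
    have b: "cmod (monomial_mult ks (f i) t) \<le> semi \<omega> lam [] (f i) * (K * (1 / (1 + norm t) ^ (2 * CARD('n))))" for i t
    proof -
      have p: "0 < (1 + norm t) ^ (2 * CARD('n))" by (simp add: add_pos_nonneg)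
      have "cmod (monomial_mult ks (f i) t) \<le> (1 + norm t) ^ length ks * cmod (f i t)" by (rule norm_monomial_mult)
      also have "\<dots> \<le> (1 + norm t) ^ length ks * (semi \<omega> lam [] (f i) * decay lam t)"
        using semi_ge(1)[OF f lam, of "[]" i t] by (intro mult_left_mono) auto
      also have "\<dots> = semi \<omega> lam [] (f i) * ((1 + norm t) ^ length ks * decay lam t)"
        by (simp only: mult_ac)
      also have "\<dots> \<le> semi \<omega> lam [] (f i) * (K * (1 / (1 + norm t) ^ (2 * CARD('n))))"
      proof (intro mult_left_mono semi_ge(3)[OF f lam])
        have "(1 + norm t) ^ length ks * (1 + norm t) ^ (2 * CARD('n)) \<le> K * exp (lam * \<omega> (norm t))"
          using K[of "norm t"] by (simp add: power_add)
        then show "(1 + norm t) ^ length ks * decay lam t \<le> K * (1 / (1 + norm t) ^ (2 * CARD('n)))"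
          using p by (simp add: exp_minus field_simps)
      qed
      finally show ?thesis .
    qed
    show i: "integrable lborel (monomial_mult ks (f i))" for i
      by (intro rapidly_decreasing_integrable0 rapidly_decreasing_monomial_mult S_omega_rapidly_decreasing f)
    show "(\<lambda>i. monomial_mult ks (f i) t) sums monomial_mult ks F t" for t
      unfolding monomial_mult_def by (rule sums_mult[OF F])
    show "summable (\<lambda>i. cmod (monomial_mult ks (f i) t))" for t
      by (rule summable_comparison_test'[OF summable_mult2[OF sm[OF lam, of "[]"],
            of "K * (1 / (1 + norm t) ^ (2 * CARD('n)))"], of 0]) (unfold real_norm_def abs_norm_cancel, rule b)
    show "summable (\<lambda>i. LINT t|lborel. cmod (monomial_mult ks (f i) t))"
    proof (rule summable_comparison_test'[OF summable_mult2[OF sm[OF lam, of "[]"]], of 0])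
      fix i
      have "(LINT t|lborel. cmod (monomial_mult ks (f i) t)) \<le> (LINT t|lborel. semi \<omega> lam [] (f i) * (K * (1 / (1 + norm (t::real^'n)) ^ (2 * CARD('n)))))"
        by (rule integral_mono[OF integrable_norm[OF i] _ b]) (intro integrable_mult_right integrable_kernel)
      then show "norm (LINT t|lborel. cmod (monomial_mult ks (f i) t)) \<le> semi \<omega> lam [] (f i) * (K * (LINT t|lborel. 1 / (1 + norm (t::real^'n)) ^ (2 * CARD('n))))"
        by (simp only: integral_mult_right_zero real_norm_def) (simp add: abs_of_nonneg)
    qed
  qed
  have xi_side: "cmod (Dl ks (FT F) x) \<le> (\<Sum>i. semi \<omega> lam ks (f i)) * decay lam x" if "lam > 0" for lam ks x
  proof -
    have "cmod (Dl ks (FT F) x) = cmod (\<Sum>i. Dl ks (FT (f i)) x)" using FTs by (simp add: sums_iff)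
    also have "\<dots> \<le> (\<Sum>i. semi \<omega> lam ks (f i) * decay lam x)"
      by (rule norm_suminf_le[OF semi_ge(2)[OF f that] summable_mult2[OF sm[OF that]]])
    also have "\<dots> = (\<Sum>i. semi \<omega> lam ks (f i)) * decay lam x"
      by (rule suminf_mult2[symmetric, OF sm[OF that]])
    finally show ?thesis .
  qed
  show "F \<in> S_omega \<omega>"
    unfolding S_omega_iff using diff x_side xi_side by blast
  show "semi \<omega> lam ks F \<le> 2 * (\<Sum>i. semi \<omega> lam ks (f i))" if "lam > 0"
    using semi_le[OF x_side[OF that] xi_side[OF that]] by simp
qed

section \<open>Functionals: growth under shifts and application to series\<close>

lemma S_dual_linear:
  "u \<in> S_dual \<omega> \<Longrightarrow> f \<in> S_omega \<omega> \<Longrightarrow> g \<in> S_omega \<omega> \<Longrightarrow> u (\<lambda>t. c * f t + g t) = cnj c * u f + u g"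
  by (simp add: S_dual_def)

lemma S_dual_add:
  "u \<in> S_dual \<omega> \<Longrightarrow> f \<in> S_omega \<omega> \<Longrightarrow> g \<in> S_omega \<omega> \<Longrightarrow> u (\<lambda>t. f t + g t) = u f + u g"
  using S_dual_linear[of u f g 1] by simp

lemma S_dual_cmult:
  assumes u: "u \<in> S_dual \<omega>" and f: "f \<in> S_omega \<omega>"
  shows "u (\<lambda>t. c * f t) = cnj c * u f"
proof -
  \<comment> \<open>The zero function is written as a multiple of \<open>f\<close>, which gives its
    membership; additivity then forces \<open>u\<close> to vanish on it.\<close>
  have z: "(\<lambda>t. 0 * f t) \<in> S_omega \<omega>" by (rule S_omega_cmult(1)[OF f])
  then have "u (\<lambda>t. 0 * f t + 0 * f t) = u (\<lambda>t. 0 * f t) + u (\<lambda>t. 0 * f t)" by (rule S_dual_add[OF u z])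
  then have u0: "u (\<lambda>t. 0 * f t) = 0" by simp
  have "u (\<lambda>t. c * f t + 0 * f t) = cnj c * u f + u (\<lambda>t. 0 * f t)"
    by (rule S_dual_linear[OF u f z])
  then show ?thesis using u0 by simp
qed

lemma S_dual_bound:
  fixes u :: "(real^'n::finite \<Rightarrow> complex) \<Rightarrow> complex"
  assumes u: "u \<in> S_dual \<omega>"
  shows "\<exists>C N lam. C \<ge> 0 \<and> lam > 0 \<and> (\<forall>f\<in>S_omega \<omega>. cmod (u f) \<le> C * (\<Sum>ks\<in>{ks. length ks \<le> N}. semi \<omega> lam ks f))"
proof -
  obtain C N lam where lam: "lam > 0"
    and C: "\<And>f. f \<in> S_omega \<omega> \<Longrightarrow> cmod (u f) \<le> C * (\<Sum>ks\<in>{ks. length ks \<le> N}. semi \<omega> lam ks f)"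
    using u unfolding S_dual_def by blast
  have "cmod (u f) \<le> \<bar>C\<bar> * (\<Sum>ks\<in>{ks. length ks \<le> N}. semi \<omega> lam ks f)" if f: "f \<in> S_omega \<omega>" for f
    by (rule order_trans[OF C[OF f]]) (intro mult_right_mono sum_nonneg semi_ge(3) f lam abs_ge_self)
  then show ?thesis using lam by (intro exI[of _ "\<bar>C\<bar>"] exI[of _ N] exI[of _ lam]) auto
qed

lemma S_dual_growth:
  fixes u :: "(real^'n::finite \<Rightarrow> complex) \<Rightarrow> complex"
  assumes u: "u \<in> S_dual \<omega>" and f: "f \<in> S_omega \<omega>"
  shows "\<exists>C mu. C \<ge> 0 \<and> mu > 0 \<and> (\<forall>x \<xi>. cmod (u (tf_shift x \<xi> f)) \<le> C * exp (mu * (\<omega> (norm x) + \<omega> (norm \<xi>))))"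
proof -
  obtain C N lam where C: "C \<ge> 0" and lam: "lam > 0"
    and b: "\<And>f. f \<in> S_omega \<omega> \<Longrightarrow> cmod (u f) \<le> C * (\<Sum>ks\<in>{ks. length ks \<le> N}. semi \<omega> lam ks f)"
    using S_dual_bound[OF u] by blast
  obtain D mu where D: "D \<ge> 0" "mu > 0" and s: "\<And>ks x \<xi>. length ks \<le> N \<Longrightarrow>
     semi \<omega> lam ks (tf_shift x \<xi> f) \<le> D * exp (mu * (\<omega> (norm x) + \<omega> (norm \<xi>)))"
    using semi_tf_shift[OF f lam, of N] by blast
  let ?n = "real (card {ks::'n list. length ks \<le> N})"
  have "cmod (u (tf_shift x \<xi> f)) \<le> C * ?n * D * exp (mu * (\<omega> (norm x) + \<omega> (norm \<xi>)))" for x \<xi>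
  proof -
    have "(\<Sum>ks\<in>{ks. length ks \<le> N}. semi \<omega> lam ks (tf_shift x \<xi> f)) \<le> ?n * (D * exp (mu * (\<omega> (norm x) + \<omega> (norm \<xi>))))"
      by (rule sum_bounded_above) (simp add: s)
    from order_trans[OF b[OF S_omega_tf_shift[OF f]] mult_left_mono[OF this C]] show ?thesis
      by (simp add: mult_ac)
  qed
  then show ?thesis using C D
    by (intro exI[of _ "C * ?n * D"] exI[of _ mu]) auto
qed

text \<open>The tails are again members, with seminorms bounded by the tails of the summable
  seminorms. Additivity removes one term at a time, and the continuity estimate sends
  \<open>u\<close> of the tail to 0.\<close>

lemma S_dual_series:
  fixes f :: "nat \<Rightarrow> real^'n::finite \<Rightarrow> complex" and u :: "(real^'n \<Rightarrow> complex) \<Rightarrow> complex"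
  assumes u: "u \<in> S_dual \<omega>"
    and f: "\<And>i. f i \<in> S_omega \<omega>" and sm: "\<And>lam ks. lam > 0 \<Longrightarrow> summable (\<lambda>i. semi \<omega> lam ks (f i))"
    and F: "\<And>t. (\<lambda>i. f i t) sums F t"
  shows "(\<lambda>i. u (f i)) sums u F"
proof -
  obtain C N lam where C: "C \<ge> 0" and lam: "lam > 0"
    and b: "\<And>f. f \<in> S_omega \<omega> \<Longrightarrow> cmod (u f) \<le> C * (\<Sum>ks\<in>{ks. length ks \<le> N}. semi \<omega> lam ks f)"
    using S_dual_bound[OF u] by blast
  define T where "T n t = F t - (\<Sum>i<n. f i t)" for n t
  have Ts: "(\<lambda>i. f (i + n) t) sums T n t" for n t
    unfolding T_def by (rule sums_split_initial_segment[OF F])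
  have TS: "T n \<in> S_omega \<omega>" and Tsemi: "lam > 0 \<Longrightarrow> semi \<omega> lam ks (T n) \<le> 2 * (\<Sum>i. semi \<omega> lam ks (f (i + n)))" for n ks lam
    by (rule S_omega_series[OF f summable_ignore_initial_segment[OF sm] Ts]; assumption)+
  have T0: "T 0 = F" by (simp add: T_def fun_eq_iff)
  have rec: "u (T n) = u (f n) + u (T (Suc n))" for n
  proof -
    have eq: "T n = (\<lambda>t. f n t + T (Suc n) t)" by (simp add: T_def fun_eq_iff)
    show ?thesis by (subst eq) (rule S_dual_add[OF u f TS])
  qed
  have part: "u F - (\<Sum>i<n. u (f i)) = u (T n)" for n
  proof (induction n)
    case (Suc n)
    have "u F - (\<Sum>i<Suc n. u (f i)) = (u F - (\<Sum>i<n. u (f i))) - u (f n)" by simp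
    also have "\<dots> = u (T (Suc n))" unfolding Suc rec[of n] by simp
    finally show ?case .
  qed (simp add: T0)
  have "(\<lambda>n. u (T n)) \<longlonglongrightarrow> 0"
  proof (rule Lim_null_comparison)
    show "\<forall>\<^sub>F n in sequentially. norm (u (T n)) \<le> C * (\<Sum>ks\<in>{ks. length ks \<le> N}. 2 * (\<Sum>i. semi \<omega> lam ks (f (i + n))))"
      by (intro always_eventually allI order_trans[OF b[OF TS]] mult_left_mono sum_mono Tsemi lam C)
    have "(\<lambda>n. C * (\<Sum>ks\<in>{ks. length ks \<le> N}. 2 * (\<Sum>i. semi \<omega> lam ks (f (i + n))))) \<longlonglongrightarrow> C * (\<Sum>ks\<in>{ks::'n list. length ks \<le> N}. 2 * 0)"
      by (intro tendsto_intros suminf_exist_split2 sm lam)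
    then show "(\<lambda>n. C * (\<Sum>ks\<in>{ks. length ks \<le> N}. 2 * (\<Sum>i. semi \<omega> lam ks (f (i + n))))) \<longlonglongrightarrow> 0" by simp
  qed
  then have "(\<lambda>n. u F - (\<Sum>i<n. u (f i))) \<longlonglongrightarrow> 0" by (simp only: part)
  from tendsto_diff[OF tendsto_const[of "u F"] this] show ?thesis by (simp add: sums_def)
qed

lemma S_dual_cseries:
  fixes f :: "nat \<Rightarrow> real^'n::finite \<Rightarrow> complex" and u :: "(real^'n \<Rightarrow> complex) \<Rightarrow> complex"
  assumes u: "u \<in> S_dual \<omega>"
    and f: "\<And>i. f i \<in> S_omega \<omega>" and sm: "\<And>lam ks. lam > 0 \<Longrightarrow> summable (\<lambda>i. cmod (c i) * semi \<omega> lam ks (f i))"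
    and F: "\<And>t. (\<lambda>i. c i * f i t) sums F t"
  shows "(\<lambda>i. cnj (c i) * u (f i)) sums u F"
proof -
  have "summable (\<lambda>i. semi \<omega> lam ks (\<lambda>t. c i * f i t))" if "lam > 0" for lam ks
    by (rule summable_comparison_test'[OF summable_mult[OF sm[OF that, of ks], of 2], of 0])
      (use S_omega_cmult[OF f] semi_ge(3)[OF S_omega_cmult(1)[OF f] that] that in auto)
  from S_dual_series[OF u S_omega_cmult(1)[OF f] this F] show ?thesis
    by (simp add: S_dual_cmult[OF u f])
qed

lemma min_square_le_mult: "(X::real) \<le> A * a\<^sup>2 \<Longrightarrow> X \<le> A * b\<^sup>2 \<Longrightarrow> 0 \<le> A \<Longrightarrow> 0 \<le> a \<Longrightarrow> 0 \<le> b \<Longrightarrow> X \<le> A * (a * b)"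
proof (cases "a \<le> b")
  case True
  assume "X \<le> A * a\<^sup>2" "0 \<le> A" "0 \<le> a"
  then show ?thesis using True by (intro order_trans[OF _ mult_left_mono[of "a\<^sup>2" "a * b" A]]) (auto simp: power2_eq_square mult_left_mono)
next
  case False
  assume "X \<le> A * b\<^sup>2" "0 \<le> A" "0 \<le> b"
  then show ?thesis using False by (intro order_trans[OF _ mult_left_mono[of "b\<^sup>2" "a * b" A]]) (auto simp: power2_eq_square mult_right_mono)
qed

lemma exp_weight_separate:
  assumes "Lam \<ge> 0"
  shows "decay Lam (t - v) * decay Lam t \<le> decay Lam v"
proof -
  have "Lam * \<omega> (norm v) \<le> Lam * (\<omega> (norm (t - v)) + \<omega> (norm t))"
    by (rule mult_left_mono[OF weight_norm_diff' assms])
  then show ?thesis by (simp add: exp_add[symmetric] algebra_simps)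
qed

text \<open>The transform of a product with a translate decays in the frequency because both factors have
  decaying transforms, and in the translation because their product is small in the mean; the
  geometric mean of the two bounds gives joint decay.\<close>

lemma FT_translate_product:
  fixes h \<Psi> :: "real^'n::finite \<Rightarrow> complex"
  assumes hc: "continuous_on UNIV h" and supp: "\<And>t. r < norm t \<Longrightarrow> h t = 0"
    and hF: "\<And>lam. lam > 0 \<Longrightarrow> \<exists>C. \<forall>\<xi>. cmod (FT h \<xi>) \<le> C * decay lam \<xi>"
    and hb: "\<And>lam. lam > 0 \<Longrightarrow> \<exists>C. \<forall>t. cmod (h t) \<le> C * decay lam t"
    and \<Psi>m: "\<Psi> \<in> borel_measurable borel"
    and \<Psi>b: "\<And>lam. lam > 0 \<Longrightarrow> \<exists>C. \<forall>t. (1 + norm t) ^ (2 * CARD('n)) * cmod (\<Psi> t) \<le> C * decay lam t"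
    and \<Psi>F: "\<And>lam. lam > 0 \<Longrightarrow> \<exists>C. \<forall>\<xi>. cmod (FT \<Psi> \<xi>) \<le> C * decay lam \<xi>"
    and lam: "lam > 0"
  shows "\<exists>C\<ge>0. \<forall>v \<xi>. cmod (FT (\<lambda>t. h (t - v) * \<Psi> t) \<xi>) \<le> C * (decay lam v * decay lam \<xi>)"
proof -
  note [measurable] = \<Psi>m borel_measurable_continuous_onI[OF hc]
  \<comment> \<open>Both bounds are prepared with the doubled exponent because the geometric mean
    halves it.\<close>
  have l2: "2 * lam > 0" using lam by simp
  obtain mu K where mu: "mu > 0" and K: "K > 0"
    and FP: "\<forall>lam\<ge>0. \<forall>C1 C2 r. \<forall>h \<Psi> :: real^'n \<Rightarrow> complex.
     continuous_on UNIV h \<longrightarrow> (\<forall>t. r < norm t \<longrightarrow> h t = 0) \<longrightarrow>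
     (\<forall>\<xi>. cmod (FT h \<xi>) \<le> C1 * decay (lam + mu) \<xi>) \<longrightarrow>
     integrable lborel \<Psi> \<longrightarrow> (\<forall>\<xi>. cmod (FT \<Psi> \<xi>) \<le> C2 * decay lam \<xi>) \<longrightarrow>
     (\<forall>\<xi>. cmod (FT (\<lambda>t. h t * \<Psi> t) \<xi>) \<le> K * C1 * C2 * decay lam \<xi>)"
    using FT_product[where 'n = 'n] by blast
  have "2 * lam + mu > 0" using lam mu by simp
  then obtain C1 where C1: "\<And>\<xi>. cmod (FT h \<xi>) \<le> C1 * decay (2 * lam + mu) \<xi>" using hF by blast
  obtain C2 where C2: "\<And>\<xi>. cmod (FT \<Psi> \<xi>) \<le> C2 * decay (2 * lam) \<xi>" using \<Psi>F[OF l2] by blast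
  obtain Ch where Ch: "\<And>t. cmod (h t) \<le> Ch * decay (2 * lam) t" using hb[OF l2] by blast
  obtain Cp where Cp: "\<And>t. (1 + norm t) ^ (2 * CARD('n)) * cmod (\<Psi> t) \<le> Cp * decay (2 * lam) t"
    using \<Psi>b[OF l2] by blast
  have pos: "C1 \<ge> 0" "C2 \<ge> 0" "Ch \<ge> 0" "Cp \<ge> 0"
    using order_trans[OF norm_ge_zero C1[of 0]] order_trans[OF norm_ge_zero C2[of 0]]
      order_trans[OF norm_ge_zero Ch[of 0]] order_trans[OF _ Cp[of 0], of 0] by (auto simp: zero_le_mult_iff)
  have kp: "0 < (1 + norm t) ^ (2 * CARD('n))" for t :: "real^'n" by (simp add: add_pos_nonneg)
  have Cp': "cmod (\<Psi> t) \<le> Cp * decay (2 * lam) t * (1 / (1 + norm t) ^ (2 * CARD('n)))" for t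
    using Cp[of t] kp[of t] by (simp add: pos_le_divide_eq mult.commute)
  have ki: "integrable lborel (\<lambda>t::real^'n. 1 / (1 + norm t) ^ (2 * CARD('n)))" by (rule integrable_kernel)
  have \<Psi>i: "integrable lborel \<Psi>"
  proof (rule Bochner_Integration.integrable_bound[OF integrable_mult_right[OF ki, of Cp]])
    have "cmod (\<Psi> t) \<le> norm (Cp * (1 / (1 + norm t) ^ (2 * CARD('n))))" for t
    proof -
      have "cmod (\<Psi> t) \<le> Cp * decay (2 * lam) t * (1 / (1 + norm t) ^ (2 * CARD('n)))" by (rule Cp')
      also have "\<dots> \<le> Cp * 1 * (1 / (1 + norm t) ^ (2 * CARD('n)))"
        using pos lam by (intro mult_right_mono mult_left_mono) auto
      finally show ?thesis using pos by simp
    qed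
    then show "AE t in lborel. norm (\<Psi> t) \<le> norm (Cp * (1 / (1 + norm t) ^ (2 * CARD('n))))" by simp
  qed simp
  define I where "I = (LINT t|lborel. 1 / (1 + norm (t::real^'n)) ^ (2 * CARD('n)))"
  have I0: "I \<ge> 0" unfolding I_def by (intro integral_nonneg_AE AE_I2) simp
  define A where "A = max (K * C1 * C2) (Ch * Cp * I)"
  have A0: "A \<ge> 0" using K pos by (simp add: A_def le_max_iff_disj)
  have sq: "(decay lam y)\<^sup>2 = decay (2 * lam) y" for y :: "real^'n"
    by (simp add: exp_double[symmetric])
  have "cmod (FT (\<lambda>t. h (t - v) * \<Psi> t) \<xi>) \<le> A * (decay lam v * decay lam \<xi>)" for v \<xi>
  proof (rule min_square_le_mult[OF _ _ A0])
    have "cmod (FT (\<lambda>t. h (t - v) * \<Psi> t) \<xi>) \<le> K * C1 * C2 * decay (2 * lam) \<xi>"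
    proof (rule FP[rule_format])
      show "continuous_on UNIV (\<lambda>t. h (t - v))"
        by (rule continuous_on_compose2[OF hc]) (auto intro!: continuous_intros)
      show "h (t - v) = 0" if "r + norm v < norm t" for t
        using supp[of "t - v"] norm_triangle_sub[of t v] that by simp
      \<comment> \<open>A translation changes the transform by a phase only, so the frequency bound
        is uniform in \<open>v\<close>.\<close>
      have "FT (\<lambda>t. h (t - v)) \<xi> = cis (- (v \<bullet> \<xi>)) * FT h \<xi>" for \<xi>
        using FT_tf_shift[of h v 0 \<xi>] by (simp add: tf_shift_def[abs_def])
      then show "cmod (FT (\<lambda>t. h (t - v)) \<xi>) \<le> C1 * decay (2 * lam + mu) \<xi>" for \<xi>
        using C1 by (simp add: norm_mult)
    qed (use l2 \<Psi>i C2 in auto)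
    also have "\<dots> \<le> A * decay (2 * lam) \<xi>" by (intro mult_right_mono) (auto simp: A_def)
    finally show "cmod (FT (\<lambda>t. h (t - v) * \<Psi> t) \<xi>) \<le> A * (decay lam \<xi>)\<^sup>2" by (simp only: sq)
    \<comment> \<open>The second bound is the L1 norm: decay of \<open>h\<close> at
      \<open>t - v\<close> and of \<Psi> at \<open>t\<close> combine to decay at \<open>v\<close>,
      and the kernel kept in reserve in the bound for \<Psi> makes the integral finite.\<close>
    have "cmod (FT (\<lambda>t. h (t - v) * \<Psi> t) \<xi>) \<le> (LINT t|lborel. cmod (h (t - v) * \<Psi> t))" by (rule norm_FT_le)
    also have "\<dots> \<le> (LINT t|lborel. (Ch * Cp * decay (2 * lam) v) * (1 / (1 + norm (t::real^'n)) ^ (2 * CARD('n))))"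
    proof (rule integral_mono')
      show "integrable lborel (\<lambda>t::real^'n. (Ch * Cp * decay (2 * lam) v) * (1 / (1 + norm t) ^ (2 * CARD('n))))"
        by (rule integrable_mult_right[OF ki])
      fix t :: "real^'n"
      have "cmod (h (t - v) * \<Psi> t) \<le> (Ch * decay (2 * lam) (t - v)) * (Cp * decay (2 * lam) t * (1 / (1 + norm t) ^ (2 * CARD('n))))"
        unfolding norm_mult using pos by (intro mult_mono Ch Cp') auto
      also have "\<dots> = Ch * Cp * (decay (2 * lam) (t - v) * decay (2 * lam) t) * (1 / (1 + norm t) ^ (2 * CARD('n)))"
        by (simp only: mult_ac)
      also have "\<dots> \<le> Ch * Cp * decay (2 * lam) v * (1 / (1 + norm t) ^ (2 * CARD('n)))"
        using pos l2 by (intro mult_right_mono mult_left_mono exp_weight_separate) auto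
      finally show "cmod (h (t - v) * \<Psi> t) \<le> (Ch * Cp * decay (2 * lam) v) * (1 / (1 + norm t) ^ (2 * CARD('n)))" .
    qed (use pos in auto)
    also have "\<dots> = Ch * Cp * I * decay (2 * lam) v"
      by (subst integral_mult_right_zero) (simp only: I_def mult_ac)
    also have "\<dots> \<le> A * decay (2 * lam) v" by (intro mult_right_mono) (auto simp: A_def)
    finally show "cmod (FT (\<lambda>t. h (t - v) * \<Psi> t) \<xi>) \<le> A * (decay lam v)\<^sup>2" by (simp only: sq)
  qed auto
  then show ?thesis using A0 by blast
qed

end

lemma norm_sums_le:
  fixes f :: "nat \<Rightarrow> complex"
  assumes "f sums s" and "\<And>n. (\<Sum>i<n. cmod (f i)) \<le> B"
  shows "cmod s \<le> B"
proof -
  have "(\<lambda>n. cmod (\<Sum>i<n. f i)) \<longlonglongrightarrow> cmod s"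
    using assms(1) unfolding sums_def by (rule tendsto_norm)
  then show ?thesis
    by (rule LIMSEQ_le_const2) (use order_trans[OF norm_sum assms(2)] in blast)
qed

section \<open>Separation of cones\<close>

lemma shrink_open_cone:
  fixes \<Gamma> :: "((real^'n::finite) \<times> (real^'n)) set"
  assumes \<Gamma>: "open_cone \<Gamma>" and z0: "z0 \<in> \<Gamma>"
  shows "\<exists>\<Gamma>' \<epsilon>. open_cone \<Gamma>' \<and> z0 \<in> \<Gamma>' \<and> \<epsilon> > 0 \<and>
     (\<forall>z\<in>\<Gamma>'. \<forall>w. w \<notin> \<Gamma> \<longrightarrow> \<epsilon> * norm z \<le> norm (z - w) \<and> \<epsilon> * norm w \<le> norm (z - w))"
proof -
  have op: "open \<Gamma>" and n0: "0 \<notin> \<Gamma>" and cone: "\<And>z s. z \<in> \<Gamma> \<Longrightarrow> s > 0 \<Longrightarrow> s *\<^sub>R z \<in> \<Gamma>"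
    using \<Gamma> by (auto simp: open_cone_def)
  define e0 where "e0 = inverse (norm z0) *\<^sub>R z0"
  have z0n: "norm z0 > 0" using z0 n0 by auto
  then have "e0 \<in> \<Gamma>" unfolding e0_def by (intro cone z0) auto
  then obtain d where d: "d > 0" "ball e0 d \<subseteq> \<Gamma>" using op open_contains_ball by blast
  define \<delta> where "\<delta> = d / 2"
  have \<delta>: "\<delta> > 0" "2 * \<delta> = d" using d by (auto simp: \<delta>_def)
  \<comment> \<open>Directions within \<delta> of that of \<open>z0\<close>, while directions within
    2 \<delta> stay in \<Gamma>. Scaling by 1 / norm z puts a point \<open>w\<close> outside
    \<Gamma> at distance at least \<delta> from the direction of \<open>z\<close>, so
    \<open>\<delta> * norm z \<le> norm (z - w)\<close>; the triangle inequality adds the bound by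
    \<open>norm w\<close> and changes \<delta> to \<delta> / (1 + \<delta>).\<close>
  define \<Gamma>' where "\<Gamma>' = {z. z \<noteq> 0 \<and> norm (inverse (norm z) *\<^sub>R z - e0) < \<delta>}"
  have "open \<Gamma>'"
  proof -
    have "continuous_on (- {0}) (\<lambda>z::(real^'n) \<times> (real^'n). norm (inverse (norm z) *\<^sub>R z - e0))"
      by (intro continuous_intros) auto
    then have "open ((\<lambda>z. norm (inverse (norm z) *\<^sub>R z - e0)) -` {..<\<delta>} \<inter> - {0})"
      by (subst (asm) continuous_on_open_vimage) auto
    moreover have "(\<lambda>z. norm (inverse (norm z) *\<^sub>R z - e0)) -` {..<\<delta>} \<inter> - {0} = \<Gamma>'"
      by (auto simp: \<Gamma>'_def)
    ultimately show ?thesis by simp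
  qed
  moreover have "0 \<notin> \<Gamma>'" by (simp add: \<Gamma>'_def)
  moreover have "s *\<^sub>R z \<in> \<Gamma>'" if "z \<in> \<Gamma>'" "s > 0" for z s
  proof -
    have "inverse (norm (s *\<^sub>R z)) *\<^sub>R (s *\<^sub>R z) = inverse (norm z) *\<^sub>R z"
      using that(2) by (simp add: field_simps)
    then show ?thesis using that by (simp add: \<Gamma>'_def del: norm_scaleR)
  qed
  ultimately have "open_cone \<Gamma>'" by (auto simp: open_cone_def)
  moreover have "z0 \<in> \<Gamma>'" using z0n \<delta> by (auto simp: \<Gamma>'_def e0_def)
  moreover have "\<delta> / (1 + \<delta>) > 0" using \<delta> by simp
  moreover have "\<delta> / (1 + \<delta>) * norm z \<le> norm (z - w) \<and> \<delta> / (1 + \<delta>) * norm w \<le> norm (z - w)" if z: "z \<in> \<Gamma>'" and w: "w \<notin> \<Gamma>" for z w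
  proof -
    have zn: "norm z > 0" using z by (simp add: \<Gamma>'_def)
    let ?s = "inverse (norm z)"
    have "?s *\<^sub>R w \<notin> \<Gamma>"
    proof
      assume "?s *\<^sub>R w \<in> \<Gamma>"
      from cone[OF this zn] have "norm z *\<^sub>R (?s *\<^sub>R w) \<in> \<Gamma>" .
      then show False using w zn by simp
    qed
    then have "d \<le> norm (?s *\<^sub>R w - e0)" using d(2) by (force simp: dist_norm norm_minus_commute not_less)
    also have "\<dots> \<le> norm (?s *\<^sub>R z - e0) + norm (?s *\<^sub>R (z - w))"
      using norm_triangle_ineq4[of "?s *\<^sub>R z - e0" "?s *\<^sub>R (z - w)"] by (simp add: scaleR_diff_right)
    finally have "\<delta> \<le> norm (?s *\<^sub>R (z - w))" using z \<delta> by (simp add: \<Gamma>'_def)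
    then have "\<delta> \<le> ?s * norm (z - w)" by (simp only: norm_scaleR abs_inverse abs_norm_cancel)
    then have a: "\<delta> * norm z \<le> norm (z - w)" using zn by (simp add: inverse_eq_divide pos_le_divide_eq)
    have "norm w \<le> norm z + norm (z - w)" using norm_triangle_ineq4[of z "z - w"] by simp
    then have "\<delta> * norm w \<le> \<delta> * (norm z + norm (z - w))" using \<delta> by (intro mult_left_mono) auto
    then have b: "\<delta> * norm w \<le> (1 + \<delta>) * norm (z - w)" using a by (simp add: algebra_simps)
    have "0 \<le> \<delta> * norm (z - w)" using \<delta> by simp
    then have "\<delta> * norm z \<le> (1 + \<delta>) * norm (z - w)" using a unfolding distrib_right by linarith
    then show ?thesis using b \<delta> by (simp add: field_simps)
  qed
  ultimately show ?thesis by blast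
qed

context weight
begin

text \<open>Turns linear separation of points into comparability of their weights: with N an integer
  above 1 / \<epsilon>, subadditivity gives \<omega>(N t) \<le> N \<omega>(t).\<close>

lemma weight_separated:
  assumes "\<epsilon> > 0"
  shows "\<exists>N::real. N \<ge> 1 \<and> (\<forall>s t. 0 \<le> s \<longrightarrow> \<epsilon> * s \<le> t \<longrightarrow> \<omega> s \<le> N * \<omega> t)"
proof -
  obtain n :: nat where n: "1 / \<epsilon> \<le> real n" using real_arch_simple by blast
  have "\<omega> s \<le> real (Suc n) * \<omega> t" if "0 \<le> s" "\<epsilon> * s \<le> t" for s t
  proof -
    have t: "t \<ge> 0" using that assms by (meson mult_nonneg_nonneg less_imp_le order_trans)
    have "s \<le> (1 / \<epsilon>) * t" using that assms by (simp add: field_simps)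
    also have "\<dots> \<le> real (Suc n) * t" using n t by (intro mult_right_mono) auto
    finally have "\<omega> s \<le> \<omega> (real (Suc n) * t)" using that by (intro weight_mono)
    also have "\<dots> \<le> real (Suc n) * \<omega> t" by (rule weight_multiple[OF t])
    finally show ?thesis .
  qed
  then show ?thesis by (intro exI[of _ "real (Suc n)"]) auto
qed

text \<open>Joint decay in the translation \<open>v\<close> and the variable. On the space side this
  is the Leibniz rule; on the frequency side the monomial is attached to \<psi>, so that
  \<open>h\<close> keeps its compact support and the geometric mean lemma applies.\<close>

lemma product_estimates:
  fixes h \<psi> :: "real^'n::finite \<Rightarrow> complex"
  assumes h: "h \<in> S_omega \<omega>" and \<psi>: "\<psi> \<in> S_omega \<omega>" and supp: "\<And>t. r < norm t \<Longrightarrow> h t = 0" and lam: "lam > 0"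
  shows "\<exists>C\<ge>0. \<forall>v x. cmod (Dl ks (\<lambda>t. h (t - v) * \<psi> t) x) \<le> C * decay lam v * decay lam x \<and>
     cmod (Dl ks (FT (\<lambda>t. h (t - v) * \<psi> t)) x) \<le> C * decay lam v * decay lam x"
proof -
  have hv: "(\<lambda>t. h (t - v)) \<in> S_omega \<omega>" for v
    using S_omega_tf_shift[OF h, of v 0] by (simp add: tf_shift_def[abs_def])
  have x_side: "\<exists>C\<ge>0. \<forall>v x. cmod (Dl ks (\<lambda>t. h (t - v) * \<psi> t) x) \<le> C * decay lam v * decay lam x"
    if lam: "lam > 0" for lam ks
  proof -
    obtain A where A: "A \<ge> 0" "\<And>a x. length a \<le> length ks \<Longrightarrow> cmod (Dl a h x) \<le> A * decay lam x"
      using S_omega_bound[OF h lam, of "length ks"] by blast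
    \<comment> \<open>Half of the decay of \<psi> combines with that of \<open>h\<close> to give
      decay in \<open>v\<close>, the other half remains as decay in \<open>x\<close>.\<close>
    have "2 * lam > 0" using lam by simp
    then obtain B where B: "B \<ge> 0" "\<And>a x. length a \<le> length ks \<Longrightarrow> cmod (Dl a \<psi> x) \<le> B * decay (2 * lam) x"
      using S_omega_bound[OF \<psi>, of "2 * lam" "length ks"] by blast
    have "cmod (Dl ks (\<lambda>t. h (t - v) * \<psi> t) x) \<le> 2 ^ length ks * A * B * decay lam v * decay lam x" for v x
    proof -
      have "cmod (Dl ks (\<lambda>t. h (t - v) * \<psi> t) x) \<le> 2 ^ length ks * ((A * decay lam (x - v)) * (B * decay (2 * lam) x))"
        by (rule Dl_mult_bound[OF S_omega_partially_smooth[OF hv] S_omega_partially_smooth[OF \<psi>]])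
          (auto simp: Dl_translate intro: A B)
      also have "\<dots> = 2 ^ length ks * A * B * ((decay lam (x - v) * decay lam x) * decay lam x)"
        by (simp add: mult_ac flip: exp_add)
      also have "\<dots> \<le> 2 ^ length ks * A * B * (decay lam v * decay lam x)"
        using A B lam by (intro mult_left_mono mult_right_mono exp_weight_separate) auto
      finally show ?thesis by (simp only: mult.assoc)
    qed
    then show ?thesis using A B by (intro exI[of _ "2 ^ length ks * A * B"]) auto
  qed
  have rd: "rapidly_decreasing (\<lambda>t. h (t - v) * \<psi> t)" for v
  proof (rule rapidly_decreasingI)
    show "continuous_on UNIV (\<lambda>t. h (t - v) * \<psi> t)"
      by (intro continuous_on_mult S_omega_continuous hv \<psi>)
    show "\<exists>C. \<forall>x. cmod (h (x - v) * \<psi> x) \<le> C * decay lam x" if "lam > 0" for lam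
      using x_side[OF that, of "[]"] by auto
  qed
  have mm: "monomial_mult ks (\<lambda>t. h (t - v) * \<psi> t) = (\<lambda>t. h (t - v) * monomial_mult ks \<psi> t)" for v
    by (simp add: monomial_mult_def fun_eq_iff)
  have \<psi>r: "rapidly_decreasing (monomial_mult ks \<psi>)"
    by (intro rapidly_decreasing_monomial_mult S_omega_rapidly_decreasing \<psi>)
  have "\<exists>C\<ge>0. \<forall>v \<xi>. cmod (FT (\<lambda>t. h (t - v) * monomial_mult ks \<psi> t) \<xi>) \<le> C * (decay lam v * decay lam \<xi>)"
  proof (rule FT_translate_product[OF S_omega_continuous[OF h] supp _ _ _ _ _ lam])
    show "\<exists>C. \<forall>\<xi>. cmod (FT h \<xi>) \<le> C * decay lam \<xi>" "\<exists>C. \<forall>t. cmod (h t) \<le> C * decay lam t" if "lam > 0" for lam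
      using S_omega_bound0[OF h that] by blast+
    show "monomial_mult ks \<psi> \<in> borel_measurable borel" using \<psi>r by (simp add: rapidly_decreasing_def)
    show "\<exists>C. \<forall>\<xi>. cmod (FT (monomial_mult ks \<psi>) \<xi>) \<le> C * decay lam \<xi>" if "lam > 0" for lam
      using \<psi> that unfolding Dl_FT[OF S_omega_rapidly_decreasing[OF \<psi>], symmetric] S_omega_iff by blast
    fix lam :: real assume lam: "lam > 0"
    obtain lam0 K where l0: "lam0 > 0" "K > 0" and K: "\<And>t. t \<ge> 0 \<Longrightarrow> (1 + t) ^ (2 * CARD('n) + length ks) \<le> K * exp (lam0 * \<omega> t)"
      using power_le_exp_weight by metis
    have "lam + lam0 > 0" using lam l0 by simp
    then obtain C where C: "C \<ge> 0" "\<And>x. cmod (\<psi> x) \<le> C * decay (lam + lam0) x"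
      using S_omega_bound0[OF \<psi>] by blast
    have "(1 + norm t) ^ (2 * CARD('n)) * cmod (monomial_mult ks \<psi> t) \<le> K * C * decay lam t" for t
    proof -
      have "(1 + norm t) ^ (2 * CARD('n)) * cmod (monomial_mult ks \<psi> t) \<le> (1 + norm t) ^ (2 * CARD('n)) * ((1 + norm t) ^ length ks * cmod (\<psi> t))"
        by (intro mult_left_mono norm_monomial_mult) simp
      also have "\<dots> = (1 + norm t) ^ (2 * CARD('n) + length ks) * cmod (\<psi> t)" by (simp add: power_add)
      also have "\<dots> \<le> (K * exp (lam0 * \<omega> (norm t))) * (C * decay (lam + lam0) t)"
        using l0 by (intro mult_mono K C) auto
      also have "\<dots> = K * C * decay lam t"
      proof -
        have "exp (lam0 * \<omega> (norm t)) * decay (lam + lam0) t = decay lam t"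
          by (simp add: exp_add[symmetric] algebra_simps)
        then show ?thesis by (simp add: mult_ac)
      qed
      finally show ?thesis .
    qed
    then show "\<exists>C. \<forall>t. (1 + norm t) ^ (2 * CARD('n)) * cmod (monomial_mult ks \<psi> t) \<le> C * decay lam t" by blast
  qed
  then obtain C2 where C2: "C2 \<ge> 0" "\<And>v \<xi>. cmod (Dl ks (FT (\<lambda>t. h (t - v) * \<psi> t)) \<xi>) \<le> C2 * decay lam v * decay lam \<xi>"
    unfolding Dl_FT[OF rd] mm by (auto simp: mult.assoc)
  obtain C1 where C1: "C1 \<ge> 0" "\<And>v x. cmod (Dl ks (\<lambda>t. h (t - v) * \<psi> t) x) \<le> C1 * decay lam v * decay lam x"
    using x_side[OF lam] by blast
  have le: "C * E1 * E2 \<le> (C1 + C2) * E1 * E2" if "C \<le> C1 + C2" "E1 \<ge> 0" "E2 \<ge> 0" for C E1 E2 :: real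
    using that by (intro mult_right_mono) auto
  show ?thesis
    using C1 C2 by (intro exI[of _ "C1 + C2"] conjI allI order_trans[OF C1(2) le] order_trans[OF C2(2) le]) auto
qed

lemma S_omega_product:
  fixes h \<psi> :: "real^'n::finite \<Rightarrow> complex"
  assumes h: "h \<in> S_omega \<omega>" and \<psi>: "\<psi> \<in> S_omega \<omega>" and supp: "\<And>t. r < norm t \<Longrightarrow> h t = 0"
  shows "(\<lambda>t. h (t - v) * \<psi> t) \<in> S_omega \<omega>"
    and "lam > 0 \<Longrightarrow> Lam > 0 \<Longrightarrow> \<exists>C\<ge>0. \<forall>v. semi \<omega> lam ks (\<lambda>t. h (t - v) * \<psi> t) \<le> C * decay Lam v"
proof -
  have hv: "(\<lambda>t. h (t - v)) \<in> S_omega \<omega>" for v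
    using S_omega_tf_shift[OF h, of v 0] by (simp add: tf_shift_def[abs_def])
  show "(\<lambda>t. h (t - v) * \<psi> t) \<in> S_omega \<omega>"
    unfolding S_omega_iff
  proof (intro conjI allI impI)
    show "Dl ks (\<lambda>t. h (t - v) * \<psi> t) differentiable at x" for ks x
      by (intro Dl_mult_differentiable S_omega_differentiable hv \<psi>)
    fix lam :: real and ks assume "lam > 0"
    from product_estimates[OF h \<psi> supp this, of r ks]
    show "\<exists>C. \<forall>x. cmod (Dl ks (\<lambda>t. h (t - v) * \<psi> t) x) \<le> C * decay lam x"
      "\<exists>C. \<forall>x. cmod (Dl ks (FT (\<lambda>t. h (t - v) * \<psi> t)) x) \<le> C * decay lam x" by blast+
  qed
  assume lam: "lam > 0" and Lam: "Lam > 0"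
  define l where "l = max lam Lam"
  have l: "l > 0" "lam \<le> l" "Lam \<le> l" using lam by (auto simp: l_def)
  obtain C where C: "C \<ge> 0" and b: "\<And>v x. cmod (Dl ks (\<lambda>t. h (t - v) * \<psi> t) x) \<le> C * decay l v * decay l x"
     "\<And>v x. cmod (Dl ks (FT (\<lambda>t. h (t - v) * \<psi> t)) x) \<le> C * decay l v * decay l x"
    using product_estimates[OF h \<psi> supp l(1), of r ks] by blast
  have le: "C * decay l v * decay l x \<le> C * decay Lam v * decay lam x" for v x :: "real^'n"
    using C l by (intro mult_mono) (auto intro!: mult_right_mono)
  have "semi \<omega> lam ks (\<lambda>t. h (t - v) * \<psi> t) \<le> 2 * C * decay Lam v" for v
    using semi_le[OF order_trans[OF b(1) le] order_trans[OF b(2) le]] by (simp add: mult.assoc)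
  then show "\<exists>C\<ge>0. \<forall>v. semi \<omega> lam ks (\<lambda>t. h (t - v) * \<psi> t) \<le> C * decay Lam v"
    using C by (intro exI[of _ "2 * C"]) auto
qed

text \<open>Both wave front conditions have this form: for one \<open>S\<close> is a cone, for the
  other its intersection with the sampling points.\<close>

definition rapid_decay_on :: "((real^'n::finite) \<times> (real^'n)) set \<Rightarrow> (((real^'n) \<times> (real^'n)) \<Rightarrow> complex) \<Rightarrow> bool" where
  "rapid_decay_on S V \<longleftrightarrow> (\<forall>lam>0. \<exists>C. \<forall>z\<in>S. exp (lam * \<omega> (norm z)) * cmod (V z) \<le> C)"

lemma STFT_growth:
  fixes u :: "(real^'n::finite \<Rightarrow> complex) \<Rightarrow> complex"
  assumes u: "u \<in> S_dual \<omega>" and f: "f \<in> S_omega \<omega>"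
  shows "\<exists>C mu. C \<ge> 0 \<and> mu > 0 \<and> (\<forall>z. cmod (STFT f u z) \<le> C * exp (mu * \<omega> (norm z)))"
proof -
  obtain C mu where C: "C \<ge> 0" "mu > 0" and b: "\<And>x \<xi>. cmod (u (tf_shift x \<xi> f)) \<le> C * exp (mu * (\<omega> (norm x) + \<omega> (norm \<xi>)))"
    using S_dual_growth[OF u f] by blast
  have "cmod (STFT f u z) \<le> C * exp (2 * mu * \<omega> (norm z))" for z
  proof -
    obtain x \<xi> where z: "z = (x, \<xi>)" by (cases z)
    have "\<omega> (norm x) \<le> \<omega> (norm z)" "\<omega> (norm \<xi>) \<le> \<omega> (norm z)"
      unfolding z by (auto intro!: weight_mono norm_fst_le norm_snd_le)
    then have "mu * (\<omega> (norm x) + \<omega> (norm \<xi>)) \<le> mu * (2 * \<omega> (norm z))" using C by (intro mult_left_mono) auto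
    then have "C * exp (mu * (\<omega> (norm x) + \<omega> (norm \<xi>))) \<le> C * exp (2 * mu * \<omega> (norm z))" using C by (intro mult_left_mono) auto
    then show ?thesis using b[of x \<xi>] by (simp add: STFT_def z)
  qed
  then show ?thesis using C by (intro exI[of _ C] exI[of _ "2 * mu"]) auto
qed

text \<open>A kernel that decays fast enough off the diagonal transfers decay to a smaller cone: inside
  \<open>\<Gamma>\<close> the decay of \<open>V\<close> is used, outside of it the points are separated.\<close>

lemma cone_transfer:
  fixes V :: "((real^'n::finite) \<times> (real^'n)) \<Rightarrow> complex"
  assumes V: "rapid_decay_on (\<Gamma> \<inter> T) V" and grow: "D \<ge> 0" "nu > 0" "\<And>z. cmod (V z) \<le> D * exp (nu * \<omega> (norm z))"
    and \<epsilon>: "\<epsilon> > 0" "\<And>z w. z \<in> \<Gamma>' \<Longrightarrow> w \<notin> \<Gamma> \<Longrightarrow> \<epsilon> * norm z \<le> norm (z - w) \<and> \<epsilon> * norm w \<le> norm (z - w)"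
    and lam: "lam > 0" and mu: "mu > 0"
  shows "\<exists>Lam C. Lam > 0 \<and> C \<ge> 0 \<and> (\<forall>z\<in>\<Gamma>'. \<forall>w\<in>T. exp (lam * \<omega> (norm z)) * decay Lam (z - w) * cmod (V w)
      \<le> C * decay mu w \<and>
    exp (lam * \<omega> (norm z)) * decay Lam (z - w) * cmod (V w) \<le> C * decay mu (z - w))"
proof -
  obtain N where N: "N \<ge> 1" "\<And>s t. 0 \<le> s \<Longrightarrow> \<epsilon> * s \<le> t \<Longrightarrow> \<omega> s \<le> N * \<omega> t" using weight_separated[OF \<epsilon>(1)] by blast
  have "lam + mu > 0" using lam mu by simp
  then obtain C where C: "\<And>w. w \<in> \<Gamma> \<inter> T \<Longrightarrow> exp ((lam + mu) * \<omega> (norm w)) * cmod (V w) \<le> C" using V unfolding rapid_decay_on_def by blast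
  \<comment> \<open>Outside \<Gamma> the weights of \<open>z\<close> and \<open>w\<close> are at
    most \<open>N\<close> times that of \<open>z - w\<close>, so the off-diagonal decay must pay
    \<open>lam\<close> for the weight at \<open>z\<close>, \<open>nu\<close> for the growth of
    \<open>V\<close> and \<open>mu\<close> for the decay to be kept, each multiplied by
    \<open>N\<close>. Inside \<Gamma> already \<open>lam + mu\<close> suffices.\<close>
  define Lam where "Lam = N * (lam + nu + mu)"
  have Lam: "Lam > 0" "lam + mu \<le> Lam"
  proof -
    show "Lam > 0" using N lam grow mu by (simp add: Lam_def)
    have "1 * (lam + mu) \<le> N * (lam + nu + mu)" using N lam grow mu by (intro mult_mono) auto
    then show "lam + mu \<le> Lam" by (simp add: Lam_def)
  qed
  let ?C = "\<bar>C\<bar> + D"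
  \<comment> \<open>Two bounds are recorded because the applications sum differently: decay in
    \<open>w\<close> is summed over all Gabor points, decay in \<open>z - w\<close> over meshes that
    tend to 0.\<close>
  have "exp (lam * \<omega> (norm z)) * decay Lam (z - w) * cmod (V w) \<le> ?C * decay mu w \<and>
    exp (lam * \<omega> (norm z)) * decay Lam (z - w) * cmod (V w) \<le> ?C * decay mu (z - w)"
    if z: "z \<in> \<Gamma>'" and wT: "w \<in> T" for z w
  proof -
    define a b d where "a = \<omega> (norm z)" and "b = \<omega> (norm w)" and "d = \<omega> (norm (z - w))"
    have nn: "a \<ge> 0" "b \<ge> 0" "d \<ge> 0" by (auto simp: a_def b_def d_def)
    show ?thesis
    proof (cases "w \<in> \<Gamma>")
      case True
      have ab: "a \<le> d + b" unfolding a_def b_def d_def by (rule weight_norm_diff)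
      have Vb: "cmod (V w) \<le> \<bar>C\<bar> * exp (- ((lam + mu) * b))"
      proof -
        have *: "exp X * y \<le> C \<Longrightarrow> y \<le> \<bar>C\<bar> * exp (- X)" for X y :: real
          by (simp add: exp_minus field_simps)
        show ?thesis using C[of w] True wT unfolding b_def by (intro *) auto
      qed
      have lam_ab: "lam * a \<le> lam * (d + b)" using ab lam by (intro mult_left_mono) auto
      have Ld: "(lam + mu) * d \<le> Lam * d" using Lam nn by (intro mult_right_mono) auto
      have "exp (lam * a) * exp (- (Lam * d)) * cmod (V w) \<le> exp (lam * a) * exp (- (Lam * d)) * (\<bar>C\<bar> * exp (- ((lam + mu) * b)))"
        by (intro mult_left_mono Vb) auto
      also have "\<dots> = \<bar>C\<bar> * exp (lam * a - Lam * d - (lam + mu) * b)"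
        by (simp add: exp_diff exp_minus field_simps flip: exp_add)
      also have "\<dots> \<le> ?C * exp (- (mu * b + mu * d))"
        using lam_ab Ld grow(1) by (intro mult_mono) (auto simp: algebra_simps)
      finally have *: "exp (lam * a) * exp (- (Lam * d)) * cmod (V w) \<le> ?C * exp (- (mu * b + mu * d))" .
      have "?C * exp (- (mu * b + mu * d)) \<le> ?C * exp (- (mu * b))" "?C * exp (- (mu * b + mu * d)) \<le> ?C * exp (- (mu * d))"
        using mu nn grow(1) by (auto intro!: mult_left_mono)
      then show ?thesis using * unfolding a_def b_def d_def by linarith
    next
      case False
      have a: "a \<le> N * d" and b: "b \<le> N * d"
        unfolding a_def b_def d_def using \<epsilon>(2)[OF z False] by (auto intro: N(2))
      have "exp (lam * a) * exp (- (Lam * d)) * cmod (V w) \<le> exp (lam * a) * exp (- (Lam * d)) * (D * exp (nu * b))"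
        by (intro mult_left_mono) (auto simp: b_def grow)
      also have "\<dots> = D * exp (lam * a - Lam * d + nu * b)"
        by (simp add: exp_diff exp_add exp_minus field_simps)
      also have "\<dots> \<le> ?C * exp (- (mu * (N * d)))"
      proof -
        have "lam * a \<le> lam * (N * d)" "nu * b \<le> nu * (N * d)" using a b lam grow by (auto intro!: mult_left_mono)
        then show ?thesis using grow(1) by (intro mult_mono) (auto simp: Lam_def algebra_simps)
      qed
      finally have *: "exp (lam * a) * exp (- (Lam * d)) * cmod (V w) \<le> ?C * exp (- (mu * (N * d)))" .
      have "d \<le> N * d" using N(1) nn mult_right_mono[of 1 N d] by simp
      then have "?C * exp (- (mu * (N * d))) \<le> ?C * exp (- (mu * b))" "?C * exp (- (mu * (N * d))) \<le> ?C * exp (- (mu * d))"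
        using mu b grow(1) by (auto intro!: mult_left_mono)
      then show ?thesis using * unfolding a_def b_def d_def by linarith
    qed
  qed
  then show ?thesis using Lam grow(1) by (intro exI[of _ Lam] exI[of _ ?C]) auto
qed

section \<open>Changing the window\<close>

text \<open>For fixed \<open>z\<close> the functional is applied to a periodization of the
  translated \<open>h\<close> times the shifted \<psi> in two ways. As a series of modulations it
  yields values of the transform with window \<psi> on the frequency line through \<open>z\<close>,
  bounded uniformly in the mesh. As a series of translates it yields the desired value plus aliasing
  terms, which vanish as the period grows. The aliasing constant may depend on \<open>z\<close>, the
  first bound may not.\<close>

lemma STFT_product_decay:
  fixes u :: "(real^'n::finite \<Rightarrow> complex) \<Rightarrow> complex"
  assumes u: "u \<in> S_dual \<omega>" and h: "h \<in> S_omega \<omega>" and \<psi>: "\<psi> \<in> S_omega \<omega>"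
    and supp: "\<And>t. r < norm t \<Longrightarrow> h t = 0"
    and V: "rapid_decay_on \<Gamma> (STFT \<psi> u)"
    and \<epsilon>: "\<epsilon> > 0" "\<And>z w. z \<in> \<Gamma>' \<Longrightarrow> w \<notin> \<Gamma> \<Longrightarrow> \<epsilon> * norm z \<le> norm (z - w) \<and> \<epsilon> * norm w \<le> norm (z - w)"
  shows "rapid_decay_on \<Gamma>' (STFT (\<lambda>t. h t * \<psi> t) u)"
  unfolding rapid_decay_on_def
proof (intro allI impI)
  fix lam :: real assume lam: "lam > 0"
  let ?d = "CARD('n)"
  obtain mu K where mu: "mu > 0" and K0: "K > 0"
    and K: "\<And>x::real^'n. decay mu x \<le> K / (1 + norm x) ^ (2 * ?d)"
    using kernel_weight by blast
  \<comment> \<open>One power more than the summation over translates needs; the surplus produces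
    the factor 1 / (1 + L) in the aliasing error.\<close>
  obtain mu3 K3 where mu3: "mu3 > 0" and K3: "K3 > 0" "\<And>t. t \<ge> 0 \<Longrightarrow> exp (- (mu3 * \<omega> t)) \<le> K3 / (1 + t) ^ (2 * ?d + 1)"
    using exp_weight_le_inverse_power by metis
  obtain D nu where gr: "D \<ge> 0" "nu > 0" "\<And>z. cmod (STFT \<psi> u z) \<le> D * exp (nu * \<omega> (norm z))"
    using STFT_growth[OF u \<psi>] by blast
  have V': "rapid_decay_on (\<Gamma> \<inter> UNIV) (STFT \<psi> u)" using V by simp
  obtain Lam C where Lam: "Lam > 0" and C: "C \<ge> 0"
    and ct: "\<And>z w. z \<in> \<Gamma>' \<Longrightarrow> exp (lam * \<omega> (norm z)) * decay Lam (z - w) * cmod (STFT \<psi> u w) \<le> C * decay mu (z - w)"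
    using cone_transfer[OF V' gr \<epsilon> lam mu] by (metis UNIV_I)
  obtain C1 where C1: "C1 \<ge> 0" "\<And>\<eta>. cmod (FT h \<eta>) \<le> C1 * decay Lam \<eta>"
    using S_omega_bound0[OF h Lam] by blast
  obtain Cu Nu lu where Cu: "Cu \<ge> 0" and lu: "lu > 0"
    and ub: "\<And>f. f \<in> S_omega \<omega> \<Longrightarrow> cmod (u f) \<le> Cu * (\<Sum>ks\<in>{ks. length ks \<le> Nu}. semi \<omega> lu ks f)"
    using S_dual_bound[OF u] by blast
  obtain e :: "nat \<Rightarrow> int^'n" where e: "bij e" using int_vec_enum by blast
  obtain i0 where i0: "\<And>i. e i = 0 \<longleftrightarrow> i = i0" using e by (metis bij_pointE)
  define B where "B = C1 * C * K * (3 / (2 * pi)) ^ ?d"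
  have "exp (lam * \<omega> (norm z)) * cmod (STFT (\<lambda>t. h t * \<psi> t) u z) \<le> B" if z\<Gamma>: "z \<in> \<Gamma>'" for z
  proof -
    obtain x \<xi> where z: "z = (x, \<xi>)" by (cases z)
    define W where "W = exp (lam * \<omega> (norm z))"
    have W0: "W > 0" by (simp add: W_def)
    define h' where "h' t = h (t - x)" for t
    define \<psi>' where "\<psi>' = tf_shift x \<xi> \<psi>"
    have h'S: "h' \<in> S_omega \<omega>"
      using S_omega_tf_shift[OF h, of x 0] by (simp add: tf_shift_def[abs_def] h'_def[abs_def])
    have \<psi>'S: "\<psi>' \<in> S_omega \<omega>" unfolding \<psi>'_def by (rule S_omega_tf_shift[OF \<psi>])
    have supp': "h' t = 0" if "r + norm x < norm t" for t
      using supp[of "t - x"] norm_triangle_sub[of t x] that by (simp add: h'_def)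
    have gS: "(\<lambda>t. h' (t - v) * \<psi>' t) \<in> S_omega \<omega>" for v
      by (rule S_omega_product(1)[OF h'S \<psi>'S supp'])
    have FTh': "cmod (FT h' \<eta>) = cmod (FT h \<eta>)" for \<eta>
      using FT_tf_shift[OF S_omega_measurable[OF h], of x 0 \<eta>] by (simp add: tf_shift_def[abs_def] h'_def[abs_def] norm_mult)
    have "\<forall>ks. \<exists>C\<ge>0. \<forall>v. semi \<omega> lu ks (\<lambda>t. h' (t - v) * \<psi>' t) \<le> C * decay mu3 v"
      using S_omega_product(2)[OF h'S \<psi>'S supp' lu mu3] by blast
    then obtain Cs where Cs: "\<And>ks. Cs ks \<ge> 0" "\<And>ks v. semi \<omega> lu ks (\<lambda>t. h' (t - v) * \<psi>' t) \<le> Cs ks * decay mu3 v"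
      by metis
    define E where "E = Cu * (\<Sum>ks\<in>{ks. length ks \<le> Nu}. Cs ks)"
    have E0: "E \<ge> 0" using Cu Cs(1) by (simp add: E_def sum_nonneg)
    have uE: "cmod (u (\<lambda>t. h' (t - v) * \<psi>' t)) \<le> E * decay mu3 v" for v
    proof -
      have "cmod (u (\<lambda>t. h' (t - v) * \<psi>' t)) \<le> Cu * (\<Sum>ks\<in>{ks. length ks \<le> Nu}. semi \<omega> lu ks (\<lambda>t. h' (t - v) * \<psi>' t))"
        by (rule ub[OF gS])
      also have "\<dots> \<le> Cu * (\<Sum>ks\<in>{ks. length ks \<le> Nu}. Cs ks * decay mu3 v)"
        by (intro mult_left_mono sum_mono Cs Cu)
      finally show ?thesis by (simp add: E_def sum_distrib_right mult.assoc)
    qed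
    \<comment> \<open>The constant \<open>E\<close> depends on \<open>z\<close>, but it is
      multiplied by a quantity that tends to 0 with \<open>k\<close>; the bound \<open>B\<close>
      that survives depends on neither.\<close>
    have main: "W * cmod (u (\<lambda>t. h' t * \<psi>' t)) \<le> B + W * (E * K3 * 3 ^ ?d / (1 + 2 * pi / k))" if k: "0 < k" "k \<le> 1" for k
    proof -
      define L where "L = 2 * pi / k"
      have L1: "L \<ge> 1"
      proof -
        have "1 \<le> 2 * pi" using pi_ge_two by simp
        also have "\<dots> \<le> 2 * pi / k" using k by (simp add: pos_le_divide_eq mult_left_le)
        finally show ?thesis by (simp add: L_def)
      qed
      let ?\<eta> = "\<lambda>i. k *\<^sub>R ivec (e i)"
      define P where "P t = (\<Sum>\<^sub>\<infinity>l. h' (t + L *\<^sub>R ivec l))" for t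
      define c where "c i = of_real ((k / (2 * pi)) ^ ?d) * FT h' (?\<eta> i)" for i
      obtain Cmu where Cmu: "\<And>\<eta>. cmod (FT h' \<eta>) \<le> Cmu * decay mu \<eta>"
        using S_omega_bound0[OF h'S mu] by blast
      note per = periodization[OF K S_omega_continuous[OF h'S] supp' Cmu k(1) e]
      have cn: "cmod (c i) = (k / (2 * pi)) ^ ?d * cmod (FT h (?\<eta> i))" for i
        using k by (simp add: c_def norm_mult norm_power norm_divide FTh')
      \<comment> \<open>The frequency expansion of the periodized product. The coefficients decay
        fast enough to beat the growth of the seminorms of the modulated windows.\<close>
      have a: "(\<lambda>i. cnj (c i) * u (tf_shift 0 (?\<eta> i) \<psi>')) sums u (\<lambda>t. P t * \<psi>' t)"
      proof (rule S_dual_cseries[OF u S_omega_tf_shift[OF \<psi>'S]])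
        show "(\<lambda>i. c i * tf_shift 0 (?\<eta> i) \<psi>' t) sums (P t * \<psi>' t)" for t
          using sums_mult2[OF per(2)[where t = t], where c = "\<psi>' t"]
          by (simp add: tf_shift_def c_def P_def L_def inner_commute mult.assoc)
        fix l :: real and ks :: "'n list" assume l: "l > 0"
        obtain C' mu' where C': "C' \<ge> 0" "mu' > 0" and s: "\<And>x \<xi>. semi \<omega> l ks (tf_shift x \<xi> \<psi>') \<le> C' * exp (mu' * (\<omega> (norm x) + \<omega> (norm \<xi>)))"
          using semi_tf_shift[OF \<psi>'S l, of "length ks"] by blast
        have "mu' + mu > 0" using C' mu by simp
        then obtain C2 where C2: "C2 \<ge> 0" "\<And>\<eta>. cmod (FT h \<eta>) \<le> C2 * decay (mu' + mu) \<eta>"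
          using S_omega_bound0[OF h] by blast
        let ?M = "(k / (2 * pi)) ^ ?d * C2 * C' * exp (mu' * \<omega> 0) * K"
        show "summable (\<lambda>i. cmod (c i) * semi \<omega> l ks (tf_shift 0 (?\<eta> i) \<psi>'))"
        proof (rule summable_comparison_test'[OF summable_mult[OF summable_on_enum[OF e lattice_summable[OF k(1)]], of ?M], of 0])
          fix i
          let ?x = "\<omega> (norm (?\<eta> i))"
          have "cmod (c i) * semi \<omega> l ks (tf_shift 0 (?\<eta> i) \<psi>') \<le> ((k / (2 * pi)) ^ ?d * (C2 * exp (- ((mu' + mu) * ?x)))) * (C' * exp (mu' * (\<omega> (norm (0::real^'n)) + ?x)))"
            unfolding cn using k C2 C' by (intro mult_mono s mult_left_mono C2(2) semi_ge(3) S_omega_tf_shift \<psi>'S l) auto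
          also have "\<dots> = (k / (2 * pi)) ^ ?d * C2 * C' * exp (mu' * \<omega> 0) * exp (- (mu * ?x))"
          proof -
            have "exp (- ((mu' + mu) * ?x)) * exp (mu' * (\<omega> (norm (0::real^'n)) + ?x)) = exp (mu' * \<omega> 0) * exp (- (mu * ?x))"
              unfolding exp_add[symmetric] by (simp add: algebra_simps)
            then show ?thesis by (simp only: mult_ac)
          qed
          also have "\<dots> \<le> (k / (2 * pi)) ^ ?d * C2 * C' * exp (mu' * \<omega> 0) * (K / (1 + norm (?\<eta> i)) ^ (2 * ?d))"
            using k C2 C' by (intro mult_left_mono K) auto
          finally show "norm (cmod (c i) * semi \<omega> l ks (tf_shift 0 (?\<eta> i) \<psi>')) \<le> ?M * (1 / (1 + norm (?\<eta> i)) ^ (2 * ?d))"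
            using semi_ge(3)[OF S_omega_tf_shift[OF \<psi>'S] l, of ks 0 "?\<eta> i"] by simp
        qed
      qed
      have b: "W * cmod (u (\<lambda>t. P t * \<psi>' t)) \<le> B"
      proof -
        have "(\<Sum>i<n. cmod (cnj (c i) * u (tf_shift 0 (?\<eta> i) \<psi>'))) \<le> B / W" for n
        proof -
          have t: "W * cmod (cnj (c i) * u (tf_shift 0 (?\<eta> i) \<psi>')) \<le> (C1 * C * K / (2 * pi) ^ ?d) * (k ^ ?d / (1 + norm (?\<eta> i)) ^ (2 * ?d))" for i
          proof -
            let ?w = "(x, \<xi> + ?\<eta> i)"
            have tf: "tf_shift 0 (?\<eta> i) \<psi>' = tf_shift x (\<xi> + ?\<eta> i) \<psi>"
              by (simp add: tf_shift_def fun_eq_iff \<psi>'_def inner_add_right cis_mult[symmetric] mult_ac)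
            have zw: "norm (z - ?w) = norm (?\<eta> i)" by (simp add: z norm_Pair)
            have "W * cmod (cnj (c i) * u (tf_shift 0 (?\<eta> i) \<psi>')) = (k / (2 * pi)) ^ ?d * (W * cmod (FT h (?\<eta> i)) * cmod (STFT \<psi> u ?w))"
              by (simp only: norm_mult complex_mod_cnj cn tf STFT_def fst_conv snd_conv mult_ac)
            also have "\<dots> \<le> (k / (2 * pi)) ^ ?d * (W * (C1 * decay Lam (?\<eta> i)) * cmod (STFT \<psi> u ?w))"
              using k W0 by (intro mult_left_mono mult_right_mono C1) auto
            also have "\<dots> = (k / (2 * pi)) ^ ?d * C1 * (W * decay Lam (z - ?w) * cmod (STFT \<psi> u ?w))"
              unfolding zw by (simp only: mult_ac)
            also have "\<dots> \<le> (k / (2 * pi)) ^ ?d * C1 * (C * decay mu (z - ?w))"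
              unfolding W_def using k C1 by (intro mult_left_mono ct z\<Gamma>) auto
            also have "\<dots> \<le> (k / (2 * pi)) ^ ?d * C1 * (C * (K / (1 + norm (?\<eta> i)) ^ (2 * ?d)))"
              unfolding zw using k C1 C by (intro mult_left_mono K) auto
            finally show ?thesis by (simp add: power_divide mult_ac)
          qed
          have "W * (\<Sum>i<n. cmod (cnj (c i) * u (tf_shift 0 (?\<eta> i) \<psi>'))) \<le> (\<Sum>i<n. (C1 * C * K / (2 * pi) ^ ?d) * (k ^ ?d / (1 + norm (?\<eta> i)) ^ (2 * ?d)))"
            unfolding sum_distrib_left by (intro sum_mono t)
          also have "\<dots> \<le> (C1 * C * K / (2 * pi) ^ ?d) * 3 ^ ?d"
            unfolding sum_distrib_left[symmetric] using C1 C K0 by (intro mult_left_mono lattice_sum_enum_le k e) auto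
          also have "\<dots> = B" by (simp add: B_def power_divide)
          finally show ?thesis using W0 by (simp add: field_simps)
        qed
        from norm_sums_le[OF a this] show ?thesis using W0 by (simp add: field_simps)
      qed
      define v where "v i = - (L *\<^sub>R ivec (e i))" for i
      have vn: "norm (v i) = norm (L *\<^sub>R ivec (e i))" for i by (simp add: v_def)
      \<comment> \<open>The expansion of the same function into translates of
        \<open>h'\<close>.\<close>
      have s: "(\<lambda>i. u (\<lambda>t. h' (t - v i) * \<psi>' t)) sums u (\<lambda>t. P t * \<psi>' t)"
      proof (rule S_dual_series[OF u gS])
        show "(\<lambda>i. h' (t - v i) * \<psi>' t) sums (P t * \<psi>' t)" for t
        proof (rule sums_mult2)
          have "finite {l. h' (t + L *\<^sub>R ivec l) \<noteq> 0}" using per(1)[where t = t] by (simp add: L_def)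
          then have "(\<lambda>l. h' (t + L *\<^sub>R ivec l)) summable_on UNIV"
            by (rule summable_on_cong_neutral[THEN iffD1, rotated -1, OF summable_on_finite]) auto
          from has_sum_enum[OF e has_sum_infsum[OF this]]
          show "(\<lambda>i. h' (t - v i)) sums P t" by (simp add: v_def P_def)
        qed
        fix l :: real and ks :: "'n list" assume l: "l > 0"
        obtain C' where C': "C' \<ge> 0" "\<And>v. semi \<omega> l ks (\<lambda>t. h' (t - v) * \<psi>' t) \<le> C' * decay mu v"
          using S_omega_product(2)[OF h'S \<psi>'S supp' l mu] by blast
        have L0: "L > 0" using L1 by simp
        show "summable (\<lambda>i. semi \<omega> l ks (\<lambda>t. h' (t - v i) * \<psi>' t))"
        proof (rule summable_comparison_test'[OF summable_mult[OF summable_on_enum[OF e lattice_summable[OF L0]], of "C' * K"], of 0])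
          fix i
          have "semi \<omega> l ks (\<lambda>t. h' (t - v i) * \<psi>' t) \<le> C' * decay mu (v i)" by (rule C')
          also have "\<dots> \<le> C' * (K / (1 + norm (v i)) ^ (2 * ?d))" by (intro mult_left_mono K C')
          finally show "norm (semi \<omega> l ks (\<lambda>t. h' (t - v i) * \<psi>' t)) \<le> C' * K * (1 / (1 + norm (L *\<^sub>R ivec (e i))) ^ (2 * ?d))"
            using semi_ge(3)[OF gS[of "v i"] l, of ks] by (simp add: vn)
        qed
      qed
      let ?a = "\<lambda>i. u (\<lambda>t. h' (t - v i) * \<psi>' t)"
      have vi0: "v i0 = 0" using i0[of i0] by (simp add: v_def)
      \<comment> \<open>Index \<open>i0\<close>, where the translation is 0, carries the wanted
        value; removing it leaves the aliasing terms, all translated by at least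
        \<open>L\<close>.\<close>
      have s': "(\<lambda>i. ?a i - (if i = i0 then ?a i0 else 0)) sums (u (\<lambda>t. P t * \<psi>' t) - ?a i0)"
        using sums_diff[OF s sums_single[of i0 "\<lambda>_. ?a i0"]] by (simp add: if_distrib cong: if_cong)
      have "cmod (u (\<lambda>t. P t * \<psi>' t) - ?a i0) \<le> E * K3 * 3 ^ ?d / (1 + L)"
      proof (rule norm_sums_le[OF s'])
        fix n
        have "cmod (?a i - (if i = i0 then ?a i0 else 0)) \<le> (E * K3 / (1 + L)) * (1 ^ ?d / (1 + norm (1 *\<^sub>R ivec (e i))) ^ (2 * ?d))" for i
        proof (cases "i = i0")
          case True
          then show ?thesis using E0 K3 L1 by simp
        next
          case False
          then have "e i \<noteq> 0" using i0 by blast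
          then have n1: "1 \<le> norm (ivec (e i))" by (rule norm_ivec_ge_1)
          have n2: "norm (v i) = L * norm (ivec (e i))" using L1 by (simp add: vn)
          have q1: "1 + L \<le> 1 + norm (v i)" unfolding n2 using n1 L1 by (simp add: mult_left_mono[of 1, simplified])
          have q2: "1 + norm (ivec (e i)) \<le> 1 + norm (v i)" unfolding n2 using mult_right_mono[OF L1 norm_ge_zero[of "ivec (e i)"]] by simp
          have "cmod (?a i) \<le> E * decay mu3 (v i)" by (rule uE)
          also have "\<dots> \<le> E * (K3 / (1 + norm (v i)) ^ (2 * ?d + 1))" by (intro mult_left_mono K3 E0) simp
          also have "\<dots> = E * K3 * (1 / ((1 + norm (v i)) ^ (2 * ?d) * (1 + norm (v i))))" by simp
          also have "\<dots> \<le> E * K3 * (1 / ((1 + norm (ivec (e i))) ^ (2 * ?d) * (1 + L)))"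
          proof (intro mult_left_mono divide_left_mono mult_mono power_mono q1 q2)
            show "0 < (1 + norm (v i)) ^ (2 * ?d) * (1 + norm (v i)) * ((1 + norm (ivec (e i))) ^ (2 * ?d) * (1 + L))"
              using L1 by (intro mult_pos_pos zero_less_power) (auto simp: add_pos_nonneg)
          qed (use E0 K3 L1 in auto)
          finally show ?thesis using False by (simp add: mult.commute)
        qed
        then have "(\<Sum>i<n. cmod (?a i - (if i = i0 then ?a i0 else 0))) \<le> (\<Sum>i<n. (E * K3 / (1 + L)) * (1 ^ ?d / (1 + norm (1 *\<^sub>R ivec (e i))) ^ (2 * ?d)))"
          by (rule sum_mono)
        also have "\<dots> \<le> (E * K3 / (1 + L)) * 3 ^ ?d"
          unfolding sum_distrib_left[symmetric] using E0 K3 L1 by (intro mult_left_mono lattice_sum_enum_le e) auto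
        finally show "(\<Sum>i<n. cmod (?a i - (if i = i0 then ?a i0 else 0))) \<le> E * K3 * 3 ^ ?d / (1 + L)" by simp
      qed
      then have "cmod (?a i0) \<le> cmod (u (\<lambda>t. P t * \<psi>' t)) + E * K3 * 3 ^ ?d / (1 + L)"
        using norm_triangle_ineq2[of "?a i0" "u (\<lambda>t. P t * \<psi>' t)"] by (simp add: norm_minus_commute)
      then have "W * cmod (?a i0) \<le> W * (cmod (u (\<lambda>t. P t * \<psi>' t)) + E * K3 * 3 ^ ?d / (1 + L))"
        using W0 by (intro mult_left_mono) auto
      then show ?thesis using b by (simp add: vi0 L_def distrib_left)
    qed
    have "W * cmod (u (\<lambda>t. h' t * \<psi>' t)) \<le> B + W * (E * K3 * 3 ^ ?d / (1 + 2 * pi * real (Suc n)))" for n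
      using main[of "1 / real (Suc n)"] by simp
    moreover have "(\<lambda>n. B + W * (E * K3 * 3 ^ ?d / (1 + 2 * pi * real (Suc n)))) \<longlonglongrightarrow> B + W * 0"
      by (intro tendsto_intros tendsto_divide_0[OF tendsto_const] filterlim_at_top_imp_at_infinity
        filterlim_tendsto_add_at_top[OF tendsto_const] filterlim_tendsto_pos_mult_at_top[OF tendsto_const]
        filterlim_compose[OF filterlim_real_sequentially filterlim_Suc]) simp
    ultimately have "W * cmod (u (\<lambda>t. h' t * \<psi>' t)) \<le> B + W * 0"
      by (intro LIMSEQ_le_const) blast+
    moreover have "(\<lambda>t. h' t * \<psi>' t) = tf_shift x \<xi> (\<lambda>t. h t * \<psi> t)"
      by (simp add: h'_def \<psi>'_def tf_shift_def fun_eq_iff)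
    ultimately show ?thesis by (simp add: W_def STFT_def z)
  qed
  then show "\<exists>C. \<forall>z\<in>\<Gamma>'. exp (lam * \<omega> (norm z)) * cmod (STFT (\<lambda>t. h t * \<psi> t) u z) \<le> C" by blast
qed

end

section \<open>Gabor expansions\<close>

lemma summable_on_product_nonneg:
  fixes a :: "'a \<Rightarrow> real" and b :: "'b \<Rightarrow> real"
  assumes a: "a summable_on UNIV" "\<And>x. a x \<ge> 0" and b: "b summable_on UNIV" "\<And>x. b x \<ge> 0"
  shows "(\<lambda>p. a (fst p) * b (snd p)) summable_on UNIV"
proof (rule nonneg_bdd_above_summable_on)
  show "0 \<le> a (fst p) * b (snd p)" for p using a b by simp
  show "bdd_above (sum (\<lambda>p. a (fst p) * b (snd p)) ` {F. F \<subseteq> UNIV \<and> finite F})"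
  proof (rule bdd_aboveI2)
    fix F :: "('a \<times> 'b) set" assume "F \<in> {F. F \<subseteq> UNIV \<and> finite F}"
    then have F: "finite F" by simp
    have "(\<Sum>p\<in>F. a (fst p) * b (snd p)) \<le> (\<Sum>p\<in>fst ` F \<times> snd ` F. a (fst p) * b (snd p))"
      using F a b by (intro sum_mono2) (auto intro: rev_image_eqI)
    also have "\<dots> = sum a (fst ` F) * sum b (snd ` F)"
      by (simp add: sum_product sum.cartesian_product case_prod_beta)
    also have "\<dots> \<le> infsum a UNIV * infsum b UNIV"
      using F a b by (intro mult_mono finite_sum_le_infsum infsum_nonneg sum_nonneg) auto
    finally show "(\<Sum>p\<in>F. a (fst p) * b (snd p)) \<le> infsum a UNIV * infsum b UNIV" .
  qed
qed

lemma infsum_finite_support: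
  fixes f :: "'a \<Rightarrow> 'b::{comm_monoid_add,t2_space}"
  assumes "finite {x. f x \<noteq> 0}"
  shows "infsum f UNIV = sum f {x. f x \<noteq> 0}" "f summable_on UNIV"
proof -
  have "infsum f UNIV = infsum f {x. f x \<noteq> 0}" by (rule infsum_cong_neutral) auto
  then show "infsum f UNIV = sum f {x. f x \<noteq> 0}" using assms by simp
  have "f summable_on {x. f x \<noteq> 0} \<longleftrightarrow> f summable_on UNIV" by (rule summable_on_cong_neutral) auto
  then show "f summable_on UNIV" using assms by simp
qed

lemma finite_translates:
  fixes g :: "real^'n::finite \<Rightarrow> complex"
  assumes supp: "\<And>t. r < norm t \<Longrightarrow> g t = 0" and \<alpha>: "\<alpha> > 0"
  shows "finite {n. g (t - \<alpha> *\<^sub>R ivec n) \<noteq> 0}"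
proof -
  obtain R where R: "\<And>l. g (t + 0 + \<alpha> *\<^sub>R ivec l) \<noteq> 0 \<Longrightarrow> l \<in> lbox R"
    using compact_support_translates[of \<alpha> r g t, OF \<alpha> supp] zero_in_cube[OF \<alpha>] by blast
  have "{n. g (t - \<alpha> *\<^sub>R ivec n) \<noteq> 0} \<subseteq> uminus ` lbox R"
  proof
    fix n assume "n \<in> {n. g (t - \<alpha> *\<^sub>R ivec n) \<noteq> 0}"
    then have "- n \<in> lbox R" using R[of "- n"] by (simp add: ivec_minus)
    then show "n \<in> uminus ` lbox R" by (intro image_eqI[of _ _ "- n"]) auto
  qed
  then show ?thesis by (rule finite_subset) simp
qed

context weight
begin

text \<open>Since the frequency step varies with \<open>n\<close>, the summable majorant must not
  involve it; replacing the step by its lower bound \<open>b1\<close> achieves this. The exponent 4d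
  is shared equally between the two components.\<close>

lemma exp_weight_lattice:
  fixes \<alpha> b1 :: real
  assumes \<alpha>: "\<alpha> > 0" and b1: "b1 > 0"
  shows "\<exists>mu S. mu > 0 \<and> (S :: (int^'n::finite) \<times> (int^'n) \<Rightarrow> real) summable_on UNIV \<and> (\<forall>p. S p \<ge> 0) \<and>
     (\<forall>n m b. b1 \<le> b \<longrightarrow> decay mu (\<alpha> *\<^sub>R ivec n, b *\<^sub>R ivec m) \<le> S (n, m))"
proof -
  let ?d = "CARD('n)"
  obtain mu K where mu: "mu > 0" and K0: "K > 0" and K: "\<And>t. t \<ge> 0 \<Longrightarrow> exp (- (mu * \<omega> t)) \<le> K / (1 + t) ^ (2 * ?d + 2 * ?d)"
    using exp_weight_le_inverse_power by metis
  define a where "a k m = 1 / (1 + norm (k *\<^sub>R ivec m)) ^ (2 * ?d)" for k and m :: "int^'n"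
  define S where "S p = K * (a \<alpha> (fst p) * a b1 (snd p))" for p
  have "S summable_on UNIV"
    unfolding S_def a_def using \<alpha> b1
    by (intro summable_on_cmult_right summable_on_product_nonneg lattice_summable) auto
  moreover have "S p \<ge> 0" for p using K0 by (simp add: S_def a_def)
  moreover have "decay mu (\<alpha> *\<^sub>R ivec n, b *\<^sub>R ivec m) \<le> S (n, m)" if b: "b1 \<le> b" for n m b
  proof -
    let ?z = "(\<alpha> *\<^sub>R ivec n, b *\<^sub>R ivec m)"
    have z1: "norm (\<alpha> *\<^sub>R ivec n) \<le> norm ?z" by (rule norm_fst_le)
    have "norm (b1 *\<^sub>R ivec m) \<le> norm (b *\<^sub>R ivec m)" using b b1 by (simp add: mult_right_mono)
    also have "\<dots> \<le> norm ?z" by (rule norm_snd_le)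
    finally have z2: "norm (b1 *\<^sub>R ivec m) \<le> norm ?z" .
    have "decay mu ?z \<le> K / ((1 + norm ?z) ^ (2 * ?d) * (1 + norm ?z) ^ (2 * ?d))"
      using K[of "norm ?z"] by (simp only: power_add norm_ge_zero)
    also have "\<dots> \<le> K / ((1 + norm (\<alpha> *\<^sub>R ivec n)) ^ (2 * ?d) * (1 + norm (b1 *\<^sub>R ivec m)) ^ (2 * ?d))"
      using K0 z1 z2 by (intro divide_left_mono mult_mono power_mono add_left_mono mult_pos_pos zero_less_power)
        (auto simp del: norm_scaleR simp: add_pos_nonneg)
    finally show ?thesis by (simp add: S_def a_def)
  qed
  ultimately show ?thesis using mu by blast
qed

text \<open>Smoothness of \<gamma> is not claimed: continuity, compact support inherited from
  \<open>g\<close>, and weighted decay of \<gamma> and its transform are what the expansion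
  requires. The transform decays because 1 / G is a multiplier for every exponent.\<close>

lemma dual_window:
  fixes g :: "real^'n::finite \<Rightarrow> complex"
  assumes g: "g \<in> S_omega \<omega>" and supp: "\<And>t. r < norm t \<Longrightarrow> g t = 0" and \<alpha>: "\<alpha> > 0"
    and c: "c > 0" "\<And>t. c \<le> (\<Sum>\<^sub>\<infinity>n. (cmod (g (t - \<alpha> *\<^sub>R ivec n)))\<^sup>2)"
  shows "\<exists>\<gamma>. continuous_on UNIV \<gamma> \<and> (\<forall>t. g t = 0 \<longrightarrow> \<gamma> t = 0) \<and>
     (\<forall>lam>0. \<exists>C. \<forall>t. cmod (\<gamma> t) \<le> C * decay lam t) \<and>
     (\<forall>lam>0. \<exists>C. \<forall>\<xi>. cmod (FT \<gamma> \<xi>) \<le> C * decay lam \<xi>) \<and>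
     (\<forall>t. ((\<lambda>n. \<gamma> (t - \<alpha> *\<^sub>R ivec n) * g (t - \<alpha> *\<^sub>R ivec n)) has_sum 1) UNIV)"
proof -
  let ?d = "CARD('n)"
  have gc: "continuous_on UNIV g" by (rule S_omega_continuous[OF g])
  have gi: "integrable lborel g" by (rule S_omega_integrable[OF g])
  define gb where "gb t = cnj (g t)" for t
  have gbc: "continuous_on UNIV gb" unfolding gb_def by (intro continuous_intros gc)
  have gbi: "integrable lborel gb" unfolding gb_def using gi by simp
  have gbF: "FT gb \<xi> = cnj (FT g (- \<xi>))" for \<xi> unfolding gb_def[abs_def] by (rule FT_cnj)
  define q where "q t = g t * gb t" for t
  have q: "q t = of_real ((cmod (g t))\<^sup>2)" for t unfolding q_def gb_def by (simp only: complex_norm_square)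
  have qc: "continuous_on UNIV q" unfolding q_def by (intro continuous_intros gc gbc)
  have qs: "r < norm t \<Longrightarrow> q t = 0" for t using supp by (simp add: q_def)
  obtain mu K where mu: "mu > 0" and K0: "K > 0"
    and K: "\<And>x::real^'n. decay mu x \<le> K / (1 + norm x) ^ (2 * ?d)"
    using kernel_weight by blast
  have qF: "\<exists>C. \<forall>\<xi>. cmod (FT q \<xi>) \<le> C * decay lam \<xi>" if lam: "lam > 0" for lam
  proof -
    obtain nu M where nu: "nu > 0" "M > 0"
      and FP: "\<forall>lam\<ge>0. \<forall>C1 C2 r. \<forall>h \<Psi> :: real^'n \<Rightarrow> complex.
     continuous_on UNIV h \<longrightarrow> (\<forall>t. r < norm t \<longrightarrow> h t = 0) \<longrightarrow>
     (\<forall>\<xi>. cmod (FT h \<xi>) \<le> C1 * decay (lam + nu) \<xi>) \<longrightarrow>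
     integrable lborel \<Psi> \<longrightarrow> (\<forall>\<xi>. cmod (FT \<Psi> \<xi>) \<le> C2 * decay lam \<xi>) \<longrightarrow>
     (\<forall>\<xi>. cmod (FT (\<lambda>t. h t * \<Psi> t) \<xi>) \<le> M * C1 * C2 * decay lam \<xi>)"
      using FT_product[where 'n = 'n] by blast
    have "lam + nu > 0" using lam nu by simp
    then obtain C1 where C1: "\<And>\<xi>. cmod (FT g \<xi>) \<le> C1 * decay (lam + nu) \<xi>" using S_omega_bound0[OF g] by blast
    obtain C2 where C2: "\<And>\<xi>. cmod (FT g \<xi>) \<le> C2 * decay lam \<xi>" using S_omega_bound0[OF g lam] by blast
    have "cmod (FT q \<xi>) \<le> M * C1 * C2 * decay lam \<xi>" for \<xi>
      unfolding q_def[abs_def]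
      by (rule FP[rule_format, OF _ gc supp C1 gbi]) (use lam C2[of "- _"] in \<open>auto simp: gbF\<close>)
    then show ?thesis by blast
  qed
  \<comment> \<open>Makes the period \<open>2 * pi / k\<close> of the Fourier series equal to the
    translation step \<open>\<alpha>\<close>.\<close>
  define k where "k = 2 * pi / \<alpha>"
  have k: "k > 0" "2 * pi / k = \<alpha>" using \<alpha> by (auto simp: k_def)
  obtain e :: "nat \<Rightarrow> int^'n" where e: "bij e" using int_vec_enum by blast
  define cf where "cf i = of_real ((k / (2 * pi)) ^ ?d) * FT q (k *\<^sub>R ivec (e i))" for i
  define G where "G t = (\<Sum>\<^sub>\<infinity>n. (cmod (g (t - \<alpha> *\<^sub>R ivec n)))\<^sup>2)" for t
  obtain Cq where Cq: "\<And>\<xi>. cmod (FT q \<xi>) \<le> Cq * decay mu \<xi>" using qF[OF mu] by blast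
  note per = periodization[OF K qc qs Cq k(1) e, folded cf_def, unfolded k(2)]
  have uminus_bij: "bij (uminus :: int^'n \<Rightarrow> int^'n)" by (rule bij_uminus)
  have fin: "finite {n. g (t - \<alpha> *\<^sub>R ivec n) \<noteq> 0}" for t by (rule finite_translates[OF supp \<alpha>])
  have GP: "complex_of_real (G t) = (\<Sum>\<^sub>\<infinity>l. q (t + \<alpha> *\<^sub>R ivec l))" for t
  proof -
    have "(\<Sum>\<^sub>\<infinity>l. q (t + \<alpha> *\<^sub>R ivec l)) = (\<Sum>\<^sub>\<infinity>n. q (t + \<alpha> *\<^sub>R ivec (- n)))"
      by (rule infsum_reindex_bij_betw[OF uminus_bij, symmetric])
    also have "\<dots> = (\<Sum>\<^sub>\<infinity>n. complex_of_real ((cmod (g (t - \<alpha> *\<^sub>R ivec n)))\<^sup>2))"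
      by (simp add: q ivec_minus)
    also have "\<dots> = complex_of_real (G t)"
      unfolding G_def using fin[of t] by (subst (1 2) infsum_finite_support) auto
    finally show ?thesis by simp
  qed
  have Gs: "(\<lambda>i. cf i * cis (k * (ivec (e i) \<bullet> t))) sums complex_of_real (G t)" for t
    unfolding GP by (rule per(2))
  have Gc: "continuous_on UNIV (\<lambda>t. complex_of_real (G t))"
  proof (rule continuous_on_series[OF _ _ per(3) Gs])
    show "continuous_on UNIV (\<lambda>t. cf i * cis (k * (ivec (e i) \<bullet> t)))" for i by (intro continuous_intros)
  qed (simp add: norm_mult)
  have Gb: "c \<le> G t" for t unfolding G_def by (rule c(2))
  have G0: "G t > 0" for t using c(1) Gb[of t] by linarith
  \<comment> \<open>By Poisson summation the Fourier coefficients of G are samples of the transform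
    of |g|^2, so they are summable against every exponential weight; the operator bound may depend
    on the exponent.\<close>
  have mult: "\<exists>M. FT_multiplier lam M (\<lambda>t. complex_of_real (1 / G t))" if lam: "lam > 0" for lam
  proof (rule inverse_multiplier[OF _ k(1) Gs _ c(1) Gb])
    have "lam + mu > 0" using lam mu by simp
    then obtain C where C: "\<And>\<xi>. cmod (FT q \<xi>) \<le> C * decay (lam + mu) \<xi>" using qF by blast
    have C0: "C \<ge> 0" using order_trans[OF norm_ge_zero C[of 0]] by (simp add: zero_le_mult_iff)
    let ?M = "(k / (2 * pi)) ^ ?d * C * K"
    show "summable (\<lambda>i. cmod (cf i) * exp (lam * \<omega> (norm (k *\<^sub>R ivec (e i)))))"
    proof (rule summable_comparison_test'[OF summable_mult[OF summable_on_enum[OF e lattice_summable[OF k(1)]], of ?M], of 0])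
      fix i
      let ?x = "k *\<^sub>R ivec (e i)"
      have "cmod (cf i) * exp (lam * \<omega> (norm ?x)) \<le> (k / (2 * pi)) ^ ?d * (C * decay (lam + mu) ?x) * exp (lam * \<omega> (norm ?x))"
        using k C[of ?x] by (intro mult_right_mono) (auto simp: cf_def norm_mult norm_power norm_divide mult_left_mono)
      also have "\<dots> = (k / (2 * pi)) ^ ?d * C * decay mu ?x"
      proof -
        have "decay (lam + mu) ?x * exp (lam * \<omega> (norm ?x)) = decay mu ?x"
          unfolding exp_add[symmetric] by (simp add: algebra_simps)
        then show ?thesis by (simp only: mult_ac)
      qed
      also have "\<dots> \<le> (k / (2 * pi)) ^ ?d * C * (K / (1 + norm ?x) ^ (2 * ?d))"
        using k C0 by (intro mult_left_mono K) auto
      finally show "norm (cmod (cf i) * exp (lam * \<omega> (norm ?x))) \<le> ?M * (1 / (1 + norm ?x) ^ (2 * ?d))" by simp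
    qed
  qed (use lam in simp)
  define \<gamma> where "\<gamma> t = complex_of_real (1 / G t) * gb t" for t
  have "continuous_on UNIV \<gamma>"
  proof -
    have "continuous_on UNIV (\<lambda>t. gb t / complex_of_real (G t))"
      using G0 by (intro continuous_intros gbc Gc) (metis less_irrefl of_real_eq_0_iff)
    then show ?thesis by (simp add: \<gamma>_def[abs_def])
  qed
  moreover have "\<gamma> t = 0" if "g t = 0" for t using that by (simp add: \<gamma>_def gb_def)
  moreover have "\<exists>C. \<forall>t. cmod (\<gamma> t) \<le> C * decay lam t" if lam: "lam > 0" for lam
  proof -
    obtain C where C: "C \<ge> 0" "\<And>t. cmod (g t) \<le> C * decay lam t" using S_omega_bound0[OF g lam] by blast
    have "cmod (\<gamma> t) \<le> 1 / c * C * decay lam t" for t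
    proof -
      have "cmod (\<gamma> t) = 1 / G t * cmod (g t)" using G0[of t] by (simp add: \<gamma>_def gb_def norm_mult norm_divide)
      also have "\<dots> \<le> 1 / c * (C * decay lam t)"
        using c(1) Gb[of t] G0[of t] by (intro mult_mono C divide_left_mono) auto
      finally show ?thesis by simp
    qed
    then show ?thesis by blast
  qed
  moreover have "\<exists>C. \<forall>\<xi>. cmod (FT \<gamma> \<xi>) \<le> C * decay lam \<xi>" if lam: "lam > 0" for lam
  proof -
    obtain M where M: "FT_multiplier lam M (\<lambda>t. complex_of_real (1 / G t))" using mult[OF lam] by blast
    obtain C where C: "\<And>\<xi>. cmod (FT g \<xi>) \<le> C * decay lam \<xi>" using S_omega_bound0[OF g lam] by blast
    have "cmod (FT gb \<xi>) \<le> C * decay lam \<xi>" for \<xi> using C[of "- \<xi>"] by (simp add: gbF)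
    from FT_multiplierD(4)[OF M gbi this] show ?thesis unfolding \<gamma>_def[abs_def] by blast
  qed
  moreover have "((\<lambda>n. \<gamma> (t - \<alpha> *\<^sub>R ivec n) * g (t - \<alpha> *\<^sub>R ivec n)) has_sum 1) UNIV" for t
  proof -
    have Gper: "G (t - \<alpha> *\<^sub>R ivec n) = G t" for n
    proof -
      have "bij (\<lambda>m. m - n)" by (intro bij_betwI[where g = "\<lambda>m. m + n"]) auto
      from infsum_reindex_bij_betw[OF this, of "\<lambda>m. (cmod (g (t - \<alpha> *\<^sub>R ivec n - \<alpha> *\<^sub>R ivec m)))\<^sup>2"]
      show ?thesis unfolding G_def by (simp add: ivec_diff algebra_simps)
    qed
    have eq: "\<gamma> (t - \<alpha> *\<^sub>R ivec n) * g (t - \<alpha> *\<^sub>R ivec n) = complex_of_real (1 / G t) * of_real ((cmod (g (t - \<alpha> *\<^sub>R ivec n)))\<^sup>2)" for n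
      by (simp only: \<gamma>_def Gper q[symmetric] q_def mult_ac)
    have f': "finite {n. complex_of_real ((cmod (g (t - \<alpha> *\<^sub>R ivec n)))\<^sup>2) \<noteq> 0}" using fin[of t] by simp
    have "((\<lambda>n. complex_of_real ((cmod (g (t - \<alpha> *\<^sub>R ivec n)))\<^sup>2)) has_sum complex_of_real (G t)) UNIV"
    proof -
      have "complex_of_real (G t) = (\<Sum>\<^sub>\<infinity>n. complex_of_real ((cmod (g (t - \<alpha> *\<^sub>R ivec n)))\<^sup>2))"
        unfolding G_def using fin[of t] by (subst (1 2) infsum_finite_support) auto
      then show ?thesis using has_sum_infsum[OF infsum_finite_support(2)[OF f']] by simp
    qed
    from has_sum_cmult_right[OF this, of "complex_of_real (1 / G t)"]
    show ?thesis unfolding eq using G0[of t] by simp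
  qed
  ultimately show ?thesis by blast
qed

text \<open>The coefficients are normalized Fourier coefficients of the shifted \<open>f\<close>
  times a translate of the dual window. Their series gives back a periodization, and multiplication
  by the translate of \<open>g\<close> removes all replicas because the period 2 pi / \<beta> n
  exceeds the sides of the support box. Summing over \<open>n\<close> uses that the products of
  translates add up to 1.\<close>

lemma gabor_expansion:
  fixes f g :: "real^'n::finite \<Rightarrow> complex" and A B :: "real^'n"
  assumes f: "f \<in> S_omega \<omega>" and g: "g \<in> S_omega \<omega>" and supp: "\<And>t j. g t \<noteq> 0 \<Longrightarrow> A $ j \<le> t $ j \<and> t $ j \<le> B $ j"
    and \<alpha>: "\<alpha> > 0" and b1: "b1 > 0" and \<beta>: "\<And>n. b1 \<le> \<beta> n" "\<And>n. \<beta> n \<le> b2" and AB: "\<And>n j. B $ j - A $ j \<le> 1 / \<beta> n"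
    and c: "c > 0" "\<And>t. c \<le> (\<Sum>\<^sub>\<infinity>n. (cmod (g (t - \<alpha> *\<^sub>R ivec n)))\<^sup>2)"
  shows "\<exists>cf. (\<forall>lam>0. \<exists>C\<ge>0. \<forall>x \<xi> m n. cmod (cf x \<xi> n m) \<le>
        C * exp (- (lam * (\<omega> (norm (x - \<alpha> *\<^sub>R ivec n)) + \<omega> (norm (\<xi> - \<beta> n *\<^sub>R ivec m)))))) \<and>
     (\<forall>x \<xi> t. ((\<lambda>p. cf x \<xi> (fst p) (snd p) * gabor g \<alpha> \<beta> (snd p) (fst p) t) has_sum tf_shift x \<xi> f t) UNIV)"
proof -
  let ?d = "CARD('n)"
  define r where "r = (\<Sum>j\<in>UNIV. \<bar>A $ j\<bar> + \<bar>B $ j\<bar>)"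
  have gs: "g t = 0" if "r < norm t" for t
  proof (rule ccontr)
    assume "g t \<noteq> 0"
    then have "\<bar>t $ j\<bar> \<le> \<bar>A $ j\<bar> + \<bar>B $ j\<bar>" for j using supp[of t j] by linarith
    then have "(\<Sum>j\<in>UNIV. \<bar>t $ j\<bar>) \<le> r" unfolding r_def by (intro sum_mono)
    then show False using norm_le_l1_cart[of t] that by linarith
  qed
  obtain \<gamma> where \<gamma>c: "continuous_on UNIV \<gamma>" and \<gamma>0: "\<And>t. g t = 0 \<Longrightarrow> \<gamma> t = 0"
    and \<gamma>b: "\<And>lam. lam > 0 \<Longrightarrow> \<exists>C. \<forall>t. cmod (\<gamma> t) \<le> C * decay lam t"
    and \<gamma>F: "\<And>lam. lam > 0 \<Longrightarrow> \<exists>C. \<forall>\<xi>. cmod (FT \<gamma> \<xi>) \<le> C * decay lam \<xi>"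
    and one: "\<And>t. ((\<lambda>n. \<gamma> (t - \<alpha> *\<^sub>R ivec n) * g (t - \<alpha> *\<^sub>R ivec n)) has_sum 1) UNIV"
    using dual_window[OF g gs \<alpha> c] by blast
  have \<gamma>s: "r < norm t \<Longrightarrow> \<gamma> t = 0" for t using gs \<gamma>0 by blast
  have bpos: "\<beta> n > 0" for n using b1 \<beta>(1)[of n] by linarith
  define hn where "hn x \<xi> n t = tf_shift x \<xi> f t * \<gamma> (t - \<alpha> *\<^sub>R ivec n)" for x \<xi> n t
  define cf where "cf x \<xi> n m = of_real ((\<beta> n / (2 * pi)) ^ ?d) * FT (hn x \<xi> n) (\<beta> n *\<^sub>R ivec m)" for x \<xi> n m
  have FTb: "\<exists>C\<ge>0. \<forall>x \<xi> n \<eta>. cmod (FT (hn x \<xi> n) \<eta>) \<le> C * exp (- (lam * (\<omega> (norm (x - \<alpha> *\<^sub>R ivec n)) + \<omega> (norm (\<xi> - \<eta>)))))"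
    if lam: "lam > 0" for lam
  proof -
    have "\<exists>C\<ge>0. \<forall>v \<xi>. cmod (FT (\<lambda>t. \<gamma> (t - v) * f t) \<xi>) \<le> C * (decay lam v * decay lam \<xi>)"
    proof (rule FT_translate_product[OF \<gamma>c \<gamma>s \<gamma>F \<gamma>b S_omega_measurable[OF f] _ _ lam])
      fix l :: real assume l: "l > 0"
      show "\<exists>C. \<forall>\<xi>. cmod (FT f \<xi>) \<le> C * decay l \<xi>" using S_omega_bound0[OF f l] by blast
      obtain l0 K where l0: "l0 > 0" "K > 0" and K: "\<And>t. t \<ge> 0 \<Longrightarrow> (1 + t) ^ (2 * ?d) \<le> K * exp (l0 * \<omega> t)"
        using power_le_exp_weight by metis
      have "l + l0 > 0" using l l0 by simp
      then obtain C where C: "C \<ge> 0" "\<And>x. cmod (f x) \<le> C * decay (l + l0) x"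
        using S_omega_bound0[OF f] by blast
      have "(1 + norm t) ^ (2 * ?d) * cmod (f t) \<le> K * C * decay l t" for t
      proof -
        have "(1 + norm t) ^ (2 * ?d) * cmod (f t) \<le> (K * exp (l0 * \<omega> (norm t))) * (C * decay (l + l0) t)"
          using l0 by (intro mult_mono K C) auto
        also have "\<dots> = K * C * (exp (l0 * \<omega> (norm t)) * decay (l + l0) t)" by (simp only: mult_ac)
        also have "exp (l0 * \<omega> (norm t)) * decay (l + l0) t = decay l t"
          unfolding exp_add[symmetric] by (simp add: algebra_simps)
        finally show ?thesis .
      qed
      then show "\<exists>C. \<forall>t. (1 + norm t) ^ (2 * ?d) * cmod (f t) \<le> C * decay l t" by blast
    qed
    then obtain C where C: "C \<ge> 0" "\<And>v \<xi>. cmod (FT (\<lambda>t. \<gamma> (t - v) * f t) \<xi>) \<le> C * (decay lam v * decay lam \<xi>)"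
      by blast
    have "cmod (FT (hn x \<xi> n) \<eta>) \<le> C * exp (- (lam * (\<omega> (norm (x - \<alpha> *\<^sub>R ivec n)) + \<omega> (norm (\<xi> - \<eta>)))))" for x \<xi> n \<eta>
    proof -
      \<comment> \<open>Pulling the time-frequency shift out of the product leaves a transform that
        depends on \<open>x\<close> and \<open>\<xi>\<close> only through differences, so the bound
        of \<open>FT_translate_product\<close> becomes uniform in both.\<close>
      let ?v = "\<alpha> *\<^sub>R ivec n - x"
      have "hn x \<xi> n = tf_shift x \<xi> (\<lambda>t. \<gamma> (t - ?v) * f t)"
        by (simp add: hn_def tf_shift_def fun_eq_iff algebra_simps)
      moreover have "(\<lambda>t. \<gamma> (t - ?v) * f t) \<in> borel_measurable borel"
        by (intro borel_measurable_continuous_onI continuous_on_mult S_omega_continuous f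
            continuous_on_compose2[OF \<gamma>c] continuous_intros) auto
      ultimately have "cmod (FT (hn x \<xi> n) \<eta>) = cmod (FT (\<lambda>t. \<gamma> (t - ?v) * f t) (\<eta> - \<xi>))"
        by (simp add: FT_tf_shift norm_mult)
      also have "\<dots> \<le> C * (decay lam ?v * decay lam (\<eta> - \<xi>))" by (rule C)
      also have "\<dots> = C * exp (- (lam * (\<omega> (norm (x - \<alpha> *\<^sub>R ivec n)) + \<omega> (norm (\<xi> - \<eta>)))))"
        by (simp add: exp_add[symmetric] norm_minus_commute algebra_simps)
      finally show ?thesis .
    qed
    then show ?thesis using C(1) by blast
  qed
  have cfb: "\<exists>C\<ge>0. \<forall>x \<xi> m n. cmod (cf x \<xi> n m) \<le> C * exp (- (lam * (\<omega> (norm (x - \<alpha> *\<^sub>R ivec n)) + \<omega> (norm (\<xi> - \<beta> n *\<^sub>R ivec m)))))"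
    if lam: "lam > 0" for lam
  proof -
    obtain C where C: "C \<ge> 0" "\<And>x \<xi> n \<eta>. cmod (FT (hn x \<xi> n) \<eta>) \<le> C * exp (- (lam * (\<omega> (norm (x - \<alpha> *\<^sub>R ivec n)) + \<omega> (norm (\<xi> - \<eta>)))))"
      using FTb[OF lam] by blast
    have "cmod (cf x \<xi> n m) \<le> (b2 / (2 * pi)) ^ ?d * C * exp (- (lam * (\<omega> (norm (x - \<alpha> *\<^sub>R ivec n)) + \<omega> (norm (\<xi> - \<beta> n *\<^sub>R ivec m)))))" for x \<xi> m n
    proof -
      have "cmod (cf x \<xi> n m) = (\<beta> n / (2 * pi)) ^ ?d * cmod (FT (hn x \<xi> n) (\<beta> n *\<^sub>R ivec m))"
        using bpos[of n] by (simp add: cf_def norm_mult norm_power norm_divide)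
      also have "\<dots> \<le> (b2 / (2 * pi)) ^ ?d * (C * exp (- (lam * (\<omega> (norm (x - \<alpha> *\<^sub>R ivec n)) + \<omega> (norm (\<xi> - \<beta> n *\<^sub>R ivec m))))))"
        using bpos[of n] \<beta>(2)[of n] by (intro mult_mono power_mono divide_right_mono C) auto
      finally show ?thesis by (simp only: mult.assoc)
    qed
    moreover have "(b2 / (2 * pi)) ^ ?d * C \<ge> 0" using C(1) bpos \<beta>(2) by (meson divide_nonneg_nonneg less_le_trans less_imp_le mult_nonneg_nonneg zero_le_power pi_ge_zero zero_le_numeral)
    ultimately show ?thesis by blast
  qed
  obtain mu S where mu: "mu > 0" and S: "(S :: (int^'n) \<times> (int^'n) \<Rightarrow> real) summable_on UNIV" "\<And>p. S p \<ge> 0"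
     "\<And>n m b. b1 \<le> b \<Longrightarrow> decay mu (\<alpha> *\<^sub>R ivec n, b *\<^sub>R ivec m) \<le> S (n, m)"
    using exp_weight_lattice[OF \<alpha> b1, where 'n = 'n] by metis
  have shift: "exp (- (mu * (\<omega> (norm (x - y)) + \<omega> (norm (\<xi> - \<eta>))))) \<le> exp (mu * \<omega> (norm (x, \<xi>))) * decay mu (y, \<eta>)" for x y \<xi> \<eta> :: "real^'n"
  proof -
    have "\<omega> (norm (y, \<eta>)) \<le> \<omega> (norm ((x, \<xi>) - (y, \<eta>))) + \<omega> (norm (x, \<xi>))" by (rule weight_norm_diff')
    also have "\<omega> (norm ((x, \<xi>) - (y, \<eta>))) \<le> \<omega> (norm (x - y)) + \<omega> (norm (\<xi> - \<eta>))" using weight_norm_Pair by simp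
    finally have "mu * \<omega> (norm (y, \<eta>)) \<le> mu * (\<omega> (norm (x - y)) + \<omega> (norm (\<xi> - \<eta>)) + \<omega> (norm (x, \<xi>)))" using mu by (intro mult_left_mono) auto
    then show ?thesis by (simp add: exp_add[symmetric] algebra_simps)
  qed
  have exp_cf: "((\<lambda>p. cf x \<xi> (fst p) (snd p) * gabor g \<alpha> \<beta> (snd p) (fst p) t) has_sum tf_shift x \<xi> f t) UNIV" for x \<xi> t
  proof -
    let ?F = "\<lambda>p. cf x \<xi> (fst p) (snd p) * gabor g \<alpha> \<beta> (snd p) (fst p) t"
    obtain C where C: "C \<ge> 0" "\<And>x \<xi> m n. cmod (cf x \<xi> n m) \<le> C * exp (- (mu * (\<omega> (norm (x - \<alpha> *\<^sub>R ivec n)) + \<omega> (norm (\<xi> - \<beta> n *\<^sub>R ivec m)))))"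
      using cfb[OF mu] by blast
    have cS: "cmod (cf x \<xi> n m) \<le> C * exp (mu * \<omega> (norm (x, \<xi>))) * S (n, m)" for n m
    proof -
      have "cmod (cf x \<xi> n m) \<le> C * (exp (mu * \<omega> (norm (x, \<xi>))) * decay mu (\<alpha> *\<^sub>R ivec n, \<beta> n *\<^sub>R ivec m))"
        by (rule order_trans[OF C(2) mult_left_mono[OF shift C(1)]])
      also have "\<dots> \<le> C * (exp (mu * \<omega> (norm (x, \<xi>))) * S (n, m))" by (intro mult_left_mono S \<beta> C(1)) simp
      finally show ?thesis by (simp only: mult.assoc)
    qed
    obtain Mg where Mg: "Mg \<ge> 0" "\<And>t. cmod (g t) \<le> Mg" using bounded_compact_support[OF S_omega_continuous[OF g] gs] by blast
    have sF: "?F summable_on UNIV"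
    proof (rule abs_summable_summable)
      have b: "cmod (?F p) \<le> C * exp (mu * \<omega> (norm (x, \<xi>))) * Mg * S p" for p
      proof -
        have "cmod (?F p) \<le> (C * exp (mu * \<omega> (norm (x, \<xi>))) * S p) * Mg"
          unfolding norm_mult using C(1) S(2) cS[of "fst p" "snd p"] Mg by (intro mult_mono) (auto simp: gabor_def tf_shift_def norm_mult)
        then show ?thesis by (simp only: mult_ac)
      qed
      show "(\<lambda>p. norm (?F p)) summable_on UNIV"
        by (rule summable_on_comparison_test[OF summable_on_cmult_right[OF S(1), of "C * exp (mu * \<omega> (norm (x, \<xi>))) * Mg"]]) (use b in auto)
    qed
    have inner: "((\<lambda>m. ?F (n, m)) has_sum tf_shift x \<xi> f t * (\<gamma> (t - \<alpha> *\<^sub>R ivec n) * g (t - \<alpha> *\<^sub>R ivec n))) UNIV" for n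
    proof -
      define L where "L = 2 * pi / \<beta> n"
      have hc: "continuous_on UNIV (hn x \<xi> n)"
        unfolding hn_def by (intro continuous_on_mult S_omega_continuous S_omega_tf_shift f
            continuous_on_compose2[OF \<gamma>c] continuous_intros) auto
      have hs: "hn x \<xi> n t = 0" if "r + norm (\<alpha> *\<^sub>R ivec n) < norm t" for t
        using \<gamma>s[of "t - \<alpha> *\<^sub>R ivec n"] norm_triangle_sub[of t "\<alpha> *\<^sub>R ivec n"] that by (simp add: hn_def del: norm_scaleR)
      have FTn: "cmod (FT (hn x \<xi> n) (\<beta> n *\<^sub>R ivec m)) = (2 * pi / \<beta> n) ^ ?d * cmod (cf x \<xi> n m)" for m
        using bpos[of n] by (simp add: cf_def norm_mult norm_power norm_divide power_divide)
      \<comment> \<open>Restricting the joint majorant to a fixed \<open>n\<close> supplies the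
        coefficient summability that Poisson summation demands.\<close>
      have Ssec: "(\<lambda>m. S (n, m)) summable_on UNIV"
      proof -
        have "S summable_on (Pair n ` UNIV)" by (rule summable_on_subset_banach[OF S(1)]) simp
        then show ?thesis by (subst (asm) summable_on_reindex) (auto simp: inj_on_def o_def)
      qed
      have sm: "(\<lambda>m. cmod (FT (hn x \<xi> n) (\<beta> n *\<^sub>R ivec m))) summable_on UNIV"
        unfolding FTn
        by (intro summable_on_cmult_right summable_on_comparison_test[OF summable_on_cmult_right[OF Ssec, of "C * exp (mu * \<omega> (norm (x, \<xi>)))"]])
          (use cS in auto)
      note po = poisson_summation(2)[OF bpos[of n] L_def hc hs sm, where s = t]
      have Lc: "complex_of_real ((\<beta> n / (2 * pi)) ^ ?d) * of_real (L ^ ?d) = 1"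
        unfolding of_real_mult[symmetric] power_mult_distrib[symmetric] using bpos[of n] by (simp add: L_def)
      \<comment> \<open>A replica moves some coordinate by at least \<open>L\<close>, and
        \<open>L > 1 / \<beta> n \<ge> B $ j - A $ j\<close>; so at a point where the translate of
        \<open>g\<close> is nonzero all replicas vanish.\<close>
      have sumg: "(\<Sum>\<^sub>\<infinity>l. hn x \<xi> n (t + L *\<^sub>R ivec l)) * g (t - \<alpha> *\<^sub>R ivec n) = hn x \<xi> n t * g (t - \<alpha> *\<^sub>R ivec n)"
      proof (cases "g (t - \<alpha> *\<^sub>R ivec n) = 0")
        case False
        have "hn x \<xi> n (t + L *\<^sub>R ivec l) = 0" if l: "l \<noteq> 0" for l :: "int^'n"
        proof -
          obtain j where j: "l $ j \<noteq> 0" using l by (auto simp: vec_eq_iff)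
          have Lg: "L > 1 / \<beta> n" "L > 0" using bpos[of n] pi_gt3 by (auto simp: L_def divide_strict_right_mono)
          have "1 \<le> \<bar>real_of_int (l $ j)\<bar>" using j by linarith
          then have "L \<le> \<bar>L * real_of_int (l $ j)\<bar>" using Lg by (simp add: abs_mult)
          then have "\<bar>L * real_of_int (l $ j)\<bar> > B $ j - A $ j" using Lg AB[of j n] by linarith
          then have "g (t + L *\<^sub>R ivec l - \<alpha> *\<^sub>R ivec n) = 0"
            using supp[OF False, of j] supp[of "t + L *\<^sub>R ivec l - \<alpha> *\<^sub>R ivec n" j] by (force simp: abs_less_iff)
          then show ?thesis by (simp add: hn_def \<gamma>0)
        qed
        then have "(\<Sum>\<^sub>\<infinity>l. hn x \<xi> n (t + L *\<^sub>R ivec l)) = (\<Sum>\<^sub>\<infinity>l\<in>{0}. hn x \<xi> n (t + L *\<^sub>R ivec l))"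
          by (intro infsum_cong_neutral) auto
        then show ?thesis by simp
      qed simp
      have "((\<lambda>m. (of_real ((\<beta> n / (2 * pi)) ^ ?d) * g (t - \<alpha> *\<^sub>R ivec n)) * (FT (hn x \<xi> n) (\<beta> n *\<^sub>R ivec m) * cis (\<beta> n * (ivec m \<bullet> t))))
          has_sum (of_real ((\<beta> n / (2 * pi)) ^ ?d) * g (t - \<alpha> *\<^sub>R ivec n)) * (of_real (L ^ ?d) * (\<Sum>\<^sub>\<infinity>l. hn x \<xi> n (t + L *\<^sub>R ivec l)))) UNIV"
        by (rule has_sum_cmult_right[OF po])
      moreover have "(of_real ((\<beta> n / (2 * pi)) ^ ?d) * g (t - \<alpha> *\<^sub>R ivec n)) * (FT (hn x \<xi> n) (\<beta> n *\<^sub>R ivec m) * cis (\<beta> n * (ivec m \<bullet> t))) = ?F (n, m)" for m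
        by (simp add: cf_def gabor_def tf_shift_def inner_commute mult_ac)
      moreover have "(of_real ((\<beta> n / (2 * pi)) ^ ?d) * g (t - \<alpha> *\<^sub>R ivec n)) * (of_real (L ^ ?d) * (\<Sum>\<^sub>\<infinity>l. hn x \<xi> n (t + L *\<^sub>R ivec l)))
         = tf_shift x \<xi> f t * (\<gamma> (t - \<alpha> *\<^sub>R ivec n) * g (t - \<alpha> *\<^sub>R ivec n))"
      proof -
        have "(of_real ((\<beta> n / (2 * pi)) ^ ?d) * g (t - \<alpha> *\<^sub>R ivec n)) * (of_real (L ^ ?d) * (\<Sum>\<^sub>\<infinity>l. hn x \<xi> n (t + L *\<^sub>R ivec l)))
          = (complex_of_real ((\<beta> n / (2 * pi)) ^ ?d) * of_real (L ^ ?d)) * ((\<Sum>\<^sub>\<infinity>l. hn x \<xi> n (t + L *\<^sub>R ivec l)) * g (t - \<alpha> *\<^sub>R ivec n))"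
          by (simp only: mult_ac)
        then show ?thesis unfolding Lc sumg by (simp add: hn_def mult.assoc)
      qed
      ultimately show ?thesis by (simp only:)
    qed
    \<comment> \<open>Fubini for an absolutely summable family: first over frequencies, which gives
      \<open>inner\<close>, then over translations.\<close>
    have "infsum ?F UNIV = (\<Sum>\<^sub>\<infinity>n. \<Sum>\<^sub>\<infinity>m. ?F (n, m))"
      using infsum_Sigma_banach[of ?F UNIV "\<lambda>_. UNIV"] sF by (simp add: UNIV_Times_UNIV)
    also have "\<dots> = (\<Sum>\<^sub>\<infinity>n. tf_shift x \<xi> f t * (\<gamma> (t - \<alpha> *\<^sub>R ivec n) * g (t - \<alpha> *\<^sub>R ivec n)))"
      using infsumI[OF inner] by (simp only:)
    also have "\<dots> = tf_shift x \<xi> f t"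
      using infsumI[OF has_sum_cmult_right[OF one[of t], of "tf_shift x \<xi> f t"]] by simp
    finally show ?thesis using has_sum_infsum[OF sF] by simp
  qed
  show ?thesis using cfb exp_cf by blast
qed

text \<open>The expansion coefficients decay at every rate off the diagonal, so the rate
  \<open>Lam\<close> demanded by \<open>cone_transfer\<close> is available. The lemma serves both
  inclusions: once for the given system, once for an auxiliary window with constant frequency
  step.\<close>

lemma gabor_decay_transfer:
  fixes f g :: "real^'n::finite \<Rightarrow> complex" and A B :: "real^'n" and u :: "(real^'n \<Rightarrow> complex) \<Rightarrow> complex"
  assumes u: "u \<in> S_dual \<omega>"
    and f: "f \<in> S_omega \<omega>" and g: "g \<in> S_omega \<omega>" and supp: "\<And>t j. g t \<noteq> 0 \<Longrightarrow> A $ j \<le> t $ j \<and> t $ j \<le> B $ j"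
    and \<alpha>: "\<alpha> > 0" and b1: "b1 > 0" and \<beta>: "\<And>n. b1 \<le> \<beta> n" "\<And>n. \<beta> n \<le> b2" and AB: "\<And>n j. B $ j - A $ j \<le> 1 / \<beta> n"
    and c: "c > 0" "\<And>t. c \<le> (\<Sum>\<^sub>\<infinity>n. (cmod (g (t - \<alpha> *\<^sub>R ivec n)))\<^sup>2)"
    and V: "rapid_decay_on (\<Gamma> \<inter> {(\<alpha> *\<^sub>R ivec n, \<beta> n *\<^sub>R ivec m) |n m. True}) (STFT g u)"
    and \<epsilon>: "\<epsilon> > 0" "\<And>z w. z \<in> \<Gamma>' \<Longrightarrow> w \<notin> \<Gamma> \<Longrightarrow> \<epsilon> * norm z \<le> norm (z - w) \<and> \<epsilon> * norm w \<le> norm (z - w)"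
  shows "rapid_decay_on \<Gamma>' (STFT f u)"
  unfolding rapid_decay_on_def
proof (intro allI impI)
  fix lam :: real assume lam: "lam > 0"
  have "\<exists>cf. (\<forall>lam>0. \<exists>C\<ge>0. \<forall>x \<xi> m n. cmod (cf x \<xi> n m) \<le>
        C * exp (- (lam * (\<omega> (norm (x - \<alpha> *\<^sub>R ivec n)) + \<omega> (norm (\<xi> - \<beta> n *\<^sub>R ivec m)))))) \<and>
     (\<forall>x \<xi> t. ((\<lambda>p. cf x \<xi> (fst p) (snd p) * gabor g \<alpha> \<beta> (snd p) (fst p) t) has_sum tf_shift x \<xi> f t) UNIV)"
    by (rule gabor_expansion[where \<beta> = \<beta>, OF f g supp \<alpha> b1 \<beta> AB c])
  then obtain cf where cfb: "\<forall>lam>0. \<exists>C\<ge>0. \<forall>x \<xi> m n. cmod (cf x \<xi> n m) \<le>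
        C * exp (- (lam * (\<omega> (norm (x - \<alpha> *\<^sub>R ivec n)) + \<omega> (norm (\<xi> - \<beta> n *\<^sub>R ivec m)))))"
     and cfs: "\<forall>x \<xi> t. ((\<lambda>p. cf x \<xi> (fst p) (snd p) * gabor g \<alpha> \<beta> (snd p) (fst p) t) has_sum tf_shift x \<xi> f t) UNIV"
    by (elim exE conjE)
  obtain mu S where mu: "mu > 0" and S: "(S :: (int^'n) \<times> (int^'n) \<Rightarrow> real) summable_on UNIV" "\<And>p. S p \<ge> 0"
     "\<And>n m b. b1 \<le> b \<Longrightarrow> decay mu (\<alpha> *\<^sub>R ivec n, b *\<^sub>R ivec m) \<le> S (n, m)"
    using exp_weight_lattice[OF \<alpha> b1, where 'n = 'n] by metis
  obtain D nu where gr: "D \<ge> 0" "nu > 0" "\<And>z. cmod (STFT g u z) \<le> D * exp (nu * \<omega> (norm z))"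
    using STFT_growth[OF u g] by blast
  define w where "w p = (\<alpha> *\<^sub>R ivec (fst p), \<beta> (fst p) *\<^sub>R ivec (snd p))" for p :: "(int^'n) \<times> (int^'n)"
  have wS: "decay mu (w p) \<le> S p" for p
    using S(3)[OF \<beta>(1), of "fst p" "fst p" "snd p"] by (simp add: w_def)
  have "\<exists>Lam C. Lam > 0 \<and> C \<ge> 0 \<and> (\<forall>z\<in>\<Gamma>'. \<forall>y\<in>{(\<alpha> *\<^sub>R ivec n, \<beta> n *\<^sub>R ivec m) |n m. True}.
      exp (lam * \<omega> (norm z)) * decay Lam (z - y) * cmod (STFT g u y) \<le> C * decay mu y \<and>
      exp (lam * \<omega> (norm z)) * decay Lam (z - y) * cmod (STFT g u y) \<le> C * decay mu (z - y))"
    by (rule cone_transfer[OF V gr \<epsilon> lam mu])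
  then obtain Lam C where Lam: "Lam > 0" and C: "C \<ge> 0"
    and ct0: "\<forall>z\<in>\<Gamma>'. \<forall>y\<in>{(\<alpha> *\<^sub>R ivec n, \<beta> n *\<^sub>R ivec m) |n m. True}.
      exp (lam * \<omega> (norm z)) * decay Lam (z - y) * cmod (STFT g u y) \<le> C * decay mu y \<and>
      exp (lam * \<omega> (norm z)) * decay Lam (z - y) * cmod (STFT g u y) \<le> C * decay mu (z - y)"
    by (elim exE conjE)
  have ct: "exp (lam * \<omega> (norm z)) * decay Lam (z - w p) * cmod (STFT g u (w p)) \<le> C * decay mu (w p)"
    if "z \<in> \<Gamma>'" for z p
  proof -
    have "w p \<in> {(\<alpha> *\<^sub>R ivec n, \<beta> n *\<^sub>R ivec m) |n m. True}" by (auto simp: w_def)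
    from ct0[rule_format, OF that this] show ?thesis by (rule conjunct1)
  qed
  have cfw: "\<exists>C\<ge>0. \<forall>x \<xi> p. cmod (cf x \<xi> (fst p) (snd p)) \<le> C * decay lam ((x, \<xi>) - w p)" if lam: "lam > 0" for lam
  proof -
    obtain C where C: "C \<ge> 0" "\<And>x \<xi> m n. cmod (cf x \<xi> n m) \<le> C * exp (- (lam * (\<omega> (norm (x - \<alpha> *\<^sub>R ivec n)) + \<omega> (norm (\<xi> - \<beta> n *\<^sub>R ivec m)))))"
      using cfb[rule_format, OF lam] by blast
    have "cmod (cf x \<xi> (fst p) (snd p)) \<le> C * decay lam ((x, \<xi>) - w p)" for x \<xi> p
    proof -
      have "\<omega> (norm ((x, \<xi>) - w p)) \<le> \<omega> (norm (x - \<alpha> *\<^sub>R ivec (fst p))) + \<omega> (norm (\<xi> - \<beta> (fst p) *\<^sub>R ivec (snd p)))"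
        unfolding w_def by (simp add: weight_norm_Pair)
      then have "exp (- (lam * (\<omega> (norm (x - \<alpha> *\<^sub>R ivec (fst p))) + \<omega> (norm (\<xi> - \<beta> (fst p) *\<^sub>R ivec (snd p)))))) \<le> decay lam ((x, \<xi>) - w p)"
        using lam by simp
      then show ?thesis by (rule order_trans[OF C(2) mult_left_mono[OF _ C(1)]])
    qed
    then show ?thesis using C(1) by blast
  qed
  obtain C1 where C1: "C1 \<ge> 0" "\<And>x \<xi> p. cmod (cf x \<xi> (fst p) (snd p)) \<le> C1 * decay Lam ((x, \<xi>) - w p)"
    using cfw[OF Lam] by blast
  obtain e :: "nat \<Rightarrow> (int^'n) \<times> (int^'n)" where e: "bij e" using int_vec_pair_enum by blast
  let ?B = "C1 * C * infsum S UNIV"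
  have "exp (lam * \<omega> (norm z)) * cmod (STFT f u z) \<le> ?B" if z\<Gamma>: "z \<in> \<Gamma>'" for z
  proof -
    obtain x \<xi> where z: "z = (x, \<xi>)" by (cases z)
    let ?W = "exp (lam * \<omega> (norm z))"
    let ?c = "\<lambda>i. cf x \<xi> (fst (e i)) (snd (e i))"
    let ?g = "\<lambda>i. tf_shift (fst (w (e i))) (snd (w (e i))) g"
    have "(\<lambda>i. cnj (?c i) * u (?g i)) sums u (tf_shift x \<xi> f)"
    proof (rule S_dual_cseries[OF u S_omega_tf_shift[OF g]])
      show "(\<lambda>i. ?c i * ?g i t) sums tf_shift x \<xi> f t" for t
        using has_sum_enum[OF e cfs[rule_format, of x \<xi> t]] by (simp add: gabor_def w_def)
      fix l :: real and ks :: "'n list" assume l: "l > 0"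
      obtain C' mu' where C': "C' \<ge> 0" "mu' > 0" and s: "\<And>x \<xi>. semi \<omega> l ks (tf_shift x \<xi> g) \<le> C' * exp (mu' * (\<omega> (norm x) + \<omega> (norm \<xi>)))"
        using semi_tf_shift[OF g l, of "length ks"] by blast
      \<comment> \<open>The part \<open>2 * mu'\<close> beats the growth of the seminorms of shifted
        windows, the part \<open>mu\<close> is kept for summation.\<close>
      let ?l = "2 * mu' + mu"
      have l2: "?l > 0" using C' mu by simp
      obtain C2 where C2: "C2 \<ge> 0" "\<And>x \<xi> p. cmod (cf x \<xi> (fst p) (snd p)) \<le> C2 * decay ?l ((x, \<xi>) - w p)"
        using cfw[OF l2] by blast
      let ?M = "C2 * C' * exp (?l * \<omega> (norm z))"
      show "summable (\<lambda>i. cmod (?c i) * semi \<omega> l ks (?g i))"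
      proof (rule summable_comparison_test'[OF summable_mult[OF summable_on_enum[OF e S(1)], of ?M], of 0])
        fix i
        let ?w = "w (e i)"
        have "decay ?l (z - ?w) \<le> exp (?l * \<omega> (norm z)) * decay ?l ?w"
          using exp_weight_shift[of ?l ?w z] l2 by (simp add: norm_minus_commute)
        then have c1: "cmod (?c i) \<le> C2 * (exp (?l * \<omega> (norm z)) * decay ?l ?w)"
          using order_trans[OF C2(2)[of x \<xi> "e i"] mult_left_mono[OF _ C2(1)]] by (simp add: z)
        have "\<omega> (norm (fst ?w)) \<le> \<omega> (norm ?w)" "\<omega> (norm (snd ?w)) \<le> \<omega> (norm ?w)"
          unfolding w_def by (auto intro!: weight_mono norm_fst_le norm_snd_le simp del: norm_scaleR)
        then have "mu' * (\<omega> (norm (fst ?w)) + \<omega> (norm (snd ?w))) \<le> mu' * (2 * \<omega> (norm ?w))"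
          using C' by (intro mult_left_mono) auto
        then have c2: "semi \<omega> l ks (?g i) \<le> C' * exp (2 * mu' * \<omega> (norm ?w))"
          by (intro order_trans[OF s mult_left_mono[OF _ C'(1)]]) simp
        have "cmod (?c i) * semi \<omega> l ks (?g i) \<le> C2 * (exp (?l * \<omega> (norm z)) * decay ?l ?w) * (C' * exp (2 * mu' * \<omega> (norm ?w)))"
          using C2 by (intro mult_mono c1 c2 semi_ge(3) S_omega_tf_shift g l) auto
        also have "\<dots> = ?M * (decay ?l ?w * exp (2 * mu' * \<omega> (norm ?w)))" by (simp only: mult_ac)
        also have "decay ?l ?w * exp (2 * mu' * \<omega> (norm ?w)) = decay mu ?w"
          unfolding exp_add[symmetric] by (simp add: algebra_simps)
        also have "?M * decay mu ?w \<le> ?M * S (e i)"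
          using C2 C' by (intro mult_left_mono wS) auto
        finally show "norm (cmod (?c i) * semi \<omega> l ks (?g i)) \<le> ?M * S (e i)"
          using semi_ge(3)[OF S_omega_tf_shift[OF g] l] by simp
      qed
    qed
    moreover have "(\<Sum>i<n. cmod (cnj (?c i) * u (?g i))) \<le> ?B / ?W" for n
    proof -
      have t: "?W * cmod (cnj (?c i) * u (?g i)) \<le> C1 * C * S (e i)" for i
      proof -
        have "?W * cmod (cnj (?c i) * u (?g i)) = ?W * cmod (?c i) * cmod (STFT g u (w (e i)))"
          by (simp add: norm_mult STFT_def)
        also have "\<dots> \<le> ?W * (C1 * decay Lam (z - w (e i))) * cmod (STFT g u (w (e i)))"
          unfolding z by (intro mult_right_mono mult_left_mono C1) auto
        also have "\<dots> = C1 * (?W * decay Lam (z - w (e i)) * cmod (STFT g u (w (e i))))"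
          by (simp only: mult_ac)
        also have "\<dots> \<le> C1 * (C * decay mu (w (e i)))"
          by (intro mult_left_mono ct z\<Gamma> C1)
        also have "\<dots> \<le> C1 * (C * S (e i))"
          by (intro mult_left_mono wS C C1)
        finally show ?thesis by (simp only: mult.assoc)
      qed
      have "?W * (\<Sum>i<n. cmod (cnj (?c i) * u (?g i))) \<le> (\<Sum>i<n. C1 * C * S (e i))"
        unfolding sum_distrib_left by (intro sum_mono t)
      also have "\<dots> = C1 * C * (\<Sum>p\<in>e ` {..<n}. S p)"
        using e by (subst sum.reindex) (auto simp: sum_distrib_left intro: inj_on_subset[OF bij_is_inj])
      also have "\<dots> \<le> ?B"
        using C C1 S by (intro mult_left_mono finite_sum_le_infsum) auto
      finally show ?thesis by (simp add: pos_le_divide_eq mult.commute)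
    qed
    ultimately have "cmod (u (tf_shift x \<xi> f)) \<le> ?B / ?W" by (rule norm_sums_le)
    then show ?thesis by (simp add: z STFT_def pos_le_divide_eq mult.commute)
  qed
  then show "\<exists>C. \<forall>z\<in>\<Gamma>'. exp (lam * \<omega> (norm z)) * cmod (STFT f u z) \<le> C" by blast
qed

section \<open>Wave front sets as rapid decay on cones and on sampling points\<close>

lemma WF_stft_iff:
  "z \<in> WF_stft \<omega> \<psi> u \<longleftrightarrow> z \<noteq> 0 \<and> \<not> (\<exists>\<Gamma>. open_cone \<Gamma> \<and> z \<in> \<Gamma> \<and> rapid_decay_on \<Gamma> (STFT \<psi> u))"
  by (simp add: WF_stft_def rapid_decay_on_def bdd_above_def)

text \<open>A Gabor coefficient is the short-time transform with window \<open>g\<close> sampled at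
  the corresponding point, so only the index set differs from the other wave front set.\<close>

lemma WF_gabor_iff:
  fixes \<beta> :: "int^'n::finite \<Rightarrow> real"
  shows "z \<in> WF_gabor \<omega> g \<alpha> \<beta> u \<longleftrightarrow> z \<noteq> 0 \<and> \<not> (\<exists>\<Gamma>. open_cone \<Gamma> \<and> z \<in> \<Gamma> \<and>
     rapid_decay_on (\<Gamma> \<inter> {(\<alpha> *\<^sub>R ivec n, \<beta> n *\<^sub>R ivec m) |n m. True}) (STFT g u))"
proof -
  have "bdd_above {exp (lam * \<omega> (norm (\<alpha> *\<^sub>R ivec n, \<beta> n *\<^sub>R ivec m))) * cmod (u (gabor g \<alpha> \<beta> m n)) |m n. (\<alpha> *\<^sub>R ivec n, \<beta> n *\<^sub>R ivec m) \<in> \<Gamma>}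
     \<longleftrightarrow> (\<exists>C. \<forall>z\<in>\<Gamma> \<inter> {(\<alpha> *\<^sub>R ivec n, \<beta> n *\<^sub>R ivec m) |n m. True}. exp (lam * \<omega> (norm z)) * cmod (STFT g u z) \<le> C)" for lam \<Gamma>
  proof -
    have "(\<forall>y\<in>{F m n |m n. P m n}. y \<le> M) \<longleftrightarrow> (\<forall>m n. P m n \<longrightarrow> F m n \<le> M)" for F :: "int^'n \<Rightarrow> int^'n \<Rightarrow> real" and P M
      by blast
    moreover have "(\<forall>z\<in>\<Gamma> \<inter> {(\<alpha> *\<^sub>R ivec n, \<beta> n *\<^sub>R ivec m) |n m. True}. Q z) \<longleftrightarrow>
        (\<forall>m n. (\<alpha> *\<^sub>R ivec n, \<beta> n *\<^sub>R ivec m) \<in> \<Gamma> \<longrightarrow> Q (\<alpha> *\<^sub>R ivec n, \<beta> n *\<^sub>R ivec m))" for Q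
      by blast
    ultimately show ?thesis
      unfolding bdd_above_def STFT_def gabor_def by (simp only: fst_conv snd_conv)
  qed
  then show ?thesis by (simp add: WF_gabor_def rapid_decay_on_def)
qed

lemma rapid_decay_on_mono: "rapid_decay_on S V \<Longrightarrow> S' \<subseteq> S \<Longrightarrow> rapid_decay_on S' V"
  unfolding rapid_decay_on_def by blast

text \<open>By continuity the window is bounded below on a small ball, and a sufficiently fine
  lattice moves every point into that ball; one term of the sum then suffices.\<close>

lemma fine_lattice_lower_bound:
  fixes g :: "real^'n::finite \<Rightarrow> complex"
  assumes cont: "continuous_on UNIV g" and supp: "\<And>t. r < norm t \<Longrightarrow> g t = 0" and t1: "g t1 \<noteq> 0"
  shows "\<exists>a c. a > 0 \<and> c > 0 \<and> (\<forall>t. c \<le> (\<Sum>\<^sub>\<infinity>n. (cmod (g (t - a *\<^sub>R ivec n)))\<^sup>2))"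
proof -
  define \<rho> where "\<rho> = cmod (g t1) / 2"
  have \<rho>: "\<rho> > 0" using t1 by (simp add: \<rho>_def)
  have "isCont g t1" using cont by (simp add: continuous_on_eq_continuous_at)
  then obtain \<delta> where \<delta>: "\<delta> > 0" "\<And>t. dist t t1 < \<delta> \<Longrightarrow> dist (g t) (g t1) < \<rho>"
    using \<rho> unfolding continuous_at_eps_delta by blast
  have big: "\<rho> \<le> cmod (g t)" if "norm (t - t1) < \<delta>" for t
  proof -
    have "cmod (g t - g t1) < \<rho>" using \<delta>(2)[of t] that by (simp add: dist_norm)
    then show ?thesis using norm_triangle_ineq2[of "g t1" "g t"] by (simp add: \<rho>_def norm_minus_commute)
  qed
  \<comment> \<open>A cube of side \<open>a\<close> around the origin lies in the ball of radius
    \<open>CARD('n) * a / 2 = \<delta> / 2\<close>.\<close>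
  define a where "a = \<delta> / CARD('n)"
  have a: "a > 0" using \<delta> by (simp add: a_def)
  have "\<rho>\<^sup>2 \<le> (\<Sum>\<^sub>\<infinity>n. (cmod (g (t - a *\<^sub>R ivec n)))\<^sup>2)" for t
  proof -
    obtain n :: "int^'n" where n: "(t - t1) - a *\<^sub>R ivec n \<in> cube a" using cube_tiling[OF a, of "t - t1"] by blast
    let ?y = "(t - t1) - a *\<^sub>R ivec n"
    have "norm ?y \<le> (\<Sum>j\<in>UNIV. \<bar>?y $ j\<bar>)" by (rule norm_le_l1_cart)
    also have "\<dots> \<le> (\<Sum>j\<in>(UNIV::'n set). a / 2)"
    proof (rule sum_mono)
      fix j :: 'n
      have "- a / 2 \<le> ?y $ j \<and> ?y $ j < a / 2" using n unfolding cube_def by blast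
      then show "\<bar>?y $ j\<bar> \<le> a / 2" by linarith
    qed
    also have "\<dots> < \<delta>" using \<delta> by (simp add: a_def)
    finally have "\<rho> \<le> cmod (g (t - a *\<^sub>R ivec n))" by (intro big) (simp add: algebra_simps)
    then have "\<rho>\<^sup>2 \<le> (\<Sum>n\<in>{n}. (cmod (g (t - a *\<^sub>R ivec n)))\<^sup>2)" using \<rho> by (simp add: power_mono)
    also have "\<dots> \<le> (\<Sum>\<^sub>\<infinity>n. (cmod (g (t - a *\<^sub>R ivec n)))\<^sup>2)"
      using finite_translates[OF supp a, where t = t]
      by (intro finite_sum_le_infsum infsum_finite_support(2)) auto
    finally show ?thesis .
  qed
  then show ?thesis using a \<rho> by (intro exI[of _ a] exI[of _ "\<rho>\<^sup>2"]) auto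
qed

end

theorem theorem4p5:
  fixes \<omega> :: "real \<Rightarrow> real"
    and g :: "real^'n::finite \<Rightarrow> complex"
    and A B :: "real^'n"
    and \<alpha> :: real
    and \<beta> :: "int^'n \<Rightarrow> real"
    and u :: "(real^'n \<Rightarrow> complex) \<Rightarrow> complex"
    and \<psi> :: "real^'n \<Rightarrow> complex"
  assumes "weight_fn \<omega>"
    and "g \<in> S_omega \<omega>" and "g \<noteq> (\<lambda>t. 0)"
    and "closure {t. g t \<noteq> 0} \<subseteq> {t. \<forall>j. A $ j \<le> t $ j \<and> t $ j \<le> B $ j}"
    and "\<alpha> > 0"
    and "\<forall>n. \<beta> n > 0"
    and "\<forall>n j. B $ j - A $ j \<le> 1 / \<beta> n"
    and "\<exists>c>0. \<forall>t. c \<le> (\<Sum>\<^sub>\<infinity>n. (cmod (g (t - \<alpha> *\<^sub>R ivec n)))\<^sup>2 / \<beta> n ^ CARD('n))"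
    and "\<exists>C. \<forall>t. (\<Sum>\<^sub>\<infinity>n. (cmod (g (t - \<alpha> *\<^sub>R ivec n)))\<^sup>2 / \<beta> n ^ CARD('n)) \<le> C"
    and "u \<in> S_dual \<omega>"
    and "\<psi> \<in> S_omega \<omega>" and "\<psi> \<noteq> (\<lambda>t. 0)"
  shows "WF_stft \<omega> \<psi> u = WF_gabor \<omega> g \<alpha> \<beta> u"
proof -
  interpret weight \<omega> by unfold_locales fact
  note g = assms(2) and \<alpha> = \<open>\<alpha> > 0\<close> and u = assms(10) and \<psi> = assms(11)
  let ?d = "CARD('n)"
  have d1: "1 \<le> ?d" by (simp add: Suc_leI)
  have \<beta>0: "\<beta> n > 0" for n using assms(6) by blast
  have AB: "B $ j - A $ j \<le> 1 / \<beta> n" for n j using assms(7) by blast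
  have supp: "A $ j \<le> t $ j \<and> t $ j \<le> B $ j" if "g t \<noteq> 0" for t j
    using assms(4) closure_subset[of "{t. g t \<noteq> 0}"] that by blast
  define r where "r = (\<Sum>j\<in>UNIV. \<bar>A $ j\<bar> + \<bar>B $ j\<bar>)"
  have gs: "g t = 0" if "r < norm t" for t
  proof (rule ccontr)
    assume "g t \<noteq> 0"
    then have "\<bar>t $ j\<bar> \<le> \<bar>A $ j\<bar> + \<bar>B $ j\<bar>" for j using supp[of t j] by linarith
    then have "(\<Sum>j\<in>UNIV. \<bar>t $ j\<bar>) \<le> r" unfolding r_def by (intro sum_mono)
    then show False using norm_le_l1_cart[of t] that by linarith
  qed
  have gc: "continuous_on UNIV g" by (rule S_omega_continuous[OF g])
  obtain t0 where t0: "g t0 \<noteq> 0" using assms(3) by auto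
  obtain \<delta> where \<delta>: "\<delta> > 0" "\<And>t. norm (t - t0) < \<delta> \<Longrightarrow> g t \<noteq> 0"
  proof -
    have "open {t. g t \<noteq> 0}" using open_Collect_neq[OF gc continuous_on_const] .
    then obtain \<delta> where "\<delta> > 0" "ball t0 \<delta> \<subseteq> {t. g t \<noteq> 0}" using t0 open_contains_ball by blast
    then show ?thesis using that by (force simp: dist_norm norm_minus_commute)
  qed
  \<comment> \<open>The support contains a segment of length \<delta>/2 in every axis direction, so
    every side of the box is at least \<delta>/2; the side condition turns this into an upper bound
    for \<beta> n.\<close>
  define b2 where "b2 = 1 / (\<delta> / 2)"
  have b2: "\<beta> n \<le> b2" for n
  proof -
    obtain j :: 'n where True by blast
    have "g (t0 + (\<delta> / 2) *\<^sub>R axis j 1) \<noteq> 0" using \<delta>(1) by (intro \<delta>(2)) simp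
    from supp[OF this, of j] supp[OF t0, of j] have "\<delta> / 2 \<le> B $ j - A $ j" by (simp add: axis_def)
    then have "\<delta> / 2 \<le> 1 / \<beta> n" using AB[of j n] by linarith
    then show ?thesis using \<delta>(1) \<beta>0[of n] by (simp add: b2_def field_simps)
  qed
  have fin: "finite {n. g (t - \<alpha> *\<^sub>R ivec n) \<noteq> 0}" for t by (rule finite_translates[OF gs \<alpha>])
  have sm: "(\<lambda>n. (cmod (g (t - \<alpha> *\<^sub>R ivec n)))\<^sup>2 / \<beta> n ^ ?d) summable_on UNIV"
      "(\<lambda>n. (cmod (g (t - \<alpha> *\<^sub>R ivec n)))\<^sup>2) summable_on UNIV" for t
    by (intro infsum_finite_support(2) finite_subset[OF _ fin[of t]]; auto)+
  obtain C where C: "\<And>t. (\<Sum>\<^sub>\<infinity>n. (cmod (g (t - \<alpha> *\<^sub>R ivec n)))\<^sup>2 / \<beta> n ^ ?d) \<le> C" using assms(9) by blast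
  \<comment> \<open>Evaluating the bounded sum at \<open>t0 + \<alpha> *\<^sub>R ivec n\<close>
    places the fixed value \<open>g t0\<close> in the \<open>n\<close>-th term, which bounds \<beta>
    n below.\<close>
  have single: "(cmod (g t0))\<^sup>2 / \<beta> n ^ ?d \<le> C" for n
  proof -
    have "(cmod (g t0))\<^sup>2 / \<beta> n ^ ?d = (\<Sum>k\<in>{n}. (cmod (g (t0 + \<alpha> *\<^sub>R ivec n - \<alpha> *\<^sub>R ivec k)))\<^sup>2 / \<beta> k ^ ?d)" by simp
    also have "\<dots> \<le> (\<Sum>\<^sub>\<infinity>k. (cmod (g (t0 + \<alpha> *\<^sub>R ivec n - \<alpha> *\<^sub>R ivec k)))\<^sup>2 / \<beta> k ^ ?d)"
      using less_imp_le[OF \<beta>0] by (intro finite_sum_le_infsum sm) (auto intro!: divide_nonneg_nonneg zero_le_power)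
    also have "\<dots> \<le> C" by (rule C)
    finally show ?thesis .
  qed
  have Cpos: "C > 0"
  proof -
    have "0 < (cmod (g t0))\<^sup>2 / \<beta> 0 ^ ?d" using t0 \<beta>0 by simp
    then show ?thesis using single[of 0] by linarith
  qed
  \<comment> \<open>The bound obtained concerns the \<open>d\<close>-th power of \<beta> n, which is
    below \<beta> n only when \<beta> n is at most 1; the minimum with 1 covers the other
    case.\<close>
  define b1 where "b1 = min 1 ((cmod (g t0))\<^sup>2 / C)"
  have b1: "b1 > 0" "b1 \<le> 1" using t0 Cpos by (auto simp: b1_def)
  have \<beta>1: "b1 \<le> \<beta> n" for n
  proof (cases "\<beta> n \<ge> 1")
    case False
    have "(cmod (g t0))\<^sup>2 / C \<le> \<beta> n ^ ?d" using single[of n] Cpos \<beta>0[of n] by (simp add: field_simps)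
    also have "\<dots> \<le> \<beta> n ^ 1" using False \<beta>0[of n] d1 by (intro power_decreasing) auto
    finally show ?thesis by (simp add: b1_def min_def)
  qed (use b1 in simp)
  obtain c0 where c0: "c0 > 0" "\<And>t. c0 \<le> (\<Sum>\<^sub>\<infinity>n. (cmod (g (t - \<alpha> *\<^sub>R ivec n)))\<^sup>2 / \<beta> n ^ ?d)" using assms(8) by blast
  \<comment> \<open>The lower bound passes to the unweighted sum, whose periodicity the construction
    of the dual window uses.\<close>
  have c: "c0 * b1 ^ ?d > 0" "c0 * b1 ^ ?d \<le> (\<Sum>\<^sub>\<infinity>n. (cmod (g (t - \<alpha> *\<^sub>R ivec n)))\<^sup>2)" for t
  proof -
    show "c0 * b1 ^ ?d > 0" using c0 b1 by simp
    have "c0 \<le> (\<Sum>\<^sub>\<infinity>n. (cmod (g (t - \<alpha> *\<^sub>R ivec n)))\<^sup>2 / \<beta> n ^ ?d)" by (rule c0)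
    also have "\<dots> \<le> (\<Sum>\<^sub>\<infinity>n. (1 / b1 ^ ?d) * (cmod (g (t - \<alpha> *\<^sub>R ivec n)))\<^sup>2)"
    proof (intro infsum_mono sm summable_on_cmult_right)
      fix n
      have "1 / \<beta> n ^ ?d \<le> 1 / b1 ^ ?d"
        using b1 \<beta>1[of n] \<beta>0[of n] by (intro divide_left_mono power_mono) auto
      from mult_right_mono[OF this, of "(cmod (g (t - \<alpha> *\<^sub>R ivec n)))\<^sup>2"]
      show "(cmod (g (t - \<alpha> *\<^sub>R ivec n)))\<^sup>2 / \<beta> n ^ ?d \<le> (1 / b1 ^ ?d) * (cmod (g (t - \<alpha> *\<^sub>R ivec n)))\<^sup>2" by simp
    qed
    also have "\<dots> = (1 / b1 ^ ?d) * (\<Sum>\<^sub>\<infinity>n. (cmod (g (t - \<alpha> *\<^sub>R ivec n)))\<^sup>2)"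
      by (rule infsum_cmult_right) (rule sm)
    finally show "c0 * b1 ^ ?d \<le> (\<Sum>\<^sub>\<infinity>n. (cmod (g (t - \<alpha> *\<^sub>R ivec n)))\<^sup>2)" using b1 by (simp add: field_simps)
  qed
  have gabor_to_stft: "\<exists>\<Gamma>. open_cone \<Gamma> \<and> z \<in> \<Gamma> \<and> rapid_decay_on \<Gamma> (STFT \<psi> u)"
    if \<Gamma>: "open_cone \<Gamma>" "z \<in> \<Gamma>" and V: "rapid_decay_on (\<Gamma> \<inter> {(\<alpha> *\<^sub>R ivec n, \<beta> n *\<^sub>R ivec m) |n m. True}) (STFT g u)" for z \<Gamma>
  proof -
    obtain \<Gamma>' \<epsilon> where \<Gamma>': "open_cone \<Gamma>'" "z \<in> \<Gamma>'" and \<epsilon>: "\<epsilon> > 0"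
      "\<And>z w. z \<in> \<Gamma>' \<Longrightarrow> w \<notin> \<Gamma> \<Longrightarrow> \<epsilon> * norm z \<le> norm (z - w) \<and> \<epsilon> * norm w \<le> norm (z - w)"
      using shrink_open_cone[OF \<Gamma>] by blast
    have "rapid_decay_on \<Gamma>' (STFT \<psi> u)"
      by (rule gabor_decay_transfer[OF u \<psi> g supp \<alpha> b1(1) \<beta>1 b2 AB c V \<epsilon>])
    then show ?thesis using \<Gamma>' by blast
  qed
  have stft_to_gabor: "\<exists>\<Gamma>. open_cone \<Gamma> \<and> z \<in> \<Gamma> \<and> rapid_decay_on (\<Gamma> \<inter> {(\<alpha> *\<^sub>R ivec n, \<beta> n *\<^sub>R ivec m) |n m. True}) (STFT g u)"
    if \<Gamma>: "open_cone \<Gamma>" "z \<in> \<Gamma>" and V: "rapid_decay_on \<Gamma> (STFT \<psi> u)" for z \<Gamma>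
  proof -
    \<comment> \<open>Two shrinkings of the cone: one for passing from \<psi> to the product window,
      one for passing from there to \<open>g\<close>.\<close>
    obtain \<Gamma>1 \<epsilon>1 where \<Gamma>1: "open_cone \<Gamma>1" "z \<in> \<Gamma>1" and \<epsilon>1: "\<epsilon>1 > 0"
      "\<And>z w. z \<in> \<Gamma>1 \<Longrightarrow> w \<notin> \<Gamma> \<Longrightarrow> \<epsilon>1 * norm z \<le> norm (z - w) \<and> \<epsilon>1 * norm w \<le> norm (z - w)"
      using shrink_open_cone[OF \<Gamma>] by blast
    obtain \<Gamma>2 \<epsilon>2 where \<Gamma>2: "open_cone \<Gamma>2" "z \<in> \<Gamma>2" and \<epsilon>2: "\<epsilon>2 > 0"
      "\<And>z w. z \<in> \<Gamma>2 \<Longrightarrow> w \<notin> \<Gamma>1 \<Longrightarrow> \<epsilon>2 * norm z \<le> norm (z - w) \<and> \<epsilon>2 * norm w \<le> norm (z - w)"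
      using shrink_open_cone[OF \<Gamma>1] by blast
    obtain t1 where t1: "\<psi> t1 \<noteq> 0" using assms(12) by auto
    \<comment> \<open>Translating \<open>g\<close> by \<open>s\<close> puts its nonzero value at
      \<open>t0\<close> onto a point where \<psi> does not vanish, so the product window is not
      identically zero.\<close>
    define s where "s = t1 - t0"
    define h where "h t = g (t - s)" for t
    have h: "h \<in> S_omega \<omega>" using S_omega_tf_shift[OF g, of s 0] by (simp add: tf_shift_def[abs_def] h_def[abs_def])
    have hs: "h t = 0" if "r + norm s < norm t" for t
      using gs[of "t - s"] norm_triangle_sub[of t s] that by (simp add: h_def)
    define g1 where "g1 t = h t * \<psi> t" for t
    have g1S: "g1 \<in> S_omega \<omega>" using S_omega_product(1)[OF h \<psi> hs, of _ 0] by (simp add: g1_def[abs_def])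
    have V1: "rapid_decay_on \<Gamma>1 (STFT g1 u)"
      unfolding g1_def[abs_def] by (rule STFT_product_decay[OF u h \<psi> hs V \<epsilon>1])
    have g1s: "g1 t = 0" if "r + norm s < norm t" for t using hs[OF that] by (simp add: g1_def)
    have "g1 t1 \<noteq> 0" using t0 t1 by (simp add: g1_def h_def s_def)
    then obtain a c1 where a: "a > 0" and c1: "c1 > 0" "\<And>t. c1 \<le> (\<Sum>\<^sub>\<infinity>n. (cmod (g1 (t - a *\<^sub>R ivec n)))\<^sup>2)"
      using fine_lattice_lower_bound[OF S_omega_continuous[OF g1S] g1s] by blast
    \<comment> \<open>Any constant step small enough for the box would do; the summand 1 in the
      denominator keeps it defined and positive.\<close>
    define b where "b = 1 / (1 + (\<Sum>j\<in>UNIV. \<bar>B $ j - A $ j\<bar>))"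
    have b: "b > 0" by (simp add: b_def add_pos_nonneg sum_nonneg)
    have AB1: "(B + s) $ j - (A + s) $ j \<le> 1 / b" for j
    proof -
      have "B $ j - A $ j \<le> \<bar>B $ j - A $ j\<bar>" by simp
      also have "\<dots> \<le> (\<Sum>j\<in>UNIV. \<bar>B $ j - A $ j\<bar>)" by (rule member_le_sum) auto
      finally show ?thesis by (simp add: b_def)
    qed
    have supp1: "(A + s) $ j \<le> t $ j \<and> t $ j \<le> (B + s) $ j" if "g1 t \<noteq> 0" for t j
    proof -
      have "g (t - s) \<noteq> 0" using that by (simp add: g1_def h_def)
      from supp[OF this, of j] show ?thesis by (simp add: algebra_simps)
    qed
    \<comment> \<open>Here the roles are exchanged: the auxiliary window generates the system and
      \<open>g\<close> is the function expanded. Decay on the whole cone of course covers its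
      lattice points, whatever the auxiliary steps are.\<close>
    have "rapid_decay_on \<Gamma>2 (STFT g u)"
      by (rule gabor_decay_transfer[where \<beta> = "\<lambda>_. b", OF u g g1S supp1 a b order_refl order_refl AB1 c1 rapid_decay_on_mono[OF V1] \<epsilon>2]) auto
    then have "rapid_decay_on (\<Gamma>2 \<inter> {(\<alpha> *\<^sub>R ivec n, \<beta> n *\<^sub>R ivec m) |n m. True}) (STFT g u)"
      by (rule rapid_decay_on_mono) blast
    then show ?thesis using \<Gamma>2 by blast
  qed
  show ?thesis
    unfolding set_eq_iff WF_stft_iff WF_gabor_iff using gabor_to_stft stft_to_gabor by blast
qed

end
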